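(* Let $N\ge3$, $p=2$, $s\in(1,2]$, $q\in(2,\frac{2N}{N-2})$. Assume that $f:\mathbb{R}\to\mathbb{R}$ is continuous and satisfies, for some constant $c>0$, $$|f(t)|\le c(|t|^{q-1}+|t|^{s-1})\qquad\forall\,t\in\mathbb{R},$$ and that $V\in L^\infty_{loc}(\mathbb{R}^N)$. Let $u\in H^1(\mathbb{R}^N)\cap L^s(\mathbb{R}^N)$ be a weak solution to $$-\Delta u+V(x)u=f(u)\qquad\text{in }\mathbb{R}^N$$ such that the function $x\mapsto V(x)|x||u(x)||\nabla u(x)|$ belongs to $L^1(\mathbb{R}^N)$. Then $u$ satisfies the Pohozaev identity $$\frac{N-2}{2}\int_{\mathbb{R}^N}|\nabla u|^2\,dx-N\int_{\mathbb{R}^N}F(u)\,dx-\int_{\mathbb{R}^N}V(x)u\,(x\cdot\nabla u)\,dx=0,$$ where $F(t):=\int_0^tf(\tau)\,d\tau$.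
   Context: Weak solution is understood in the local sense: $\int_{\mathbb{R}^N}\nabla u\cdot\nabla v\,dx+\int_{\mathbb{R}^N}V(x)uv\,dx=\int_{\mathbb{R}^N}f(u)v\,dx$ for all $v\in C_c^\infty(\mathbb{R}^N)$. *)

theory Defs
  imports "HOL-Analysis.Analysis"
begin

text \<open>
  All measure-theoretic notions refer to Lebesgue measure on the completed sigma-algebra
  (\<open>lebesgue\<close>). Elements of function spaces are represented by functions, not by
  almost-everywhere classes.
\<close>

text \<open>The classical gradient; unspecified at points where \<open>f\<close> is not differentiable.\<close>

definition grad :: "('a::euclidean_space \<Rightarrow> real) \<Rightarrow> 'a \<Rightarrow> 'a" where
  "grad f x = (THE D. GDERIV f x :> D)"

primrec Ck :: "nat \<Rightarrow> ('a::euclidean_space \<Rightarrow> real) \<Rightarrow> bool" where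
  "Ck 0 f \<longleftrightarrow> continuous_on UNIV f"
| "Ck (Suc k) f \<longleftrightarrow>
     (\<forall>x. f differentiable at x) \<and> (\<forall>b\<in>Basis. Ck k (\<lambda>x. grad f x \<bullet> b))"

definition Cc_infinity :: "('a::euclidean_space \<Rightarrow> real) set" where
  "Cc_infinity = {\<phi>. (\<forall>k. Ck k \<phi>) \<and> compact (closure {x. \<phi> x \<noteq> 0})}"

text \<open>Intended for exponents \<open>p > 0\<close> (note \<open>0 powr 0 = 0\<close>).\<close>

definition Lp :: "real \<Rightarrow> ('a::euclidean_space \<Rightarrow> 'b::euclidean_space) set" where
  "Lp p = {u \<in> borel_measurable lebesgue. integrable lebesgue (\<lambda>x. norm (u x) powr p)}"

definition L1_loc :: "('a::euclidean_space \<Rightarrow> 'b::euclidean_space) set" where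
  "L1_loc = {u \<in> borel_measurable lebesgue. \<forall>K. compact K \<longrightarrow> set_integrable lebesgue K u}"

definition Linf_loc :: "('a::euclidean_space \<Rightarrow> real) set" where
  "Linf_loc = {V \<in> borel_measurable lebesgue.
     \<forall>K. compact K \<longrightarrow> (\<exists>C. AE x in lebesgue. x \<in> K \<longrightarrow> \<bar>V x\<bar> \<le> C)}"

text \<open>
  A weak gradient is determined only up to a null set, hence a relation between \<open>u\<close> and
  the representatives \<open>Du\<close> of its weak gradient.
\<close>

definition has_weak_gradient ::
    "('a::euclidean_space \<Rightarrow> real) \<Rightarrow> ('a \<Rightarrow> 'a) \<Rightarrow> bool" where
  "has_weak_gradient u Du \<longleftrightarrow> u \<in> L1_loc \<and> Du \<in> L1_loc \<and>
     (\<forall>\<phi>\<in>Cc_infinity. \<forall>b\<in>Basis.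
        (\<integral>x. u x * (grad \<phi> x \<bullet> b) \<partial>lebesgue) = - (\<integral>x. (Du x \<bullet> b) * \<phi> x \<partial>lebesgue))"

definition H1 :: "('a::euclidean_space \<Rightarrow> real) set" where
  "H1 = {u \<in> Lp 2. \<exists>Du\<in>Lp 2. has_weak_gradient u Du}"

text \<open>
  Weak solutions of \<open>- \<Delta>u + V u = f(u)\<close> on the whole space, where \<open>Du\<close>
  represents the weak gradient of \<open>u\<close>.
\<close>

definition weak_solution ::
    "('a::euclidean_space \<Rightarrow> real) \<Rightarrow> (real \<Rightarrow> real) \<Rightarrow> ('a \<Rightarrow> real) \<Rightarrow> ('a \<Rightarrow> 'a) \<Rightarrow> bool" where
  "weak_solution V f u Du \<longleftrightarrow> has_weak_gradient u Du \<and>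
     (\<forall>v\<in>Cc_infinity.
        (\<integral>x. Du x \<bullet> grad v x \<partial>lebesgue) + (\<integral>x. V x * u x * v x \<partial>lebesgue)
          = (\<integral>x. f (u x) * v x \<partial>lebesgue))"

definition primitive :: "(real \<Rightarrow> real) \<Rightarrow> real \<Rightarrow> real" where
  "primitive f t = (LBINT \<tau>=0..t. f \<tau>)"

end

theory Submission
  imports Defs "HOL-Computational_Algebra.Polynomial"
begin

text \<open>
  Mollify \<open>u\<close> and multiply the mollified equation by \<open>\<phi> (x \<bullet> \<nabla>u)\<close> with a cutoff \<open>\<phi>\<close>: the
  classical divergence identity involves only \<open>\<nabla>u\<close>, so the mollification can be removed as soon as
  the right-hand side \<open>g = f(u) - V u\<close> is locally square integrable, and then the cutoff is removed
  by dominated convergence. Local square integrability of \<open>f(u)\<close> is the only regularity needed. With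
  the mollifier \<open>\<rho>\<^sub>t\<close> chosen so that \<open>\<partial>\<^sub>t \<rho>\<^sub>t = t \<Delta>J\<^sub>t\<close> for a compactly supported \<open>J\<^sub>t\<close>, the equation
  bounds the \<open>t\<close>-derivative of \<open>u * \<rho>\<^sub>t\<close> by averages of \<open>g\<close> and \<open>u\<close> over balls of radius \<open>t\<close>; summing
  over dyadic scales gains integrability, and subcriticality of \<open>q\<close> makes the gain iterate up to
  \<open>u \<in> L\<^bsup>2(q-1)\<^esup>\<close> locally.
\<close>

text \<open>The field \<open>\<phi> (x \<bullet> \<nabla>u)\<close> is no admissible test function:
  \<open>f\<close> is merely continuous and \<open>V\<close> merely bounded on balls, so no second
  derivatives of \<open>u\<close> are at hand. Square integrability of \<open>f(u)\<close> asks for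
  the exponent \<open>2(q-1)\<close>, which for \<open>q\<close> near \<open>2N/(N-2)\<close>
  exceeds what \<open>H^1\<close> provides; hence the iteration. Its arithmetic: averaging over
  balls of radius \<open>t\<close> maps \<open>L^p\<close> to \<open>L^s\<close> with norm of order
  \<open>t^(N(1/s - 1/p))\<close>. After integration over the scales \<open>[t/2, t]\<close>,
  averages of \<open>g\<close> carry the factor \<open>t^2\<close> and averages of \<open>u\<close>
  the factor \<open>t\<close>, so the dyadic sum converges when \<open>1/p - 1/s < 2/N\<close> and
  \<open>1/r - 1/s < 1/N\<close>, the thresholds of the second and first order embeddings. The
  mollified equation has the mollified \<open>g\<close> on the right, not \<open>f\<close> of a
  mollified function. The limit therefore leaves \<open>\<phi> f(u) (x \<bullet> \<nabla>u)\<close>,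
  and turning it into \<open>F(u)\<close> takes a separate weak chain rule, where
  \<open>f(u) \<nabla>u\<close> must be locally integrable: a second use of the square
  integrability. The cutoff disappears because \<open>x \<bullet> \<nabla>\<phi>\<close> is bounded
  uniformly under dilation and tends to \<open>0\<close> pointwise.\<close>

subsection \<open>Flat functions and smooth test functions\<close>

text \<open>The polynomial factor in \<open>1/t\<close> makes this class of functions closed under differentiation.\<close>

definition flat :: "real poly \<Rightarrow> real \<Rightarrow> real" where
  "flat p t = (if t > 0 then poly p (1 / t) * exp (- 1 / t) else 0)"

text \<open>By the chain rule both factors of \<open>poly p (1 / t) * exp (- 1 / t)\<close>
  contribute \<open>1 / t\<^sup>2\<close>, with opposite signs; \<open>[:0, 0, 1:]\<close> is this
  square in the variable \<open>1 / t\<close>.\<close>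

definition flat_deriv :: "real poly \<Rightarrow> real poly" where
  "flat_deriv p = [:0, 0, 1:] * (p - pderiv p)"

lemma flat_nonpos [simp]: "t \<le> 0 \<Longrightarrow> flat p t = 0"
  by (simp add: flat_def)

lemma flat_pos: "t > 0 \<Longrightarrow> flat p t = poly p (1 / t) * exp (- 1 / t)"
  by (simp add: flat_def)

lemma tendsto_poly_div_exp: "((\<lambda>x. poly p x / exp x) \<longlongrightarrow> (0::real)) at_top"
proof -
  have "((\<lambda>x. \<Sum>i\<le>degree p. coeff p i * (x ^ i / exp x)) \<longlongrightarrow> (\<Sum>i\<le>degree p. coeff p i * 0)) at_top"
    by (intro tendsto_sum tendsto_mult tendsto_const tendsto_power_div_exp_0)
  moreover have "(\<lambda>x. \<Sum>i\<le>degree p. coeff p i * (x ^ i / exp x)) = (\<lambda>x. poly p x / exp x)"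
    by (auto simp: poly_altdef sum_divide_distrib)
  ultimately show ?thesis by simp
qed

lemma flat_has_real_derivative:
  "(flat p has_real_derivative flat (flat_deriv p) t) (at t)"
proof (cases t "0::real" rule: linorder_cases)
  case less
  have "((\<lambda>t. 0) has_real_derivative flat (flat_deriv p) t) (at t)" using less by simp
  then show ?thesis
    by (rule has_field_derivative_transform_within_open[of _ _ _ "{..<0}"]) (use less in auto)
next
  case greater
  have "((\<lambda>t. poly p (1 / t) * exp (- 1 / t)) has_real_derivative flat (flat_deriv p) t) (at t)"
    using greater
    by (auto intro!: derivative_eq_intros simp: flat_def flat_deriv_def field_simps power2_eq_square)
  then show ?thesis
    by (rule has_field_derivative_transform_within_open[of _ _ _ "{0<..}"]) (use greater in \<open>auto simp: flat_def\<close>)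
next
  case equal
  \<comment> \<open>At the origin the right difference quotient is
    \<open>1 / h * poly p (1 / h) * exp (- 1 / h)\<close>. The extra factor is
    \<open>pCons 0 p\<close>, and \<open>x = 1 / h\<close> makes it a polynomial over an exponential
    at infinity.\<close>
  have *: "((\<lambda>x. poly (pCons 0 p) x / exp x) \<longlongrightarrow> (0::real)) at_top" by (rule tendsto_poly_div_exp)
  have "filterlim (\<lambda>h::real. 1 / h) at_top (at_right 0)"
    using filterlim_inverse_at_top_right by (simp add: inverse_eq_divide)
  from filterlim_compose[OF * this]
  have "((\<lambda>h. flat p h / h) \<longlongrightarrow> 0) (at_right 0)"
    by (rule Lim_transform_eventually)
       (auto simp: eventually_at_filter flat_def field_simps exp_minus intro!: always_eventually)
  moreover have "((\<lambda>h. flat p h / h) \<longlongrightarrow> 0) (at_left 0)"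
    by (rule Lim_transform_eventually[OF tendsto_const]) (auto simp: eventually_at_filter)
  ultimately have "((\<lambda>h. flat p h / h) \<longlongrightarrow> 0) (at 0)"
    by (simp add: filterlim_split_at)
  then show ?thesis using equal by (simp add: DERIV_def)
qed

lemma continuous_on_flat [continuous_intros]:
  "continuous_on S g \<Longrightarrow> continuous_on S (\<lambda>x. flat p (g x))"
  by (rule continuous_on_compose2[where g="flat p" and t=UNIV])
     (auto intro!: DERIV_continuous_on flat_has_real_derivative)

text \<open>Dependence on \<open>z \<bullet> z\<close> keeps the function smooth at the centre, and
  for \<open>t > 0\<close> the argument of \<open>flat\<close> is positive exactly inside the ball
  of radius \<open>t\<close>. For \<open>t = 0\<close> division by zero makes the function constant,
  so the gradient formula below holds for every \<open>t\<close>.\<close>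

definition bump :: "real poly \<Rightarrow> real \<Rightarrow> 'a::euclidean_space \<Rightarrow> real" where
  "bump p t z = flat p (1 - (z \<bullet> z) / t\<^sup>2)"

lemma bump_eq_0: "t > 0 \<Longrightarrow> norm z \<ge> t \<Longrightarrow> bump p t z = 0"
  unfolding bump_def
  by (rule flat_nonpos) (simp add: field_simps flip: power2_norm_eq_inner)

lemma continuous_on_bump [continuous_intros]:
  "continuous_on S g \<Longrightarrow> continuous_on S (\<lambda>x. bump p t (g x))"
  unfolding bump_def by (cases "t = 0") (auto intro!: continuous_intros)

lemma bump_bounded: "\<exists>B>0. \<forall>t>0. \<forall>z::'a::euclidean_space. \<bar>bump p t z\<bar> \<le> B"
proof -
  have "compact (flat p ` {0..1})"
    by (intro compact_continuous_image continuous_intros) auto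
  then have "bounded (flat p ` {0..1})" by (rule compact_imp_bounded)
  then obtain B where B: "B > 0" "\<forall>x\<in>{0..1}. \<bar>flat p x\<bar> \<le> B"
    unfolding bounded_pos by auto
  have "\<bar>bump p t z\<bar> \<le> B" if "t > 0" for t and z :: 'a
  proof (cases "norm z \<ge> t")
    case True then show ?thesis using B that by (simp add: bump_eq_0)
  next
    case False
    then have "z \<bullet> z \<le> t\<^sup>2" by (simp flip: power2_norm_eq_inner add: power_mono)
    then have "1 - (z \<bullet> z) / t\<^sup>2 \<in> {0..1}" using that by (auto simp: field_simps)
    then show ?thesis using B by (simp add: bump_def)
  qed
  with B show ?thesis by blast
qed

text \<open>The profile depends on the squared distance alone, so differentiation only brings out
  \<open>z - a\<close> and moves \<open>p\<close> to \<open>flat_deriv p\<close>. This stability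
  closes \<open>smooth_fun\<close> under derivatives and produces a mollifier that is itself the
  factor of a gradient.\<close>

lemma bump_GDERIV:
  "GDERIV (\<lambda>z. bump p t (z - a)) z :> (- 2 / t\<^sup>2 * bump (flat_deriv p) t (z - a)) *\<^sub>R (z - a)"
proof -
  have "((\<lambda>z. 1 - ((z - a) \<bullet> (z - a)) / t\<^sup>2) has_derivative (\<lambda>h. h \<bullet> ((- 2 / t\<^sup>2) *\<^sub>R (z - a)))) (at z)"
    by (cases "t = 0") (auto intro!: derivative_eq_intros simp: inner_commute inner_diff_right power2_eq_square fun_eq_iff field_simps)
  then have "GDERIV (\<lambda>z. 1 - ((z - a) \<bullet> (z - a)) / t\<^sup>2) z :> (- 2 / t\<^sup>2) *\<^sub>R (z - a)"
    by (simp add: gderiv_def)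
  from GDERIV_DERIV_compose[OF this flat_has_real_derivative[of p]] show ?thesis
    by (simp add: bump_def mult.commute)
qed

text \<open>A syntactic class holding every test function constructed below and stable under partial
  derivatives, so that \<open>Ck k\<close> for all \<open>k\<close> follows by one
  induction.\<close>

inductive smooth_fun :: "('a::euclidean_space \<Rightarrow> real) \<Rightarrow> bool" where
  const: "smooth_fun (\<lambda>x. c)"
| coord: "smooth_fun (\<lambda>x. x \<bullet> b)"
| bump: "smooth_fun (\<lambda>x. bump p t (x - a))"
| add: "smooth_fun g \<Longrightarrow> smooth_fun h \<Longrightarrow> smooth_fun (\<lambda>x. g x + h x)"
| mult: "smooth_fun g \<Longrightarrow> smooth_fun h \<Longrightarrow> smooth_fun (\<lambda>x. g x * h x)"

lemma smooth_fun_GDERIV_ex: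
  "smooth_fun g \<Longrightarrow> \<exists>D. (\<forall>x. GDERIV g x :> D x) \<and> (\<forall>b. smooth_fun (\<lambda>x. D x \<bullet> b))"
proof (induction rule: smooth_fun.induct)
  case (const c)
  then show ?case
    by (intro exI[of _ "\<lambda>_. 0"]) (auto intro: GDERIV_const smooth_fun.const)
next
  case (coord b)
  show ?case
    by (intro exI[of _ "\<lambda>_. b"]) (auto simp: gderiv_def intro!: derivative_eq_intros smooth_fun.const)
next
  case (bump p t a)
  have "smooth_fun (\<lambda>x. - 2 / t\<^sup>2 * bump (flat_deriv p) t (x - a) * (x \<bullet> b + - (a \<bullet> b)))" for b
    by (intro smooth_fun.intros)
  then show ?case
    by (intro exI[of _ "\<lambda>z. (- 2 / t\<^sup>2 * bump (flat_deriv p) t (z - a)) *\<^sub>R (z - a)"])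
       (use bump_GDERIV[of p t a] in \<open>simp add: inner_diff_left\<close>)
next
  case (add g h)
  then obtain D E where "\<forall>x. GDERIV g x :> D x" "\<forall>b. smooth_fun (\<lambda>x. D x \<bullet> b)"
    "\<forall>x. GDERIV h x :> E x" "\<forall>b. smooth_fun (\<lambda>x. E x \<bullet> b)" by blast
  then show ?case
    by (intro exI[of _ "\<lambda>x. D x + E x"]) (auto intro: GDERIV_add smooth_fun.add simp: inner_add_left)
next
  case (mult g h)
  then obtain D E where "\<forall>x. GDERIV g x :> D x" "\<forall>b. smooth_fun (\<lambda>x. D x \<bullet> b)"
    "\<forall>x. GDERIV h x :> E x" "\<forall>b. smooth_fun (\<lambda>x. E x \<bullet> b)" by blast
  with mult.hyps show ?case
    by (intro exI[of _ "\<lambda>x. g x *\<^sub>R E x + h x *\<^sub>R D x"])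
       (auto intro!: GDERIV_mult smooth_fun.add smooth_fun.mult simp: inner_add_left)
qed

lemma GDERIV_unique: "GDERIV f x :> D \<Longrightarrow> GDERIV f x :> E \<Longrightarrow> D = E"
proof -
  assume "GDERIV f x :> D" "GDERIV f x :> E"
  then have "(\<lambda>h. h \<bullet> D) = (\<lambda>h. h \<bullet> E)"
    unfolding gderiv_def by (rule has_derivative_unique)
  then have "h \<bullet> (D - E) = 0" for h by (metis inner_diff_right right_minus_eq)
  from this[of "D - E"] show ?thesis by simp
qed

lemma grad_eq: "GDERIV f x :> D \<Longrightarrow> grad f x = D"
  unfolding grad_def by (rule the_equality) (auto intro: GDERIV_unique)

lemma smooth_fun_GDERIV: "smooth_fun g \<Longrightarrow> GDERIV g x :> grad g x"
  using smooth_fun_GDERIV_ex grad_eq by metis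

lemma smooth_fun_grad: "smooth_fun g \<Longrightarrow> smooth_fun (\<lambda>x. grad g x \<bullet> b)"
proof -
  assume "smooth_fun g"
  then obtain D where D: "\<forall>x. GDERIV g x :> D x" "\<forall>b. smooth_fun (\<lambda>x. D x \<bullet> b)"
    using smooth_fun_GDERIV_ex by blast
  then have "grad g = D" by (auto intro!: grad_eq)
  with D show ?thesis by simp
qed

lemma smooth_fun_continuous: "smooth_fun g \<Longrightarrow> continuous_on S g"
  using smooth_fun_GDERIV unfolding gderiv_def
  by (metis continuous_at_imp_continuous_on has_derivative_continuous)

lemma smooth_fun_Ck: "smooth_fun g \<Longrightarrow> Ck k g"
proof (induction k arbitrary: g)
  case 0 then show ?case by (simp add: smooth_fun_continuous)
next
  case (Suc k)
  then show ?case
    using smooth_fun_GDERIV smooth_fun_grad unfolding gderiv_def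
    by (auto simp: differentiable_def; blast)
qed

lemma smooth_fun_Cc_infinity:
  assumes "smooth_fun g" "\<And>x. x \<notin> cball a r \<Longrightarrow> g x = 0"
  shows "g \<in> Cc_infinity"
proof -
  have "{x. g x \<noteq> 0} \<subseteq> cball a r" using assms(2) by blast
  then have "bounded {x. g x \<noteq> 0}" by (rule bounded_subset[OF bounded_cball])
  then show ?thesis using smooth_fun_Ck[OF assms(1)]
    by (auto simp: Cc_infinity_def compact_closure)
qed

lemma grad_outside:
  assumes "\<And>x. x \<notin> cball a r \<Longrightarrow> g x = 0" "x \<notin> cball a r"
  shows "grad g x = 0"
proof -
  have "((\<lambda>x. 0::real) has_derivative (\<lambda>h. h \<bullet> 0)) (at x)" by simp
  then have "(g has_derivative (\<lambda>h. h \<bullet> 0)) (at x)"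
    by (rule has_derivative_transform_within_open[of _ _ _ _ "- cball a r"]) (use assms in auto)
  then show ?thesis by (intro grad_eq) (simp add: gderiv_def)
qed

subsection \<open>Kernels and mollification\<close>

text \<open>The mean value theorem bounds every difference quotient by \<open>G\<close>, so
  dominated convergence along an arbitrary sequence of increments gives the derivative.\<close>

lemma has_real_derivative_integral:
  fixes K K' :: "real \<Rightarrow> 'a \<Rightarrow> real"
  assumes d: "d > 0"
    and int: "\<And>t. \<bar>t - t0\<bar> < d \<Longrightarrow> integrable M (K t)"
    and der: "\<And>t y. \<bar>t - t0\<bar> < d \<Longrightarrow> ((\<lambda>t. K t y) has_real_derivative K' t y) (at t)"
    and G: "integrable M G"
    and bd: "\<And>t y. \<bar>t - t0\<bar> < d \<Longrightarrow> \<bar>K' t y\<bar> \<le> G y"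
    and meas: "K' t0 \<in> borel_measurable M"
  shows "((\<lambda>t. LINT y|M. K t y) has_real_derivative (LINT y|M. K' t0 y)) (at t0)"
  unfolding DERIV_def tendsto_at_iff_sequentially
proof (intro allI impI)
  fix X :: "nat \<Rightarrow> real"
  assume X: "\<forall>i. X i \<in> UNIV - {0}" "X \<longlonglongrightarrow> 0"
  \<comment> \<open>Increments outside the admissible interval are replaced by \<open>d / 2\<close>.
    The limit is unchanged, and the domination now holds for every index rather than
    eventually.\<close>
  define Y where "Y i = (if \<bar>X i\<bar> < d then X i else d / 2)" for i
  have ev: "eventually (\<lambda>i. Y i = X i) sequentially"
    using tendstoD[OF X(2) d] by eventually_elim (auto simp: Y_def)
  have Y: "Y i \<noteq> 0" "\<bar>Y i\<bar> < d" for i using X(1) d by (auto simp: Y_def)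
  have Y0: "Y \<longlonglongrightarrow> 0"
    using X(2) by (rule Lim_transform_eventually) (use ev in \<open>simp add: eq_commute\<close>)
  have q: "\<bar>(K (t0 + Y i) y - K t0 y) / Y i\<bar> \<le> G y" for i y
  proof -
    have "\<exists>z. \<bar>z - t0\<bar> < d \<and> K (t0 + Y i) y - K t0 y = Y i * K' z y"
    proof (cases "Y i > 0")
      case True
      obtain z where "t0 < z" "z < t0 + Y i" "K (t0 + Y i) y - K t0 y = (t0 + Y i - t0) * K' z y"
        using MVT2[of t0 "t0 + Y i" "\<lambda>t. K t y" "\<lambda>t. K' t y"] der True Y(2)[of i] by force
      then show ?thesis using Y(2)[of i] by (intro exI[of _ z]) auto
    next
      case False
      then have neg: "Y i < 0" using Y(1)[of i] by simp
      obtain z where "t0 + Y i < z" "z < t0" "K t0 y - K (t0 + Y i) y = (t0 - (t0 + Y i)) * K' z y"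
        using MVT2[of "t0 + Y i" t0 "\<lambda>t. K t y" "\<lambda>t. K' t y"] der neg Y(2)[of i] by force
      then show ?thesis using Y(2)[of i] by (intro exI[of _ z]) auto
    qed
    then obtain z where "\<bar>z - t0\<bar> < d" "K (t0 + Y i) y - K t0 y = Y i * K' z y" by blast
    with bd[of z y] Y(1)[of i] show ?thesis by simp
  qed
  have int': "integrable M (K (t0 + Y i))" for i using Y(2) by (intro int) auto
  have int0: "integrable M (K t0)" using d by (intro int) auto
  have "(\<lambda>i. LINT y|M. (K (t0 + Y i) y - K t0 y) / Y i) \<longlonglongrightarrow> (LINT y|M. K' t0 y)"
  proof (rule integral_dominated_convergence[OF meas _ G])
    show "(\<lambda>y. (K (t0 + Y i) y - K t0 y) / Y i) \<in> borel_measurable M" for i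
      using int'[of i] int0 by (auto intro!: borel_measurable_divide borel_measurable_diff)
    show "AE y in M. (\<lambda>i. (K (t0 + Y i) y - K t0 y) / Y i) \<longlonglongrightarrow> K' t0 y"
    proof (rule AE_I2)
      fix y
      have "((\<lambda>h. (K (t0 + h) y - K t0 y) / h) \<longlongrightarrow> K' t0 y) (at 0)"
        using der[of t0 y] d by (simp add: DERIV_def)
      then show "(\<lambda>i. (K (t0 + Y i) y - K t0 y) / Y i) \<longlonglongrightarrow> K' t0 y"
        using Y0 Y(1) unfolding tendsto_at_iff_sequentially by (auto simp: o_def)
    qed
  qed (use q in auto)
  then have "(\<lambda>i. ((LINT y|M. K (t0 + Y i) y) - (LINT y|M. K t0 y)) / Y i) \<longlonglongrightarrow> (LINT y|M. K' t0 y)"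
    using int' int0 by simp
  then show "((\<lambda>h. ((LINT y|M. K (t0 + h) y) - (LINT y|M. K t0 y)) / h) \<circ> X) \<longlonglongrightarrow> (LINT y|M. K' t0 y)"
    by (rule Lim_transform_eventually) (use ev in \<open>eventually_elim, simp\<close>)
qed

section \<open>Locally integrable functions against compactly supported kernels\<close>

lemma cball_in_lebesgue [measurable]: "cball a r \<in> sets lebesgue"
  by simp

lemma integrable_indicator_cball: "integrable lebesgue (indicator (cball a r) :: 'a::euclidean_space \<Rightarrow> real)"
  by (rule lmeasurable_iff_integrable[THEN iffD1]) simp

lemma integrable_L1_loc_times:
  fixes v :: "'a::euclidean_space \<Rightarrow> real"
  assumes v: "v \<in> L1_loc" and k: "k \<in> borel_measurable lebesgue"
    and bd: "\<And>y. \<bar>k y\<bar> \<le> B" and supp: "\<And>y. y \<notin> cball a r \<Longrightarrow> k y = 0"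
  shows "integrable lebesgue (\<lambda>y. v y * k y)"
proof (rule Bochner_Integration.integrable_bound)
  have "set_integrable lebesgue (cball a r) v" using v by (auto simp: L1_loc_def)
  then show "integrable lebesgue (\<lambda>y. B *\<^sub>R (indicator (cball a r) y *\<^sub>R v y))"
    unfolding set_integrable_def by (rule integrable_scaleR_right)
  have "v \<in> borel_measurable lebesgue" using v by (auto simp: L1_loc_def)
  then show "(\<lambda>y. v y * k y) \<in> borel_measurable lebesgue" using k by measurable
  have "B \<ge> 0" using bd[of a] by linarith
  then show "AE y in lebesgue. norm (v y * k y) \<le> norm (B *\<^sub>R (indicator (cball a r) y *\<^sub>R v y))"
  proof (intro AE_I2)
    fix y
    show "norm (v y * k y) \<le> norm (B *\<^sub>R (indicator (cball a r) y *\<^sub>R v y))"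
    proof (cases "y \<in> cball a r")
      case True
      have "\<bar>k y\<bar> * \<bar>v y\<bar> \<le> B * \<bar>v y\<bar>" using bd by (rule mult_right_mono) simp
      with True \<open>B \<ge> 0\<close> show ?thesis by (simp add: abs_mult mult.commute)
    next
      case False
      then show ?thesis using supp[OF False] by simp
    qed
  qed
qed

lemma integrable_L1_loc_cball:
  fixes v :: "'a::euclidean_space \<Rightarrow> real"
  assumes "v \<in> L1_loc"
  shows "integrable lebesgue (\<lambda>y. v y * (B * indicator (cball a r) y))"
proof -
  have "set_integrable lebesgue (cball a r) v" using assms by (auto simp: L1_loc_def)
  then have "integrable lebesgue (\<lambda>y. B *\<^sub>R (indicator (cball a r) y *\<^sub>R v y))"
    unfolding set_integrable_def by (rule integrable_scaleR_right)
  then show ?thesis by (simp add: ac_simps)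
qed

lemma continuous_lebesgue_measurable:
  fixes k :: "'a::euclidean_space \<Rightarrow> 'b::real_normed_vector"
  shows "continuous_on UNIV k \<Longrightarrow> k \<in> borel_measurable lebesgue"
  by (intro measurable_completion) (simp add: borel_measurable_continuous_onI)

text \<open>The radius is explicit because it tells which values of a locally integrable function a
  convolution can see. Asking only for continuity keeps derivatives of bumps and products with
  cutoffs and mollified functions in the class.\<close>

definition kernel :: "real \<Rightarrow> ('a::euclidean_space \<Rightarrow> real) \<Rightarrow> bool" where
  "kernel r k \<longleftrightarrow> continuous_on UNIV k \<and> (\<forall>z. norm z > r \<longrightarrow> k z = 0)"

lemma kernelI: "continuous_on UNIV k \<Longrightarrow> (\<And>z. norm z > r \<Longrightarrow> k z = 0) \<Longrightarrow> kernel r k"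
  by (simp add: kernel_def)

lemma kernel_mult_left: "continuous_on UNIV g \<Longrightarrow> kernel r k \<Longrightarrow> kernel r (\<lambda>z. g z * k z)"
  by (auto simp: kernel_def intro!: continuous_intros)

lemma kernel_mult_right: "continuous_on UNIV g \<Longrightarrow> kernel r k \<Longrightarrow> kernel r (\<lambda>z. k z * g z)"
  by (auto simp: kernel_def intro!: continuous_intros)

lemma kernel_add: "kernel r k \<Longrightarrow> kernel r l \<Longrightarrow> kernel r (\<lambda>z. k z + l z)"
  by (auto simp: kernel_def intro!: continuous_intros)

lemma kernel_bounded:
  assumes "kernel r k" shows "\<exists>B>0. \<forall>z. \<bar>k z\<bar> \<le> B"
proof -
  have "compact (k ` cball 0 r)"
    using assms by (intro compact_continuous_image) (auto simp: kernel_def intro: continuous_on_subset)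
  then obtain B where B: "B > 0" "\<forall>z\<in>cball 0 r. \<bar>k z\<bar> \<le> B"
    using compact_imp_bounded[of "k ` cball 0 r"] unfolding bounded_pos by auto
  have "\<bar>k z\<bar> \<le> B" for z
    using B assms by (cases "norm z \<le> r") (auto simp: kernel_def)
  with B show ?thesis by blast
qed

lemma kernel_measurable: "kernel r k \<Longrightarrow> k \<in> borel_measurable lebesgue"
  by (auto simp: kernel_def intro: continuous_lebesgue_measurable)

lemma kernel_borel_measurable: "kernel r k \<Longrightarrow> k \<in> borel_measurable borel"
  by (auto simp: kernel_def intro: borel_measurable_continuous_onI)

lemma kernel_shift_measurable:
  assumes "kernel r k" shows "(\<lambda>y. k (y - x)) \<in> borel_measurable lebesgue"
proof -
  have "continuous_on UNIV (\<lambda>y. y - x)" by (intro continuous_intros)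
  then have "continuous_on UNIV (\<lambda>y. k (y - x))"
    using assms unfolding kernel_def by (auto intro: continuous_on_compose2[of UNIV k UNIV "\<lambda>y. y - x"])
  then show ?thesis by (rule continuous_lebesgue_measurable)
qed

lemma L1_loc_one: "(\<lambda>_. 1::real) \<in> L1_loc"
proof -
  have "integrable lebesgue (indicator K :: 'a \<Rightarrow> real)" if "compact K" for K
    using lmeasurable_compact[OF that] lmeasurable_iff_integrable by blast
  then show ?thesis by (simp add: L1_loc_def set_integrable_def)
qed

lemma integrable_L1_loc_kernel:
  fixes v :: "'a::euclidean_space \<Rightarrow> real"
  assumes "v \<in> L1_loc" "kernel r k"
  shows "integrable lebesgue (\<lambda>y. v y * k (y - x))"
proof -
  obtain B where B: "\<forall>z. \<bar>k z\<bar> \<le> B" using kernel_bounded[OF assms(2)] by blast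
  show ?thesis
    using assms B
    by (intro integrable_L1_loc_times[where B = B and a = x and r = r] kernel_shift_measurable)
       (auto simp: kernel_def dist_norm norm_minus_commute)
qed

lemma integrable_kernel: "kernel r k \<Longrightarrow> integrable lebesgue k"
  using integrable_L1_loc_kernel[OF L1_loc_one, of r k 0] by simp

text \<open>The kernel is evaluated at \<open>y - x\<close>, so that derivatives in the integration variable carry no sign.\<close>

definition conv :: "('a::euclidean_space \<Rightarrow> real) \<Rightarrow> ('a \<Rightarrow> real) \<Rightarrow> 'a \<Rightarrow> real" where
  "conv v k x = (LINT y|lebesgue. v y * k (y - x))"

lemma conv_has_derivative:
  fixes v :: "'a::euclidean_space \<Rightarrow> real"
  assumes v: "v \<in> L1_loc" and k: "kernel r k" and D: "\<And>z. GDERIV k z :> D z"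
    and kD: "kernel r (\<lambda>z. D z \<bullet> b)"
  shows "((\<lambda>s. conv v k (x + s *\<^sub>R b)) has_real_derivative
            - conv v (\<lambda>z. D z \<bullet> b) (x + s *\<^sub>R b)) (at s)"
proof -
  obtain B where B: "B > 0" "\<forall>z. \<bar>D z \<bullet> b\<bar> \<le> B" using kernel_bounded[OF kD] by blast
  let ?x = "x + s *\<^sub>R b"
  let ?R = "r + norm b"
  have "((\<lambda>s. LINT y|lebesgue. v y * k (y - (x + s *\<^sub>R b))) has_real_derivative
      (LINT y|lebesgue. v y * - (D (y - (x + s *\<^sub>R b)) \<bullet> b))) (at s)"
  \<comment> \<open>For parameters within \<open>1\<close> of \<open>s\<close> the base point moves
    by at most \<open>norm b\<close>, so all translated kernels live in the ball of radius
    \<open>r + norm b\<close>.\<close>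
  proof (rule has_real_derivative_integral[where d = 1 and G = "\<lambda>y. \<bar>v y * (B * indicator (cball ?x ?R) y)\<bar>"])
    show "integrable lebesgue (\<lambda>y. v y * k (y - (x + t *\<^sub>R b)))" for t
      by (rule integrable_L1_loc_kernel[OF v k])
    have "integrable lebesgue (\<lambda>y. v y * (B * indicator (cball ?x ?R) y))"
      by (rule integrable_L1_loc_cball[OF v])
    then show "integrable lebesgue (\<lambda>y. \<bar>v y * (B * indicator (cball ?x ?R) y)\<bar>)"
      by (rule integrable_abs)
    have "v \<in> borel_measurable lebesgue" using v by (auto simp: L1_loc_def)
    moreover have "(\<lambda>y. D (y - ?x) \<bullet> b) \<in> borel_measurable lebesgue"
      by (rule kernel_shift_measurable[OF kD])
    ultimately show "(\<lambda>y. v y * - (D (y - ?x) \<bullet> b)) \<in> borel_measurable lebesgue"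
      by measurable
  next
    fix t :: real and y :: 'a
    assume t: "\<bar>t - s\<bar> < 1"
    have k': "(k has_derivative (\<lambda>h. h \<bullet> D (y - (x + t *\<^sub>R b)))) (at (y - (x + t *\<^sub>R b)))"
      using D by (simp add: gderiv_def)
    have "((\<lambda>t. y - (x + t *\<^sub>R b)) has_derivative (\<lambda>h. - (h *\<^sub>R b))) (at t)"
      by (auto intro!: derivative_eq_intros)
    from has_derivative_compose[OF this k']
    have "((\<lambda>t. k (y - (x + t *\<^sub>R b))) has_derivative (\<lambda>h. - (h *\<^sub>R b) \<bullet> D (y - (x + t *\<^sub>R b)))) (at t)" .
    then have "((\<lambda>t. k (y - (x + t *\<^sub>R b))) has_real_derivative - (D (y - (x + t *\<^sub>R b)) \<bullet> b)) (at t)"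
      by (rule has_derivative_imp_has_field_derivative) (simp add: inner_commute mult.commute)
    from DERIV_cmult[OF this, of "v y"]
    show "((\<lambda>t. v y * k (y - (x + t *\<^sub>R b))) has_real_derivative v y * - (D (y - (x + t *\<^sub>R b)) \<bullet> b)) (at t)" .
    show "\<bar>v y * - (D (y - (x + t *\<^sub>R b)) \<bullet> b)\<bar> \<le> \<bar>v y * (B * indicator (cball ?x ?R) y)\<bar>"
    proof (cases "y \<in> cball ?x ?R")
      case True
      then show ?thesis using B by (auto simp: abs_mult intro!: mult_left_mono)
    next
      case False
      have "norm (y - ?x) \<le> norm (y - (x + t *\<^sub>R b)) + norm ((t - s) *\<^sub>R b)"
        by (rule order_trans[OF _ norm_triangle_ineq]) (simp add: algebra_simps)
      moreover have "norm ((t - s) *\<^sub>R b) \<le> norm b" using t by (simp add: mult_left_le_one_le)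
      moreover have "norm (y - ?x) > ?R" using False by (simp add: dist_norm norm_minus_commute)
      ultimately have "norm (y - (x + t *\<^sub>R b)) > r" by linarith
      then show ?thesis using kD by (simp add: kernel_def)
    qed
  qed simp
  then show ?thesis by (simp add: conv_def)
qed

lemma conv_continuous:
  fixes v :: "'a::euclidean_space \<Rightarrow> real"
  assumes v: "v \<in> L1_loc" and k: "kernel r k"
  shows "continuous_on UNIV (conv v k)"
proof -
  obtain B where B: "B > 0" "\<forall>z. \<bar>k z\<bar> \<le> B" using kernel_bounded[OF k] by blast
  have vm: "v \<in> borel_measurable lebesgue" using v by (auto simp: L1_loc_def)
  have km: "(\<lambda>y. k (y - x)) \<in> borel_measurable lebesgue" for x
    by (rule kernel_shift_measurable[OF k])
  have "(conv v k \<circ> X) \<longlonglongrightarrow> conv v k x" if X: "X \<longlonglongrightarrow> x" for X and x :: 'a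
  proof -
    have "bounded (range X)" using X convergent_imp_bounded by blast
    then obtain R where R: "\<And>n. norm (X n) \<le> R" unfolding bounded_iff by auto
    have "(\<lambda>n. LINT y|lebesgue. v y * k (y - X n)) \<longlonglongrightarrow> (LINT y|lebesgue. v y * k (y - x))"
    proof (rule integral_dominated_convergence[where w = "\<lambda>y. \<bar>v y * (B * indicator (cball 0 (R + r)) y)\<bar>"])
      show "(\<lambda>y. v y * k (y - x)) \<in> borel_measurable lebesgue" using vm km by measurable
      show "(\<lambda>y. v y * k (y - X n)) \<in> borel_measurable lebesgue" for n using vm km by measurable
      have "integrable lebesgue (\<lambda>y. v y * (B * indicator (cball 0 (R + r)) y))"
        by (rule integrable_L1_loc_cball[OF v])
      then show "integrable lebesgue (\<lambda>y. \<bar>v y * (B * indicator (cball 0 (R + r)) y)\<bar>)"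
        by (rule integrable_abs)
      have "isCont k z" for z using k by (auto simp: kernel_def continuous_on_eq_continuous_at)
      then have "(\<lambda>n. k (y - X n)) \<longlonglongrightarrow> k (y - x)" for y
        by (rule isCont_tendsto_compose) (intro tendsto_intros X)
      then show "AE y in lebesgue. (\<lambda>n. v y * k (y - X n)) \<longlonglongrightarrow> v y * k (y - x)"
        by (intro AE_I2 tendsto_mult tendsto_const)
      show "AE y in lebesgue. norm (v y * k (y - X n)) \<le> \<bar>v y * (B * indicator (cball 0 (R + r)) y)\<bar>" for n
      proof (rule AE_I2)
        fix y
        show "norm (v y * k (y - X n)) \<le> \<bar>v y * (B * indicator (cball 0 (R + r)) y)\<bar>"
        proof (cases "norm y \<le> R + r")
          case True
          then show ?thesis using B by (auto simp: abs_mult intro!: mult_left_mono)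
        next
          case False
          have "norm y \<le> norm (y - X n) + norm (X n)" by (metis diff_add_cancel norm_triangle_ineq)
          with False R[of n] have "norm (y - X n) > r" by linarith
          then show ?thesis using k by (simp add: kernel_def)
        qed
      qed
    qed
    then show ?thesis by (simp add: conv_def o_def)
  qed
  then show ?thesis unfolding continuous_on_sequentially by auto
qed

text \<open>Tonelli together with invariance under reflection and translation. As \<open>G\<close>
  is only Lebesgue measurable, a Borel representative replaces it first, so that the integrand is
  jointly measurable on the product of Borel spaces.\<close>

lemma nn_integral_conv:
  fixes G k :: "'a::euclidean_space \<Rightarrow> ennreal"
  assumes G: "G \<in> borel_measurable lebesgue" and k[measurable]: "k \<in> borel_measurable borel"
  shows "(\<lambda>x. \<integral>\<^sup>+y. G y * k (y - x) \<partial>lebesgue) \<in> borel_measurable borel"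
    and "(\<integral>\<^sup>+x. (\<integral>\<^sup>+y. G y * k (y - x) \<partial>lebesgue) \<partial>lebesgue)
           = (\<integral>\<^sup>+y. G y \<partial>lebesgue) * (\<integral>\<^sup>+z. k z \<partial>lebesgue)"
proof -
  obtain G' where G'[measurable]: "G' \<in> borel_measurable borel" and ae: "AE x in lborel. G x = G' x"
    using completion_ex_borel_measurable[OF G] by auto
  have eq: "(\<integral>\<^sup>+y. G y * k (y - x) \<partial>lebesgue) = (\<integral>\<^sup>+y. G' y * k (y - x) \<partial>lborel)" for x
    unfolding nn_integral_completion by (rule nn_integral_cong_AE) (use ae in eventually_elim, simp)
  show "(\<lambda>x. \<integral>\<^sup>+y. G y * k (y - x) \<partial>lebesgue) \<in> borel_measurable borel"
    unfolding eq by measurable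
  have refl: "(\<integral>\<^sup>+x. k (y - x) \<partial>lborel) = (\<integral>\<^sup>+z. k z \<partial>lborel)" for y
    by (subst (2) lborel_affine[of "-1" y]) (auto simp: nn_integral_density nn_integral_distr)
  have "(\<integral>\<^sup>+x. (\<integral>\<^sup>+y. G' y * k (y - x) \<partial>lborel) \<partial>lborel)
      = (\<integral>\<^sup>+y. (\<integral>\<^sup>+x. G' y * k (y - x) \<partial>lborel) \<partial>lborel)"
    by (rule lborel_pair.Fubini') measurable
  also have "\<dots> = (\<integral>\<^sup>+y. G' y * (\<integral>\<^sup>+z. k z \<partial>lborel) \<partial>lborel)"
    by (simp add: nn_integral_cmult refl)
  also have "\<dots> = (\<integral>\<^sup>+y. G' y \<partial>lborel) * (\<integral>\<^sup>+z. k z \<partial>lborel)"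
    by (rule nn_integral_multc) measurable
  also have "(\<integral>\<^sup>+y. G' y \<partial>lborel) = (\<integral>\<^sup>+y. G y \<partial>lborel)"
    by (rule nn_integral_cong_AE) (use ae in eventually_elim, simp)
  finally show "(\<integral>\<^sup>+x. (\<integral>\<^sup>+y. G y * k (y - x) \<partial>lebesgue) \<partial>lebesgue)
           = (\<integral>\<^sup>+y. G y \<partial>lebesgue) * (\<integral>\<^sup>+z. k z \<partial>lebesgue)"
    unfolding eq unfolding nn_integral_completion .
qed

lemma lebesgue_integral_translate:
  fixes F :: "'a::euclidean_space \<Rightarrow> real"
  assumes [measurable]: "F \<in> borel_measurable borel"
  shows "(LINT y|lebesgue. F (y + c)) = (LINT y|lebesgue. F y)"
proof -
  have "(LINT y|lborel. F y) = (LINT y|lborel. F (c + y))"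
    by (subst lborel_distr_plus[of c, symmetric]) (simp add: integral_distr)
  then show ?thesis by (simp add: integral_completion add.commute)
qed

text \<open>By translation invariance the integral of \<open>F (x + t *\<^sub>R b)\<close> does not
  depend on \<open>t\<close>; its derivative at \<open>0\<close> is the integral of
  \<open>F'\<close>. Integration by parts for mollified functions rests on this alone.\<close>

lemma integral_directional_derivative_eq_0:
  fixes F F' :: "'a::euclidean_space \<Rightarrow> real"
  assumes F: "kernel r F" and F': "kernel r F'"
    and der: "\<And>x. ((\<lambda>s. F (x + s *\<^sub>R b)) has_real_derivative F' x) (at 0)"
  shows "(LINT x|lebesgue. F' x) = 0"
proof -
  obtain B where B: "B > 0" "\<forall>z. \<bar>F' z\<bar> \<le> B" using kernel_bounded[OF F'] by blast
  have [measurable]: "F \<in> borel_measurable borel" by (rule kernel_borel_measurable[OF F])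
  have "((\<lambda>t. LINT y|lebesgue. F (y + t *\<^sub>R b)) has_real_derivative (LINT y|lebesgue. F' (y + 0 *\<^sub>R b))) (at 0)"
  proof (rule has_real_derivative_integral[where d = 1 and G = "\<lambda>y. 1 * (B * indicator (cball 0 (r + norm b)) y)"])
    show "integrable lebesgue (\<lambda>y. F (y + t *\<^sub>R b))" for t
      using integrable_L1_loc_kernel[OF L1_loc_one F, of "- t *\<^sub>R b"] by simp
    show "integrable lebesgue (\<lambda>y. 1 * (B * indicator (cball 0 (r + norm b)) y))"
      by (rule integrable_L1_loc_cball[OF L1_loc_one])
    show "(\<lambda>y. F' (y + 0 *\<^sub>R b)) \<in> borel_measurable lebesgue" using kernel_measurable[OF F'] by simp
  next
    fix t :: real and y :: 'a
    assume t: "\<bar>t - 0\<bar> < 1"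
    have "((\<lambda>s. F (y + t *\<^sub>R b + s *\<^sub>R b)) has_real_derivative F' (y + t *\<^sub>R b)) (at (t - t))"
      using der by simp
    then have "((\<lambda>s. F (y + t *\<^sub>R b + (s - t) *\<^sub>R b)) has_real_derivative F' (y + t *\<^sub>R b)) (at t)"
      using DERIV_shift[of "\<lambda>s. F (y + t *\<^sub>R b + s *\<^sub>R b)" _ t "- t"] by simp
    then show "((\<lambda>t. F (y + t *\<^sub>R b)) has_real_derivative F' (y + t *\<^sub>R b)) (at t)"
      by (simp add: algebra_simps)
    show "\<bar>F' (y + t *\<^sub>R b)\<bar> \<le> 1 * (B * indicator (cball 0 (r + norm b)) y)"
    proof (cases "norm y \<le> r + norm b")
      case True then show ?thesis using B by simp
    next
      case False
      have "norm y \<le> norm (y + t *\<^sub>R b) + norm (t *\<^sub>R b)"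
        using norm_triangle_ineq4[of "y + t *\<^sub>R b" "t *\<^sub>R b"] by simp
      moreover have "norm (t *\<^sub>R b) \<le> norm b" using t by (simp add: mult_left_le_one_le)
      ultimately have "norm (y + t *\<^sub>R b) > r" using False by linarith
      then show ?thesis using F' B by (simp add: kernel_def)
    qed
  qed simp
  then have "((\<lambda>t. LINT y|lebesgue. F y) has_real_derivative (LINT y|lebesgue. F' y)) (at 0)"
    by (simp add: lebesgue_integral_translate)
  from DERIV_unique[OF this DERIV_const] show ?thesis .
qed

subsection \<open>The mollifier\<close>

text \<open>Every \<open>p\<close> is normalised by the mass belonging to
  \<open>flat_deriv 1\<close>. With this common constant differentiation still just exchanges
  \<open>p\<close> for \<open>flat_deriv p\<close>, and mass one is claimed only for
  \<open>rho\<close>.\<close>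

definition moll :: "real poly \<Rightarrow> real \<Rightarrow> 'a::euclidean_space \<Rightarrow> real" where
  "moll p t z = bump p t z / ((LINT x|lebesgue. bump (flat_deriv 1) 1 (x::'a)) * t ^ DIM('a))"

text \<open>With \<open>J\<^sub>t = moll 1 t / 2\<close> the gradient of \<open>J\<^sub>t\<close> at \<open>z\<close> is \<open>- \<rho>\<^sub>t(z) z / t\<^sup>2\<close>, whence \<open>\<partial>\<^sub>t \<rho>\<^sub>t = t \<Delta>J\<^sub>t\<close>.\<close>

definition rho :: "real \<Rightarrow> 'a::euclidean_space \<Rightarrow> real" where
  "rho = moll (flat_deriv 1)"

lemma moll_eq_0: "t > 0 \<Longrightarrow> norm z \<ge> t \<Longrightarrow> moll p t z = 0"
  by (simp add: moll_def bump_eq_0)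

lemma kernel_moll: "t > 0 \<Longrightarrow> kernel t (moll p t)"
  unfolding moll_def[abs_def] divide_inverse
  by (intro kernel_mult_right kernelI continuous_intros) (auto simp: bump_eq_0)

lemma kernel_rho: "t > 0 \<Longrightarrow> kernel t (rho t)"
  by (simp add: rho_def kernel_moll)

lemma kernel_bump: "t > 0 \<Longrightarrow> kernel t (bump p t)"
  by (intro kernelI continuous_intros) (auto simp: bump_eq_0)

lemma smooth_fun_divide: "smooth_fun g \<Longrightarrow> smooth_fun (\<lambda>x. g x / c)"
  using smooth_fun.mult[OF _ smooth_fun.const[of "inverse c"]] by (simp add: divide_inverse)

lemma smooth_fun_moll: "smooth_fun (\<lambda>z. moll p t (z - a))"
  unfolding moll_def by (intro smooth_fun_divide smooth_fun.bump)

lemma smooth_fun_rho_shift: "smooth_fun (\<lambda>z. rho t (z - a))"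
  unfolding rho_def by (rule smooth_fun_moll)

lemma smooth_fun_rho: "smooth_fun (rho t)"
  using smooth_fun_rho_shift[of t 0] by simp

lemma moll_GDERIV: "GDERIV (\<lambda>z. moll p t (z - a)) z :> (- 2 / t\<^sup>2 * moll (flat_deriv p) t (z - a)) *\<^sub>R (z - a)"
proof -
  let ?c = "inverse ((LINT x|lebesgue. bump (flat_deriv 1) 1 (x::'a)) * t ^ DIM('a))"
  show ?thesis
    using GDERIV_mult[OF GDERIV_const[of ?c z] bump_GDERIV[of p t a z]]
    by (simp add: moll_def divide_inverse ac_simps)
qed

lemma flat_deriv_1: "flat_deriv 1 = [:0, 0, 1:]"
  by (simp add: flat_deriv_def)

lemma bump_deriv_1_nonneg: "bump (flat_deriv 1) t z \<ge> 0"
  by (simp add: bump_def flat_def flat_deriv_1)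

text \<open>The polynomial \<open>flat_deriv 1\<close> is the square of the variable, so the bump is
  nonnegative and does not vanish in the open unit ball; mass zero would make that ball a null
  set.\<close>

lemma bump_mass_pos: "(LINT x|lebesgue. bump (flat_deriv 1) 1 (x::'a::euclidean_space)) > 0"
proof -
  let ?f = "\<lambda>x::'a. bump (flat_deriv 1) 1 x"
  have int: "integrable lebesgue ?f" by (rule integrable_kernel[of 1]) (simp add: kernel_bump)
  have "(LINT x|lebesgue. ?f x) \<noteq> 0"
  proof
    assume "(LINT x|lebesgue. ?f x) = 0"
    then have "AE x in lebesgue. ?f x = 0"
      using integral_nonneg_eq_0_iff_AE[OF int] bump_deriv_1_nonneg by auto
    then have "AE x::'a in lborel. \<not> x \<in> ball 0 1"
      unfolding AE_completion_iff
      by eventually_elim (auto simp: bump_def flat_def flat_deriv_1 dot_square_norm abs_square_less_1 abs_square_eq_1)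
    then have "emeasure lborel (ball (0::'a) 1) = 0"
      by (subst (asm) AE_iff_measurable[OF _ refl]) (auto simp: ball_def)
    then show False using emeasure_ball[of 1 "0::'a"] by (simp add: unit_ball_vol_pos less_imp_neq[symmetric])
  qed
  moreover have "(LINT x|lebesgue. ?f x) \<ge> 0" by (simp add: bump_deriv_1_nonneg)
  ultimately show ?thesis by simp
qed

lemma rho_nonneg: "t > 0 \<Longrightarrow> rho t (z::'a::euclidean_space) \<ge> 0"
  using bump_mass_pos[where ?'a='a] by (auto simp: rho_def moll_def bump_deriv_1_nonneg)

lemma integral_rho:
  assumes "t > 0" shows "(LINT z|lebesgue. rho t (z::'a::euclidean_space)) = 1"
proof -
  let ?f = "\<lambda>x::'a. bump (flat_deriv 1) 1 x"
  let ?I = "LINT x|lebesgue. ?f x"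
  have [measurable]: "bump p s \<in> borel_measurable borel" for p s
    by (intro borel_measurable_continuous_onI continuous_intros)
  have eq: "bump (flat_deriv 1) t (t *\<^sub>R x) = ?f x" for x :: 'a
    using assms by (simp add: bump_def power2_eq_square)
  have "(LINT x|lborel. bump (flat_deriv 1) t (x::'a)) = t ^ DIM('a) * (LINT x|lborel. ?f x)"
    using assms
    by (subst lborel_affine[of t "0::'a"]) (auto simp: integral_density integral_distr eq)
  then have "(LINT x|lebesgue. bump (flat_deriv 1) t (x::'a)) = t ^ DIM('a) * ?I"
    by (simp add: integral_completion)
  then show ?thesis using bump_mass_pos[where ?'a='a] assms by (simp add: rho_def moll_def)
qed

lemma integral_rho_shift:
  assumes "t > 0" shows "(LINT y|lebesgue. rho t (y - (x::'a::euclidean_space))) = 1"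
  using lebesgue_integral_translate[of "rho t" "- x"]
    kernel_borel_measurable[OF kernel_rho[OF assms], where ?'a='a]
  by (simp add: integral_rho[OF assms])

lemma integrable_rho_shift:
  "t > 0 \<Longrightarrow> integrable lebesgue (\<lambda>y. rho t (y - (x::'a::euclidean_space)))"
  using integrable_L1_loc_kernel[OF L1_loc_one kernel_rho] by simp

lemma moll_bounded: "\<exists>B>0. \<forall>t>0. \<forall>z::'a::euclidean_space. \<bar>moll p t z\<bar> \<le> B / t ^ DIM('a)"
proof -
  obtain B where B: "B > 0" "\<forall>t>0. \<forall>z::'a. \<bar>bump p t z\<bar> \<le> B" using bump_bounded by blast
  let ?I = "LINT x|lebesgue. bump (flat_deriv 1) 1 (x::'a)"
  have I: "?I > 0" by (rule bump_mass_pos)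
  have "\<bar>moll p t z\<bar> \<le> (B / ?I) / t ^ DIM('a)" if "t > 0" for t and z :: 'a
    using B that I by (simp add: moll_def abs_mult divide_simps)
  with B I show ?thesis by (intro exI[of _ "B / ?I"]) auto
qed

section \<open>The mollifier as a function of its scale\<close>

definition rho_dt :: "real \<Rightarrow> 'a::euclidean_space \<Rightarrow> real" where
  "rho_dt t z = - DIM('a) / t * rho t z + 2 * (z \<bullet> z) / t ^ 3 * moll (flat_deriv (flat_deriv 1)) t z"

text \<open>The first summand of \<open>rho_dt\<close> comes from \<open>t ^ DIM('a)\<close> in the
  denominator, the second from the argument \<open>(z \<bullet> z) / t\<^sup>2\<close> of the
  profile.\<close>

lemma rho_has_derivative_t:
  assumes t: "t > 0"
  shows "((\<lambda>t. rho t (z::'a::euclidean_space)) has_real_derivative rho_dt t z) (at t)"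
proof -
  define I where "I = (LINT x|lebesgue. bump (flat_deriv 1) 1 (x::'a))"
  have I: "I > 0" unfolding I_def by (rule bump_mass_pos)
  define n where "n = DIM('a)"
  have "n * t ^ (n - Suc 0) = n / t * t ^ n" using t by (cases n) auto
  then have "((\<lambda>t. t ^ n) has_real_derivative n / t * t ^ n) (at t)"
    using DERIV_pow[of n t UNIV] by simp
  then have P: "((\<lambda>t. I * t ^ n) has_real_derivative I * (n / t * t ^ n)) (at t)"
    by (rule DERIV_cmult)
  have F: "((\<lambda>t. bump (flat_deriv 1) t z) has_real_derivative
     bump (flat_deriv (flat_deriv 1)) t z * (2 * (z \<bullet> z) / t ^ 3)) (at t)"
    unfolding bump_def by (rule DERIV_chain2[OF flat_has_real_derivative])
       (use t in \<open>auto intro!: derivative_eq_intros simp: power2_eq_square power3_eq_cube field_simps\<close>)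
  have alg: "(f' * q * (I * P) - f * (I * (a * P))) / (I * P * (I * P)) = - a * (f / (I * P)) + q * (f' / (I * P))"
    if "P \<noteq> 0" for f f' q P a :: real using that I by (simp add: field_simps)
  have "((\<lambda>t. bump (flat_deriv 1) t z / (I * t ^ n)) has_real_derivative
     - (n / t) * (bump (flat_deriv 1) t z / (I * t ^ n))
       + 2 * (z \<bullet> z) / t ^ 3 * (bump (flat_deriv (flat_deriv 1)) t z / (I * t ^ n))) (at t)"
    by (rule DERIV_cong[OF DERIV_divide[OF F P]], use I t in simp, rule alg) (use t in simp)
  then show ?thesis by (simp add: rho_def moll_def rho_dt_def I_def n_def)
qed

text \<open>On the support \<open>z \<bullet> z\<close> is at most \<open>t\<^sup>2\<close>, so
  \<open>(z \<bullet> z) / t ^ 3\<close> costs a single factor \<open>1 / t\<close>, the same as the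
  other summand.\<close>

lemma rho_dt_bounded: "\<exists>B>0. \<forall>t>0. \<forall>z::'a::euclidean_space. \<bar>rho_dt t z\<bar> \<le> B / t ^ Suc DIM('a)"
proof -
  obtain B1 where B1: "B1 > 0" "\<forall>t>0. \<forall>z::'a. \<bar>rho t z\<bar> \<le> B1 / t ^ DIM('a)"
    using moll_bounded unfolding rho_def by blast
  obtain B2 where B2: "B2 > 0" "\<forall>t>0. \<forall>z::'a. \<bar>moll (flat_deriv (flat_deriv 1)) t z\<bar> \<le> B2 / t ^ DIM('a)"
    using moll_bounded by blast
  have "\<bar>rho_dt t z\<bar> \<le> (DIM('a) * B1 + 2 * B2) / t ^ Suc DIM('a)" if t: "t > 0" for t and z :: 'a
  proof (cases "norm z \<ge> t")
    case True
    then show ?thesis using t B1 B2 by (simp add: rho_dt_def rho_def moll_eq_0)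
  next
    case False
    then have zz: "z \<bullet> z \<le> t\<^sup>2" by (simp flip: power2_norm_eq_inner add: power_mono)
    have "\<bar>rho_dt t z\<bar> \<le> DIM('a) / t * \<bar>rho t z\<bar> + 2 * (z \<bullet> z) / t ^ 3 * \<bar>moll (flat_deriv (flat_deriv 1)) t z\<bar>"
      unfolding rho_dt_def using t by (intro order_trans[OF abs_triangle_ineq]) (auto simp: abs_mult)
    also have "\<dots> \<le> DIM('a) / t * (B1 / t ^ DIM('a)) + 2 * t\<^sup>2 / t ^ 3 * (B2 / t ^ DIM('a))"
      using t B1 B2 zz by (intro add_mono mult_mono divide_right_mono) auto
    also have "\<dots> = (DIM('a) * B1 + 2 * B2) / t ^ Suc DIM('a)"
      using t by (simp add: field_simps power2_eq_square power3_eq_cube)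
    finally show ?thesis .
  qed
  moreover have "DIM('a) * B1 + 2 * B2 > 0" using B1 B2 by (simp add: add_pos_pos)
  ultimately show ?thesis by blast
qed

lemma kernel_rho_dt: "t > 0 \<Longrightarrow> kernel t (rho_dt t)"
  unfolding rho_dt_def[abs_def] rho_def
  by (intro kernel_add kernel_mult_left kernel_moll continuous_intros) auto

lemma conv_rho_has_derivative_t:
  fixes v :: "'a::euclidean_space \<Rightarrow> real"
  assumes v: "v \<in> L1_loc" and t: "t > 0"
  shows "((\<lambda>t. conv v (rho t) x) has_real_derivative conv v (rho_dt t) x) (at t)"
proof -
  obtain B where B: "B > 0" "\<forall>t>0. \<forall>z::'a. \<bar>rho_dt t z\<bar> \<le> B / t ^ Suc DIM('a)"
    using rho_dt_bounded by blast
  \<comment> \<open>Within distance \<open>t / 2\<close> of \<open>t\<close> the scale stays above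
    \<open>t / 2\<close>, where the bound for \<open>rho_dt\<close> is worst.\<close>
  define C where "C = B / (t / 2) ^ Suc DIM('a)"
  have "((\<lambda>t. LINT y|lebesgue. v y * rho t (y - x)) has_real_derivative (LINT y|lebesgue. v y * rho_dt t (y - x))) (at t)"
  proof (rule has_real_derivative_integral[where d = "t / 2" and G = "\<lambda>y. \<bar>v y * (C * indicator (cball x (2 * t)) y)\<bar>"])
    show "t / 2 > 0" using t by simp
    show "integrable lebesgue (\<lambda>y. \<bar>v y * (C * indicator (cball x (2 * t)) y)\<bar>)"
      by (intro integrable_abs integrable_L1_loc_cball v)
    show "(\<lambda>y. v y * rho_dt t (y - x)) \<in> borel_measurable lebesgue"
      by (rule borel_measurable_integrable[OF integrable_L1_loc_kernel[OF v kernel_rho_dt[OF t]]])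
  next
    fix s :: real and y
    assume "\<bar>s - t\<bar> < t / 2"
    then have s: "s > 0" "s \<ge> t / 2" "s \<le> 2 * t" by linarith+
    show "integrable lebesgue (\<lambda>y. v y * rho s (y - x))"
      by (rule integrable_L1_loc_kernel[OF v kernel_rho[OF s(1)]])
    show "((\<lambda>t. v y * rho t (y - x)) has_real_derivative v y * rho_dt s (y - x)) (at s)"
      by (rule DERIV_cmult[OF rho_has_derivative_t[OF s(1)]])
    show "\<bar>v y * rho_dt s (y - x)\<bar> \<le> \<bar>v y * (C * indicator (cball x (2 * t)) y)\<bar>"
    proof (cases "dist x y \<le> 2 * t")
      case True
      have "\<bar>rho_dt s (y - x)\<bar> \<le> B / s ^ Suc DIM('a)" using B s by blast
      also have "\<dots> \<le> C" unfolding C_def using B s t by (intro divide_left_mono power_mono mult_pos_pos zero_less_power) auto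
      also have "C = \<bar>C\<bar>" using B t by (simp add: C_def)
      finally show ?thesis using True by (simp add: abs_mult mult_left_mono)
    next
      case False
      then have "norm (y - x) > s" using s by (simp add: dist_norm norm_minus_commute)
      then have "rho_dt s (y - x) = 0" using kernel_rho_dt[OF s(1), where ?'a='a] by (simp add: kernel_def)
      then show ?thesis by simp
    qed
  qed
  then show ?thesis by (simp add: conv_def)
qed

section \<open>Convergence of mollifications in the mean and almost everywhere\<close>

lemma integrable_imp_L1_loc:
  fixes v :: "'a::euclidean_space \<Rightarrow> 'b::euclidean_space"
  assumes "integrable lebesgue v" shows "v \<in> L1_loc"
proof -
  have "set_integrable lebesgue K v" if "compact K" for K
    unfolding set_integrable_def
    using assms lmeasurable_compact[OF that] by (intro integrable_mult_indicator) (auto simp: fmeasurable_def)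
  then show ?thesis using assms by (auto simp: L1_loc_def)
qed

text \<open>Young's inequality for an integrable function and a kernel: Tonelli applied to absolute
  values.\<close>

lemma conv_integrable:
  fixes v :: "'a::euclidean_space \<Rightarrow> real"
  assumes v: "integrable lebesgue v" and k: "kernel r k"
  shows "integrable lebesgue (conv v k)"
    and "(LINT x|lebesgue. \<bar>conv v k x\<bar>) \<le> (LINT x|lebesgue. \<bar>v x\<bar>) * (LINT x|lebesgue. \<bar>k x\<bar>)"
proof -
  have ik: "integrable lebesgue k" by (rule integrable_kernel[OF k])
  have vl: "v \<in> L1_loc" by (rule integrable_imp_L1_loc[OF v])
  have [measurable]: "k \<in> borel_measurable borel" by (rule kernel_borel_measurable[OF k])
  have [measurable]: "v \<in> borel_measurable lebesgue" using v by auto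
  have m: "conv v k \<in> borel_measurable lebesgue"
    by (rule continuous_lebesgue_measurable[OF conv_continuous[OF vl k]])
  have b: "ennreal (norm (conv v k x)) \<le> (\<integral>\<^sup>+y. ennreal \<bar>v y\<bar> * ennreal \<bar>k (y - x)\<bar> \<partial>lebesgue)" for x
  proof -
    have "ennreal (norm (conv v k x)) \<le> (\<integral>\<^sup>+y. ennreal (norm (v y * k (y - x))) \<partial>lebesgue)"
      unfolding conv_def by (rule integral_norm_bound_ennreal[OF integrable_L1_loc_kernel[OF vl k]])
    also have "\<dots> = (\<integral>\<^sup>+y. ennreal \<bar>v y\<bar> * ennreal \<bar>k (y - x)\<bar> \<partial>lebesgue)"
      by (simp add: abs_mult ennreal_mult)
    finally show ?thesis .
  qed
  have "(\<integral>\<^sup>+x. ennreal (norm (conv v k x)) \<partial>lebesgue)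
      \<le> (\<integral>\<^sup>+x. (\<integral>\<^sup>+y. ennreal \<bar>v y\<bar> * ennreal \<bar>k (y - x)\<bar> \<partial>lebesgue) \<partial>lebesgue)"
    by (rule nn_integral_mono) (rule b)
  also have "\<dots> = (\<integral>\<^sup>+y. ennreal \<bar>v y\<bar> \<partial>lebesgue) * (\<integral>\<^sup>+y. ennreal \<bar>k y\<bar> \<partial>lebesgue)"
    by (rule nn_integral_conv) measurable
  also have "\<dots> = ennreal (LINT x|lebesgue. \<bar>v x\<bar>) * ennreal (LINT x|lebesgue. \<bar>k x\<bar>)"
    using v ik by (subst (1 2) nn_integral_eq_integral) auto
  also have "\<dots> = ennreal ((LINT x|lebesgue. \<bar>v x\<bar>) * (LINT x|lebesgue. \<bar>k x\<bar>))"
    by (simp add: ennreal_mult)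
  finally have le: "(\<integral>\<^sup>+x. ennreal (norm (conv v k x)) \<partial>lebesgue)
      \<le> ennreal ((LINT x|lebesgue. \<bar>v x\<bar>) * (LINT x|lebesgue. \<bar>k x\<bar>))" .
  show i: "integrable lebesgue (conv v k)"
    using m le by (auto simp: integrable_iff_bounded intro: le_less_trans)
  have "ennreal (LINT x|lebesgue. \<bar>conv v k x\<bar>) = (\<integral>\<^sup>+x. ennreal (norm (conv v k x)) \<partial>lebesgue)"
    using i by (subst nn_integral_eq_integral) auto
  with le have "ennreal (LINT x|lebesgue. \<bar>conv v k x\<bar>)
     \<le> ennreal ((LINT x|lebesgue. \<bar>v x\<bar>) * (LINT x|lebesgue. \<bar>k x\<bar>))" by simp
  then show "(LINT x|lebesgue. \<bar>conv v k x\<bar>) \<le> (LINT x|lebesgue. \<bar>v x\<bar>) * (LINT x|lebesgue. \<bar>k x\<bar>)"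
    by (subst (asm) ennreal_le_iff) (auto intro!: mult_nonneg_nonneg)
qed

lemma conv_integral_nonneg:
  fixes v :: "'a::euclidean_space \<Rightarrow> real"
  assumes v: "integrable lebesgue v" and k: "kernel r k" and nn: "\<And>x. v x \<ge> 0" "\<And>x. k x \<ge> 0"
  shows "(LINT x|lebesgue. conv v k x) = (LINT x|lebesgue. v x) * (LINT x|lebesgue. k x)"
proof -
  have ik: "integrable lebesgue k" by (rule integrable_kernel[OF k])
  have vl: "v \<in> L1_loc" by (rule integrable_imp_L1_loc[OF v])
  have [measurable]: "k \<in> borel_measurable borel" by (rule kernel_borel_measurable[OF k])
  have [measurable]: "v \<in> borel_measurable lebesgue" using v by auto
  have nc: "conv v k x \<ge> 0" for x unfolding conv_def by (simp add: nn)
  have b: "ennreal (conv v k x) = (\<integral>\<^sup>+y. ennreal (v y) * ennreal (k (y - x)) \<partial>lebesgue)" for x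
    unfolding conv_def using integrable_L1_loc_kernel[OF vl k, of x]
    by (subst nn_integral_eq_integral[symmetric]) (auto simp: nn ennreal_mult)
  have "ennreal (LINT x|lebesgue. conv v k x) = (\<integral>\<^sup>+x. ennreal (conv v k x) \<partial>lebesgue)"
    using conv_integrable(1)[OF v k] nc by (subst nn_integral_eq_integral) auto
  also have "\<dots> = (\<integral>\<^sup>+y. ennreal (v y) \<partial>lebesgue) * (\<integral>\<^sup>+y. ennreal (k y) \<partial>lebesgue)"
    unfolding b by (rule nn_integral_conv) measurable
  also have "\<dots> = ennreal (LINT x|lebesgue. v x) * ennreal (LINT x|lebesgue. k x)"
    using v ik nn by (subst (1 2) nn_integral_eq_integral) auto
  also have "\<dots> = ennreal ((LINT x|lebesgue. v x) * (LINT x|lebesgue. k x))"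
    by (simp add: ennreal_mult nn)
  finally show ?thesis
    by (subst (asm) ennreal_inj) (auto simp: nn nc intro!: mult_nonneg_nonneg)
qed

lemma conv_diff:
  "v \<in> L1_loc \<Longrightarrow> w \<in> L1_loc \<Longrightarrow> kernel r k \<Longrightarrow> conv (\<lambda>x. v x - w x) k x = conv v k x - conv w k x"
  unfolding conv_def by (simp add: left_diff_distrib integrable_L1_loc_kernel)

lemma conv_rho_contraction:
  fixes v :: "'a::euclidean_space \<Rightarrow> real"
  assumes v: "integrable lebesgue v" and t: "t > 0"
  shows "(LINT x|lebesgue. \<bar>conv v (rho t) x\<bar>) \<le> (LINT x|lebesgue. \<bar>v x\<bar>)"
  using conv_integrable(2)[OF v kernel_rho[OF t]] integral_rho[OF t, where ?'a='a]
  by (simp add: rho_nonneg[OF t])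

text \<open>Convergence passes to \<open>L\<^sup>1\<close> limits because mollification is an \<open>L\<^sup>1\<close> contraction.\<close>

lemma conv_rho_L1_closed:
  fixes v :: "'a::euclidean_space \<Rightarrow> real"
  assumes v: "integrable lebesgue v" and h: "\<And>n. h n > 0"
    and ap: "\<And>e. e > 0 \<Longrightarrow> \<exists>w. integrable lebesgue w \<and> (LINT x|lebesgue. \<bar>v x - w x\<bar>) \<le> e \<and>
          (\<lambda>n. LINT x|lebesgue. \<bar>conv w (rho (h n)) x - w x\<bar>) \<longlonglongrightarrow> 0"
  shows "(\<lambda>n. LINT x|lebesgue. \<bar>conv v (rho (h n)) x - v x\<bar>) \<longlonglongrightarrow> 0"
proof (rule LIMSEQ_I)
  fix e :: real assume e: "e > 0"
  then have "e / 4 > 0" by simp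
  from ap[OF this] obtain w where w: "integrable lebesgue w" "(LINT x|lebesgue. \<bar>v x - w x\<bar>) \<le> e / 4"
    and lim: "(\<lambda>n. LINT x|lebesgue. \<bar>conv w (rho (h n)) x - w x\<bar>) \<longlonglongrightarrow> 0" by blast
  have vw: "integrable lebesgue (\<lambda>x. v x - w x)" using v w by simp
  have le: "(LINT x|lebesgue. \<bar>conv v (rho (h n)) x - v x\<bar>)
      \<le> e / 2 + (LINT x|lebesgue. \<bar>conv w (rho (h n)) x - w x\<bar>)" for n
  proof -
    let ?c = "\<lambda>v. conv v (rho (h n))"
    have i: "integrable lebesgue (?c v)" "integrable lebesgue (?c w)" "integrable lebesgue (?c (\<lambda>x. v x - w x))"
      using conv_integrable(1)[OF v kernel_rho[OF h]] conv_integrable(1)[OF w(1) kernel_rho[OF h]]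
        conv_integrable(1)[OF vw kernel_rho[OF h]] by auto
    have diff: "?c v x - ?c w x = ?c (\<lambda>x. v x - w x) x" for x
      using v w by (simp add: conv_diff[OF _ _ kernel_rho[OF h]] integrable_imp_L1_loc)
    have "\<bar>?c v x - v x\<bar> \<le> \<bar>?c (\<lambda>x. v x - w x) x\<bar> + (\<bar>v x - w x\<bar> + \<bar>?c w x - w x\<bar>)" for x
      using diff[of x] by linarith
    then have "(LINT x|lebesgue. \<bar>?c v x - v x\<bar>) \<le>
       (LINT x|lebesgue. \<bar>?c (\<lambda>x. v x - w x) x\<bar> + (\<bar>v x - w x\<bar> + \<bar>?c w x - w x\<bar>))"
      using i v w vw by (intro integral_mono) auto
    also have "\<dots> = (LINT x|lebesgue. \<bar>?c (\<lambda>x. v x - w x) x\<bar>) + ((LINT x|lebesgue. \<bar>v x - w x\<bar>) + (LINT x|lebesgue. \<bar>?c w x - w x\<bar>))"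
      using i v w vw by simp
    also have "\<dots> \<le> e / 4 + (e / 4 + (LINT x|lebesgue. \<bar>?c w x - w x\<bar>))"
      using conv_rho_contraction[OF vw h[of n]] w by (intro add_mono) auto
    finally show ?thesis by simp
  qed
  from LIMSEQ_D[OF lim, of "e / 2"] e obtain n0 where
    n0: "\<And>n. n \<ge> n0 \<Longrightarrow> (LINT x|lebesgue. \<bar>conv w (rho (h n)) x - w x\<bar>) < e / 2"
    by auto
  show "\<exists>no. \<forall>n\<ge>no. norm ((LINT x|lebesgue. \<bar>conv v (rho (h n)) x - v x\<bar>) - 0) < e"
  proof (intro exI[of _ n0] allI impI)
    fix n assume "n \<ge> n0"
    then show "norm ((LINT x|lebesgue. \<bar>conv v (rho (h n)) x - v x\<bar>) - 0) < e"
      using le[of n] n0[of n] by simp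
  qed
qed

text \<open>At each point of an open set the mollified indicator is eventually exactly
  \<open>1\<close>, so its mass inside tends to \<open>measure lebesgue U\<close>. Its total mass
  always equals that number, hence the mass outside tends to \<open>0\<close>, although nothing is
  known pointwise at the boundary.\<close>

lemma conv_rho_L1_open:
  fixes U :: "'a::euclidean_space set"
  assumes U: "open U" "emeasure lebesgue U < \<infinity>" and h: "\<And>n. h n > 0" "h \<longlonglongrightarrow> 0"
  shows "(\<lambda>n. LINT x|lebesgue. \<bar>conv (indicator U) (rho (h n)) x - indicator U x\<bar>) \<longlonglongrightarrow> 0"
proof -
  let ?v = "indicator U :: 'a \<Rightarrow> real"
  let ?c = "\<lambda>n. conv ?v (rho (h n))"
  have Us: "U \<in> sets lebesgue" using U by auto
  have v: "integrable lebesgue ?v" using U Us by (simp add: integrable_indicator_iff)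
  note vl = integrable_imp_L1_loc[OF v]
  have ci: "integrable lebesgue (?c n)" for n by (rule conv_integrable(1)[OF v kernel_rho[OF h(1)]])
  have c0: "?c n x \<ge> 0" for n x unfolding conv_def
    by (intro Bochner_Integration.integral_nonneg mult_nonneg_nonneg rho_nonneg h(1)) simp
  have c1: "?c n x \<le> 1" for n x
  proof -
    have "?c n x \<le> (LINT y|lebesgue. rho (h n) (y - x))"
      unfolding conv_def
      by (intro integral_mono integrable_L1_loc_kernel[OF vl kernel_rho[OF h(1)]] integrable_rho_shift h(1))
         (simp add: indicator_def rho_nonneg[OF h(1)])
    then show ?thesis by (simp add: integral_rho_shift[OF h(1)])
  qed
  have cU: "(LINT x|lebesgue. ?c n x) = measure lebesgue U" for n
    using conv_integral_nonneg[OF v kernel_rho[OF h(1)], of n] rho_nonneg[OF h(1), where ?'a='a] Us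
    by (simp add: integral_rho[OF h(1)])
  have lim: "(\<lambda>n. LINT x|lebesgue. ?c n x * ?v x) \<longlonglongrightarrow> (LINT x|lebesgue. ?v x)"
  proof (rule integral_dominated_convergence[OF _ _ v])
    show "AE x in lebesgue. (\<lambda>n. ?c n x * ?v x) \<longlonglongrightarrow> ?v x"
    proof (rule AE_I2)
      fix x
      show "(\<lambda>n. ?c n x * ?v x) \<longlonglongrightarrow> ?v x"
      proof (cases "x \<in> U")
        case True
        then obtain d where d: "d > 0" "ball x d \<subseteq> U" using U by (auto simp: open_contains_ball)
        have eq1: "?c n x = 1" if "h n < d" for n
        proof -
          have "?v y * rho (h n) (y - x) = rho (h n) (y - x)" for y
          proof (cases "y \<in> U")
            case False
            then have "norm (y - x) \<ge> h n" using d that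
              by (metis dist_commute dist_norm less_le_not_le linorder_linear mem_ball order_less_le_trans subsetD)
            then show ?thesis using h(1) by (simp add: rho_def moll_eq_0)
          qed simp
          then have "?c n x = (LINT y|lebesgue. rho (h n) (y - x))"
            unfolding conv_def by (intro Bochner_Integration.integral_cong refl)
          then show ?thesis by (simp only: integral_rho_shift[OF h(1)])
        qed
        have "eventually (\<lambda>n. ?v x = ?c n x * ?v x) sequentially"
          using order_tendstoD(2)[OF h(2) d(1)] by eventually_elim (simp add: True eq1)
        then show ?thesis by (rule Lim_transform_eventually[OF tendsto_const])
      qed simp
    qed
    show "AE x in lebesgue. norm (?c n x * ?v x) \<le> ?v x" for n
      using c0 c1 by (intro AE_I2) (simp add: indicator_def)
    show "?v \<in> borel_measurable lebesgue" using v by auto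
    then show "(\<lambda>x. ?c n x * ?v x) \<in> borel_measurable lebesgue" for n
      using ci by (intro borel_measurable_times) auto
  qed
  have icv: "integrable lebesgue (\<lambda>x. ?c n x * ?v x)" for n
    using integrable_mult_indicator[OF Us ci[of n]] by (simp add: mult.commute)
  \<comment> \<open>Holds because \<open>?v\<close> has values \<open>0\<close> and \<open>1\<close>
    and \<open>?c\<close> lies between them; it expresses the distance through the overlap whose
    limit is \<open>lim\<close>.\<close>
  have "\<bar>?c n x - ?v x\<bar> = ?c n x + ?v x - 2 * (?c n x * ?v x)" for n x
    using c0[of n x] c1[of n x] by (auto simp: indicator_def)
  then have "(LINT x|lebesgue. \<bar>?c n x - ?v x\<bar>) = measure lebesgue U + (LINT x|lebesgue. ?v x) - 2 * (LINT x|lebesgue. ?c n x * ?v x)" for n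
    using ci v icv by (simp add: cU)
  moreover have "(\<lambda>n. measure lebesgue U + (LINT x|lebesgue. ?v x) - 2 * (LINT x|lebesgue. ?c n x * ?v x)) \<longlonglongrightarrow>
      measure lebesgue U + (LINT x|lebesgue. ?v x) - 2 * (LINT x|lebesgue. ?v x)"
    by (intro tendsto_intros lim)
  moreover have "measure lebesgue U + (LINT x|lebesgue. ?v x) - 2 * (LINT x|lebesgue. ?v x) = 0"
    using Us by simp
  ultimately show ?thesis by simp
qed

text \<open>Outer regularity replaces a measurable set by an open one, linearity reaches simple
  functions, and closedness under mean limits gives the rest. Starting from open sets makes density
  of continuous functions dispensable.\<close>

lemma conv_rho_L1:
  fixes v :: "'a::euclidean_space \<Rightarrow> real"
  assumes v: "integrable lebesgue v" and h: "\<And>n. h n > 0" "h \<longlonglongrightarrow> 0"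
  shows "(\<lambda>n. LINT x|lebesgue. \<bar>conv v (rho (h n)) x - v x\<bar>) \<longlonglongrightarrow> 0"
  using v
proof (induction v rule: integrable_induct)
  case (base A c)
  have iA: "integrable lebesgue (indicator A :: 'a \<Rightarrow> real)" using base by (simp add: integrable_indicator_iff)
  have "(\<lambda>n. LINT x|lebesgue. \<bar>conv (indicator A) (rho (h n)) x - indicator A x\<bar>) \<longlonglongrightarrow> 0"
  proof (rule conv_rho_L1_closed[OF iA h(1)])
    fix e :: real assume e: "e > 0"
    obtain U where U: "open U" "A \<subseteq> U" "U - A \<in> lmeasurable" "emeasure lebesgue (U - A) < ennreal e"
      using sets_lebesgue_outer_open[OF base(1) e] by blast
    have "emeasure lebesgue U \<le> emeasure lebesgue A + emeasure lebesgue (U - A)"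
      using U base by (metis Un_Diff_cancel Un_absorb1 emeasure_subadditive fmeasurableD)
    also have "\<dots> < \<infinity>"
      using base(2) order.strict_trans[OF U(4) ennreal_less_top]
      by (simp only: ennreal_add_less_top infinity_ennreal_def)
    finally have Uf: "emeasure lebesgue U < \<infinity>" .
    have iU: "integrable lebesgue (indicator U :: 'a \<Rightarrow> real)" using Uf U by (simp add: integrable_indicator_iff)
    have "\<bar>indicator A x - indicator U x\<bar> = (indicator (U - A) x :: real)" for x
      using U(2) by (auto simp: indicator_def)
    then have "(LINT x|lebesgue. \<bar>indicator A x - (indicator U x :: real)\<bar>) = measure lebesgue (U - A)"
      using U(3) by (simp add: fmeasurableD)
    also have "\<dots> \<le> e" using U(3,4) e
      by (metis emeasure_eq_measure2 ennreal_less_iff less_eq_real_def measure_nonneg)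
    finally show "\<exists>w. integrable lebesgue w \<and> (LINT x|lebesgue. \<bar>indicator A x - w x\<bar>) \<le> e \<and>
          (\<lambda>n. LINT x|lebesgue. \<bar>conv w (rho (h n)) x - w x\<bar>) \<longlonglongrightarrow> 0"
      using iU conv_rho_L1_open[OF U(1) Uf h] by blast
  qed
  from tendsto_mult_left[OF this, of "\<bar>c\<bar>"]
  have "(\<lambda>n. \<bar>c\<bar> * (LINT x|lebesgue. \<bar>conv (indicator A) (rho (h n)) x - indicator A x\<bar>)) \<longlonglongrightarrow> 0" by simp
  moreover have "conv (\<lambda>x. indicator A x *\<^sub>R c) k x = c * conv (indicator A) k x" for k x
    unfolding conv_def by (simp add: mult.commute[of _ c] mult.assoc)
  then have "(LINT x|lebesgue. \<bar>conv (\<lambda>x. indicator A x *\<^sub>R c) (rho (h n)) x - indicator A x *\<^sub>R c\<bar>)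
      = \<bar>c\<bar> * (LINT x|lebesgue. \<bar>conv (indicator A) (rho (h n)) x - indicator A x\<bar>)" for n
    by (simp add: mult.commute[of _ c] flip: right_diff_distrib abs_mult integral_mult_right_zero)
  ultimately show ?case by simp
next
  case (add f g)
  have i: "integrable lebesgue (conv f (rho (h n)))" "integrable lebesgue (conv g (rho (h n)))"
     "integrable lebesgue (conv (\<lambda>x. f x + g x) (rho (h n)))" for n
    by (rule conv_integrable(1)[OF _ kernel_rho[OF h(1)]], use add in simp)+
  have "conv (\<lambda>x. f x + g x) (rho (h n)) x = conv f (rho (h n)) x + conv g (rho (h n)) x" for n x
    unfolding conv_def
    using add by (simp add: distrib_right integrable_L1_loc_kernel[OF _ kernel_rho[OF h(1)]] integrable_imp_L1_loc)
  then have "\<bar>conv (\<lambda>x. f x + g x) (rho (h n)) x - (f x + g x)\<bar> \<le>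
     \<bar>conv f (rho (h n)) x - f x\<bar> + \<bar>conv g (rho (h n)) x - g x\<bar>" for n x by simp
  then have "(LINT x|lebesgue. \<bar>conv (\<lambda>x. f x + g x) (rho (h n)) x - (f x + g x)\<bar>) \<le>
     (LINT x|lebesgue. \<bar>conv f (rho (h n)) x - f x\<bar> + \<bar>conv g (rho (h n)) x - g x\<bar>)" for n
    using i add by (intro integral_mono) auto
  then have le: "(LINT x|lebesgue. \<bar>conv (\<lambda>x. f x + g x) (rho (h n)) x - (f x + g x)\<bar>) \<le>
     (LINT x|lebesgue. \<bar>conv f (rho (h n)) x - f x\<bar>) + (LINT x|lebesgue. \<bar>conv g (rho (h n)) x - g x\<bar>)" for n
    using i add by simp
  show ?case
  proof (rule tendsto_sandwich[OF _ _ tendsto_const])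
    show "(\<lambda>n. (LINT x|lebesgue. \<bar>conv f (rho (h n)) x - f x\<bar>) + (LINT x|lebesgue. \<bar>conv g (rho (h n)) x - g x\<bar>)) \<longlonglongrightarrow> 0"
      using tendsto_add[OF add(3,4)] by simp
  qed (use le in auto)
next
  case (lim f s)
  show ?case
  proof (rule conv_rho_L1_closed[OF lim(4) h(1)])
    fix e :: real assume e: "e > 0"
    have "(\<lambda>i. LINT x|lebesgue. \<bar>f x - s i x\<bar>) \<longlonglongrightarrow> integral\<^sup>L lebesgue (\<lambda>x::'a. 0::real)"
    \<comment> \<open>The approximating simple functions satisfy
      \<open>norm (s i x) \<le> 2 * norm (f x)\<close>, whence the factor \<open>3\<close>.\<close>
    proof (rule integral_dominated_convergence[where w = "\<lambda>x. 3 * \<bar>f x\<bar>"])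
      show "AE x in lebesgue. (\<lambda>i. \<bar>f x - s i x\<bar>) \<longlonglongrightarrow> 0"
      proof (rule AE_I2)
        fix x
        have "(\<lambda>i. \<bar>f x - s i x\<bar>) \<longlonglongrightarrow> \<bar>f x - f x\<bar>" by (intro tendsto_intros lim(2)) simp
        then show "(\<lambda>i. \<bar>f x - s i x\<bar>) \<longlonglongrightarrow> 0" by simp
      qed
      show "AE x in lebesgue. norm \<bar>f x - s i x\<bar> \<le> 3 * \<bar>f x\<bar>" for i
      proof (rule AE_I2)
        fix x show "norm \<bar>f x - s i x\<bar> \<le> 3 * \<bar>f x\<bar>" using lim(3)[of x i] by simp
      qed
      show "(\<lambda>x. \<bar>f x - s i x\<bar>) \<in> borel_measurable lebesgue" for i using lim(1)[of i] lim(4) by measurable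
      show "integrable lebesgue (\<lambda>x. 3 * \<bar>f x\<bar>)" using lim(4) by simp
    qed simp
    then have "eventually (\<lambda>i. (LINT x|lebesgue. \<bar>f x - s i x\<bar>) < e) sequentially"
      using e by (intro order_tendstoD(2)) auto
    then obtain i where "(LINT x|lebesgue. \<bar>f x - s i x\<bar>) < e" by (auto simp: eventually_sequentially)
    then show "\<exists>w. integrable lebesgue w \<and> (LINT x|lebesgue. \<bar>f x - w x\<bar>) \<le> e \<and>
          (\<lambda>n. LINT x|lebesgue. \<bar>conv w (rho (h n)) x - w x\<bar>) \<longlonglongrightarrow> 0"
      using lim(1)[of i] lim(5)[of i] by (intro exI[of _ "s i"]) auto
  qed
qed

lemma conv_local:
  assumes "kernel t k" "\<And>y. dist x y \<le> t \<Longrightarrow> v y = w y"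
  shows "conv v k x = conv w k x"
  unfolding conv_def
proof (intro Bochner_Integration.integral_cong refl)
  fix y
  show "v y * k (y - x) = w y * k (y - x)"
    using assms by (cases "dist x y \<le> t") (auto simp: kernel_def dist_norm norm_minus_commute)
qed

lemma L1_loc_cball_integrable:
  fixes v :: "'a::euclidean_space \<Rightarrow> real"
  shows "v \<in> L1_loc \<Longrightarrow> integrable lebesgue (\<lambda>x. indicator (cball a R) x * v x)"
  by (auto simp: L1_loc_def set_integrable_def)

text \<open>At scales up to \<open>1\<close> a mollification looks no further than distance
  \<open>1\<close>. Truncation to a slightly larger ball thus transfers results on integrable
  functions to locally integrable ones.\<close>

lemma conv_rho_cball:
  fixes v :: "'a::euclidean_space \<Rightarrow> real"
  assumes "0 < t" "t \<le> 1" "norm x \<le> R"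
  shows "conv (\<lambda>x. indicator (cball 0 (R + 1)) x * v x) (rho t) x = conv v (rho t) x"
proof (rule conv_local[OF kernel_rho[OF assms(1)]])
  fix y assume "dist x y \<le> t"
  then have "norm y \<le> R + 1"
    using assms norm_triangle_ineq2[of y x] by (simp add: dist_norm norm_minus_commute)
  then show "indicator (cball 0 (R + 1)) y * v y = v y" by simp
qed

lemma conv_rho_subseq_AE:
  fixes v :: "'a::euclidean_space \<Rightarrow> real"
  assumes v: "integrable lebesgue v" and h: "\<And>n. h n > 0" "h \<longlonglongrightarrow> 0"
  shows "\<exists>s. strict_mono s \<and> (AE x in lebesgue. (\<lambda>n. conv v (rho (h (s n))) x) \<longlonglongrightarrow> v x)"
proof -
  have "\<exists>s. strict_mono s \<and> (AE x in lebesgue. (\<lambda>n. conv v (rho (h (s n))) x - v x) \<longlonglongrightarrow> 0)"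
    using conv_integrable(1)[OF v kernel_rho[OF h(1)]] v conv_rho_L1[OF v h]
    by (intro tendsto_L1_AE_subseq[where u = "\<lambda>n x. conv v (rho (h n)) x - v x"]) auto
  then show ?thesis by (simp add: LIM_zero_iff)
qed

text \<open>On each ball the truncated function is integrable, so a subsequence of its
  mollifications converges almost everywhere and the bound survives; countably many balls exhaust
  the space. Values in \<open>ennreal\<close> allow \<open>Bd\<close> to be infinite where nothing
  is known.\<close>

lemma AE_bound_of_conv_rho:
  fixes w :: "'a::euclidean_space \<Rightarrow> real"
  assumes w: "w \<in> L1_loc" and h: "\<And>n. h n > 0" "\<And>n. h n \<le> 1" "h \<longlonglongrightarrow> 0"
    and bd: "\<And>n x. ennreal \<bar>conv w (rho (h n)) x\<bar> \<le> Bd x"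
  shows "AE x in lebesgue. ennreal \<bar>w x\<bar> \<le> Bd x"
proof -
  have "AE x in lebesgue. norm x \<le> real m \<longrightarrow> ennreal \<bar>w x\<bar> \<le> Bd x" for m
  proof -
    let ?v = "\<lambda>x. indicator (cball 0 (real m + 1)) x * w x"
    obtain s where s: "strict_mono s" "AE x in lebesgue. (\<lambda>n. conv ?v (rho (h (s n))) x) \<longlonglongrightarrow> ?v x"
      using conv_rho_subseq_AE[OF L1_loc_cball_integrable[OF w] h(1,3)] by blast
    from s(2) show ?thesis
    proof eventually_elim
      case (elim x)
      show ?case
      proof
        assume x: "norm x \<le> real m"
        then have "(\<lambda>n. conv w (rho (h (s n))) x) \<longlonglongrightarrow> w x"
          using elim by (simp add: conv_rho_cball[OF h(1,2) x])
        then have "(\<lambda>n. ennreal \<bar>conv w (rho (h (s n))) x\<bar>) \<longlonglongrightarrow> ennreal \<bar>w x\<bar>"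
          by (intro tendsto_intros)
        then show "ennreal \<bar>w x\<bar> \<le> Bd x"
          by (rule LIMSEQ_le_const2) (use bd in auto)
      qed
    qed
  qed
  then have "AE x in lebesgue. \<forall>m::nat. norm x \<le> real m \<longrightarrow> ennreal \<bar>w x\<bar> \<le> Bd x"
    unfolding AE_all_countable by blast
  then show ?thesis
    by eventually_elim (meson real_arch_simple)
qed

lemma powr_integrable_L1_loc:
  fixes v :: "'a::euclidean_space \<Rightarrow> 'b::euclidean_space"
  assumes v: "v \<in> borel_measurable lebesgue" and p: "p \<ge> 1"
    and i: "integrable lebesgue (\<lambda>x. norm (v x) powr p)"
  shows "v \<in> L1_loc"
proof -
  have "set_integrable lebesgue K v" if K: "compact K" for K
    unfolding set_integrable_def
  proof (rule Bochner_Integration.integrable_bound)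
    have Ks: "K \<in> lmeasurable" by (rule lmeasurable_compact[OF K])
    then have "integrable lebesgue (indicator K :: 'a \<Rightarrow> real)" using lmeasurable_iff_integrable by blast
    then show "integrable lebesgue (\<lambda>x. indicator K x + norm (v x) powr p)" using i by auto
    show "(\<lambda>x. indicator K x *\<^sub>R v x) \<in> borel_measurable lebesgue" using v Ks by measurable
    have "norm (v x) \<le> 1 + norm (v x) powr p" for x
    proof (cases "norm (v x) \<le> 1")
      case True then show ?thesis by (simp add: add_increasing2)
    next
      case False
      then have "norm (v x) powr 1 \<le> norm (v x) powr p" using p by (intro powr_mono) auto
      then show ?thesis using False by simp
    qed
    then show "AE x in lebesgue. norm (indicator K x *\<^sub>R v x) \<le> norm (indicator K x + norm (v x) powr p)"
      by (intro AE_I2) (auto simp: indicator_def)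
  qed
  then show ?thesis using v by (simp add: L1_loc_def)
qed

lemma square_integrable_L1_loc:
  fixes v :: "'a::euclidean_space \<Rightarrow> real"
  assumes "v \<in> borel_measurable lebesgue" "integrable lebesgue (\<lambda>x. (v x)\<^sup>2)"
  shows "v \<in> L1_loc"
  using assms by (intro powr_integrable_L1_loc[where p = 2]) auto

section \<open>Mollification of bounded and of square integrable functions\<close>

lemma conv_rho_bounded:
  fixes v :: "'a::euclidean_space \<Rightarrow> real"
  assumes v: "v \<in> L1_loc" and t: "t > 0" and bd: "\<And>x. \<bar>v x\<bar> \<le> B"
  shows "\<bar>conv v (rho t) x\<bar> \<le> B"
proof -
  have "\<bar>conv v (rho t) x\<bar> \<le> (LINT y|lebesgue. \<bar>v y * rho t (y - x)\<bar>)"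
    unfolding conv_def by (rule integral_abs_bound)
  also have "\<dots> \<le> (LINT y|lebesgue. B * rho t (y - x))"
    using bd
    by (intro integral_mono integrable_abs integrable_L1_loc_kernel[OF v kernel_rho[OF t]]
          integrable_mult_right integrable_rho_shift t)
       (auto simp: abs_mult rho_nonneg[OF t] intro!: mult_right_mono)
  also have "\<dots> = B" by (simp add: integral_rho_shift[OF t])
  finally show ?thesis .
qed

text \<open>Jensen's inequality for the probability density \<open>rho t (y - x)\<close>, obtained
  by integrating \<open>0 \<le> (v y - m)\<^sup>2\<close> against it, with \<open>m\<close> the
  mollified value at \<open>x\<close>.\<close>

lemma conv_rho_square_le:
  fixes v :: "'a::euclidean_space \<Rightarrow> real"
  assumes v: "v \<in> borel_measurable lebesgue" "integrable lebesgue (\<lambda>x. (v x)\<^sup>2)" and t: "t > 0"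
  shows "(conv v (rho t) x)\<^sup>2 \<le> conv (\<lambda>x. (v x)\<^sup>2) (rho t) x"
proof -
  let ?m = "conv v (rho t) x"
  note k = kernel_rho[OF t]
  have i1: "integrable lebesgue (\<lambda>y. v y * rho t (y - x))"
    by (rule integrable_L1_loc_kernel[OF square_integrable_L1_loc[OF v] k])
  have i2: "integrable lebesgue (\<lambda>y. (v y)\<^sup>2 * rho t (y - x))"
    by (rule integrable_L1_loc_kernel[OF integrable_imp_L1_loc[OF v(2)] k])
  have "(LINT y|lebesgue. 2 * ?m * (v y * rho t (y - x)) - ?m\<^sup>2 * rho t (y - x))
      \<le> (LINT y|lebesgue. (v y)\<^sup>2 * rho t (y - x))"
  proof (intro integral_mono)
    fix y
    have "2 * ?m * v y - ?m\<^sup>2 \<le> (v y)\<^sup>2" using zero_le_power2[of "v y - ?m"] by (simp add: power2_diff algebra_simps)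
    from mult_right_mono[OF this rho_nonneg[OF t, of "y - x"]]
    show "2 * ?m * (v y * rho t (y - x)) - ?m\<^sup>2 * rho t (y - x) \<le> (v y)\<^sup>2 * rho t (y - x)"
      by (simp add: algebra_simps)
  qed (use i1 i2 integrable_rho_shift[OF t, of x] in auto)
  also have "(LINT y|lebesgue. 2 * ?m * (v y * rho t (y - x)) - ?m\<^sup>2 * rho t (y - x))
     = 2 * ?m * ?m - ?m\<^sup>2 * 1"
    using i1 integrable_rho_shift[OF t, of x]
    by (subst Bochner_Integration.integral_diff) (auto simp: integral_rho_shift[OF t] conv_def)
  finally show ?thesis by (simp add: conv_def power2_eq_square)
qed

lemma conv_rho_L2_contraction:
  fixes v :: "'a::euclidean_space \<Rightarrow> real"
  assumes v: "v \<in> borel_measurable lebesgue" "integrable lebesgue (\<lambda>x. (v x)\<^sup>2)" and t: "t > 0"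
  shows "integrable lebesgue (\<lambda>x. (conv v (rho t) x)\<^sup>2)"
    and "(LINT x|lebesgue. (conv v (rho t) x)\<^sup>2) \<le> (LINT x|lebesgue. (v x)\<^sup>2)"
proof -
  note k = kernel_rho[OF t]
  have i: "integrable lebesgue (conv (\<lambda>x. (v x)\<^sup>2) (rho t))" by (rule conv_integrable(1)[OF v(2) k])
  have [measurable]: "conv v (rho t) \<in> borel_measurable lebesgue"
    by (rule continuous_lebesgue_measurable[OF conv_continuous[OF square_integrable_L1_loc[OF v] k]])
  show i2: "integrable lebesgue (\<lambda>x. (conv v (rho t) x)\<^sup>2)"
  proof (rule Bochner_Integration.integrable_bound[OF i])
    show "AE x in lebesgue. norm ((conv v (rho t) x)\<^sup>2) \<le> norm (conv (\<lambda>x. (v x)\<^sup>2) (rho t) x)"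
      using order_trans[OF conv_rho_square_le[OF v t] abs_ge_self] by (intro AE_I2) simp
  qed measurable
  have "(LINT x|lebesgue. (conv v (rho t) x)\<^sup>2) \<le> (LINT x|lebesgue. conv (\<lambda>x. (v x)\<^sup>2) (rho t) x)"
    by (intro integral_mono i i2 conv_rho_square_le v t)
  also have "\<dots> = (LINT x|lebesgue. (v x)\<^sup>2)"
    using conv_integral_nonneg[OF v(2) k] rho_nonneg[OF t, where ?'a='a] by (simp add: integral_rho[OF t])
  finally show "(LINT x|lebesgue. (conv v (rho t) x)\<^sup>2) \<le> (LINT x|lebesgue. (v x)\<^sup>2)" .
qed

lemma square_integrable_diff:
  fixes f g :: "'a \<Rightarrow> real"
  assumes [measurable]: "f \<in> borel_measurable M" "g \<in> borel_measurable M"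
    and i: "integrable M (\<lambda>x. (f x)\<^sup>2)" "integrable M (\<lambda>x. (g x)\<^sup>2)"
  shows "integrable M (\<lambda>x. (f x - g x)\<^sup>2)"
proof (rule Bochner_Integration.integrable_bound)
  show "integrable M (\<lambda>x. 2 * (f x)\<^sup>2 + 2 * (g x)\<^sup>2)" using i by auto
  have "(a - b)\<^sup>2 \<le> 2 * a\<^sup>2 + 2 * b\<^sup>2" for a b :: real
    using zero_le_power2[of "a + b"] by (simp add: power2_sum power2_diff)
  then show "AE x in M. norm ((f x - g x)\<^sup>2) \<le> norm (2 * (f x)\<^sup>2 + 2 * (g x)\<^sup>2)"
    by (intro AE_I2) auto
qed measurable

text \<open>Cutting off large values and distant points leaves a bounded integrable
  \<open>w\<close>, for which differences bounded by \<open>2 * K\<close> upgrade mean convergence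
  to mean square convergence. The remainder \<open>v - w\<close> is controlled by contraction in the
  mean square.\<close>

lemma conv_rho_L2:
  fixes v :: "'a::euclidean_space \<Rightarrow> real"
  assumes v: "v \<in> borel_measurable lebesgue" "integrable lebesgue (\<lambda>x. (v x)\<^sup>2)"
    and h: "\<And>n. h n > 0" "h \<longlonglongrightarrow> 0"
  shows "(\<lambda>n. LINT x|lebesgue. (conv v (rho (h n)) x - v x)\<^sup>2) \<longlonglongrightarrow> 0"
proof (rule LIMSEQ_I)
  fix e :: real assume e: "e > 0"
  note [measurable] = v(1)
  define A where "A K = {x. \<bar>v x\<bar> \<le> K} \<inter> cball 0 K" for K :: real
  have A[measurable]: "A K \<in> sets lebesgue" for K
  proof -
    have "{x \<in> space lebesgue. \<bar>v x\<bar> \<le> K} \<in> sets lebesgue" by measurable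
    then have "{x. \<bar>v x\<bar> \<le> K} \<in> sets lebesgue" by simp
    then show ?thesis unfolding A_def by (rule sets.Int) simp
  qed
  define vk where "vk K x = indicator (A K) x * v x" for K x
  have "(\<lambda>K. LINT x|lebesgue. (v x - vk (real K) x)\<^sup>2) \<longlonglongrightarrow> integral\<^sup>L lebesgue (\<lambda>x::'a. 0::real)"
  proof (rule integral_dominated_convergence[OF _ _ v(2)])
    show "AE x in lebesgue. (\<lambda>K. (v x - vk (real K) x)\<^sup>2) \<longlonglongrightarrow> 0"
    proof (rule AE_I2)
      fix x :: 'a
      have "eventually (\<lambda>K. real K \<ge> max \<bar>v x\<bar> (norm x)) sequentially"
        using eventually_ge_at_top[of "nat \<lceil>max \<bar>v x\<bar> (norm x)\<rceil>"] by eventually_elim linarith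
      then have "eventually (\<lambda>K. 0 = (v x - vk (real K) x)\<^sup>2) sequentially"
        by eventually_elim (simp add: vk_def A_def)
      then show "(\<lambda>K. (v x - vk (real K) x)\<^sup>2) \<longlonglongrightarrow> 0" by (rule Lim_transform_eventually[OF tendsto_const])
    qed
    show "AE x in lebesgue. norm ((v x - vk (real K) x)\<^sup>2) \<le> (v x)\<^sup>2" for K
      by (intro AE_I2) (auto simp: vk_def indicator_def)
    show "(\<lambda>x. (v x - vk (real K) x)\<^sup>2) \<in> borel_measurable lebesgue" for K
      unfolding vk_def by measurable
  qed simp
  \<comment> \<open>The remainder enters twice, mollified and not, each time with the factor
    \<open>3\<close> of the square of a three-term sum: together \<open>e / 2\<close>.\<close>
  then have "eventually (\<lambda>K. (LINT x|lebesgue. (v x - vk (real K) x)\<^sup>2) < e / 12) sequentially"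
    using e by (intro order_tendstoD(2)) auto
  then obtain K :: nat where K: "(LINT x|lebesgue. (v x - vk (real K) x)\<^sup>2) < e / 12"
    by (auto simp: eventually_sequentially)
  define w where "w = vk (real K)"
  have w[measurable]: "w \<in> borel_measurable lebesgue" unfolding w_def vk_def by measurable
  have wb: "\<bar>w x\<bar> \<le> real K" for x by (auto simp: w_def vk_def A_def indicator_def)
  have w2: "integrable lebesgue (\<lambda>x. (w x)\<^sup>2)"
    by (rule Bochner_Integration.integrable_bound[OF v(2)]) (auto simp: w_def vk_def indicator_def)
  have wl: "w \<in> L1_loc" by (rule square_integrable_L1_loc[OF w w2])
  have "w = (\<lambda>x. indicator (cball 0 (real K)) x * w x)" by (auto simp: w_def vk_def A_def indicator_def)
  with L1_loc_cball_integrable[OF wl, of 0 "real K"] have wi: "integrable lebesgue w" by simp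
  have vl: "v \<in> L1_loc" by (rule square_integrable_L1_loc[OF v])
  have d2: "integrable lebesgue (\<lambda>x. (v x - w x)\<^sup>2)" by (rule square_integrable_diff[OF v(1) w v(2) w2])
  have dm: "(\<lambda>x. v x - w x) \<in> borel_measurable lebesgue" by measurable
  have le: "(LINT x|lebesgue. (conv v (rho (h n)) x - v x)\<^sup>2)
      \<le> e / 2 + 6 * real K * (LINT x|lebesgue. \<bar>conv w (rho (h n)) x - w x\<bar>)" for n
  proof -
    let ?c = "\<lambda>v. conv v (rho (h n))"
    note k = kernel_rho[OF h(1), of n]
    have m[measurable]: "?c v \<in> borel_measurable lebesgue" "?c w \<in> borel_measurable lebesgue"
      by (intro continuous_lebesgue_measurable conv_continuous[OF _ k] vl wl)+
    have ic: "integrable lebesgue (\<lambda>x. \<bar>?c w x - w x\<bar>)"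
      using conv_integrable(1)[OF wi k] wi by auto
    have eq: "?c (\<lambda>x. v x - w x) x = ?c v x - ?c w x" for x
      by (rule conv_diff[OF vl wl k])
    have "(?c v x - v x)\<^sup>2 \<le> 3 * (?c (\<lambda>x. v x - w x) x)\<^sup>2 + (6 * real K * \<bar>?c w x - w x\<bar> + 3 * (v x - w x)\<^sup>2)" for x
    proof -
      have sq: "(a + b + c)\<^sup>2 \<le> 3 * a\<^sup>2 + (3 * b\<^sup>2 + 3 * c\<^sup>2)" for a b c :: real
        using zero_le_power2[of "a - b"] zero_le_power2[of "a - c"] zero_le_power2[of "b - c"]
        by (simp add: power2_eq_square algebra_simps)
      have "\<bar>?c w x - w x\<bar> \<le> 2 * real K"
        using conv_rho_bounded[OF wl h(1) wb, of n x] wb[of x] by linarith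
      from mult_right_mono[OF this, of "\<bar>?c w x - w x\<bar>"]
      have "(?c w x - w x)\<^sup>2 \<le> 2 * real K * \<bar>?c w x - w x\<bar>"
        by (simp add: power2_eq_square flip: abs_mult)
      with sq[of "?c v x - ?c w x" "?c w x - w x" "w x - v x"] show ?thesis
        by (simp add: eq power2_commute[of "w x"])
    qed
    then have "(LINT x|lebesgue. (?c v x - v x)\<^sup>2) \<le>
      (LINT x|lebesgue. 3 * (?c (\<lambda>x. v x - w x) x)\<^sup>2 + (6 * real K * \<bar>?c w x - w x\<bar> + 3 * (v x - w x)\<^sup>2))"
      using conv_rho_L2_contraction(1)[OF dm d2 h(1)] ic d2
        square_integrable_diff[OF m(1) v(1) conv_rho_L2_contraction(1)[OF v h(1)] v(2)]
      by (intro integral_mono) auto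
    also have "\<dots> = 3 * (LINT x|lebesgue. (?c (\<lambda>x. v x - w x) x)\<^sup>2) +
       (6 * real K * (LINT x|lebesgue. \<bar>?c w x - w x\<bar>) + 3 * (LINT x|lebesgue. (v x - w x)\<^sup>2))"
      using conv_rho_L2_contraction(1)[OF dm d2 h(1)] ic d2 by simp
    also have "\<dots> \<le> e / 2 + 6 * real K * (LINT x|lebesgue. \<bar>?c w x - w x\<bar>)"
      using conv_rho_L2_contraction(2)[OF dm d2 h(1), of n] K by (simp add: w_def)
    finally show ?thesis .
  qed
  have "(\<lambda>n. 6 * real K * (LINT x|lebesgue. \<bar>conv w (rho (h n)) x - w x\<bar>)) \<longlonglongrightarrow> 6 * real K * 0"
    by (intro tendsto_mult tendsto_const conv_rho_L1[OF wi h])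
  then have "eventually (\<lambda>n. 6 * real K * (LINT x|lebesgue. \<bar>conv w (rho (h n)) x - w x\<bar>) < e / 2) sequentially"
    using e by (intro order_tendstoD(2)) auto
  then obtain n0 where n0: "\<And>n. n \<ge> n0 \<Longrightarrow> 6 * real K * (LINT x|lebesgue. \<bar>conv w (rho (h n)) x - w x\<bar>) < e / 2"
    by (auto simp: eventually_sequentially)
  show "\<exists>no. \<forall>n\<ge>no. norm ((LINT x|lebesgue. (conv v (rho (h n)) x - v x)\<^sup>2) - 0) < e"
  proof (intro exI[of _ n0] allI impI)
    fix n assume "n \<ge> n0"
    then show "norm ((LINT x|lebesgue. (conv v (rho (h n)) x - v x)\<^sup>2) - 0) < e"
      using le[of n] n0[of n] by simp
  qed
qed

section \<open>Averages over balls\<close>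

text \<open>Normalised by \<open>h ^ DIM('a)\<close> rather than by the volume of the ball.\<close>

definition avg :: "real \<Rightarrow> ('a::euclidean_space \<Rightarrow> real) \<Rightarrow> 'a \<Rightarrow> real" where
  "avg h G x = (LINT y|lebesgue. G y * indicator (cball x h) y) / h ^ DIM('a)"

lemma integrable_cball_times:
  fixes G :: "'a::euclidean_space \<Rightarrow> real"
  shows "G \<in> L1_loc \<Longrightarrow> integrable lebesgue (\<lambda>y. G y * indicator (cball x h) y)"
  using L1_loc_cball_integrable[of G x h] by (simp add: mult.commute)

lemma avg_nonneg: "(\<And>y. G y \<ge> 0) \<Longrightarrow> h > 0 \<Longrightarrow> avg h G x \<ge> 0"
  unfolding avg_def by (intro divide_nonneg_nonneg Bochner_Integration.integral_nonneg) auto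

text \<open>Presents the ball integral as a convolution with the indicator of a centred ball, the
  form to which Tonelli and measurability in \<open>x\<close> apply.\<close>

lemma cball_integral_nn:
  fixes G :: "'a::euclidean_space \<Rightarrow> real"
  assumes G: "G \<in> L1_loc" and nn: "\<And>y. G y \<ge> 0"
  shows "ennreal (LINT y|lebesgue. G y * indicator (cball x h) y)
     = (\<integral>\<^sup>+y. ennreal (G y) * indicator (cball 0 h) (y - x) \<partial>lebesgue)"
proof -
  have ind: "indicator (cball x h) y = indicator (cball 0 h) (y - x)" for y
    by (simp add: indicator_def dist_norm norm_minus_commute)
  have "ennreal (LINT y|lebesgue. G y * indicator (cball x h) y)
     = (\<integral>\<^sup>+y. ennreal (G y * indicator (cball x h) y) \<partial>lebesgue)"
    using nn by (intro nn_integral_eq_integral[symmetric] integrable_cball_times G) auto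
  also have "\<dots> = (\<integral>\<^sup>+y. ennreal (G y) * indicator (cball 0 h) (y - x) \<partial>lebesgue)"
    by (intro nn_integral_cong) (auto simp: indicator_def dist_norm norm_minus_commute nn)
  finally show ?thesis .
qed

lemma avg_measurable:
  fixes G :: "'a::euclidean_space \<Rightarrow> real"
  assumes G: "G \<in> L1_loc" and nn: "\<And>y. G y \<ge> 0"
  shows "avg h G \<in> borel_measurable borel"
proof -
  have "(\<lambda>x. ennreal (LINT y|lebesgue. G y * indicator (cball x h) y)) \<in> borel_measurable borel"
    unfolding cball_integral_nn[OF G nn]
    using G by (intro nn_integral_conv(1) borel_measurable_indicator borel_closed) (auto simp: L1_loc_def)
  then have "(\<lambda>x. enn2real (ennreal (LINT y|lebesgue. G y * indicator (cball x h) y))) \<in> borel_measurable borel"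
    by measurable
  moreover have "(LINT y|lebesgue. G y * indicator (cball x h) y) \<ge> 0" for x
    by (intro Bochner_Integration.integral_nonneg) (simp add: nn)
  ultimately have "(\<lambda>x. LINT y|lebesgue. G y * indicator (cball x h) y) \<in> borel_measurable borel"
    by simp
  then show ?thesis unfolding avg_def by measurable
qed

text \<open>Convexity of the power function, in the form that gives Jensen's inequality on
  integration. It is the weighted inequality of arithmetic and geometric means for
  \<open>a powr p\<close> and \<open>b powr p\<close> with weights \<open>(p - 1) / p\<close> and
  \<open>1 / p\<close>.\<close>

lemma powr_ge_tangent:
  fixes a b p :: real
  assumes "a \<ge> 0" "b \<ge> 0" "p \<ge> 1"
  shows "a powr p + p * a powr (p - 1) * (b - a) \<le> b powr p"
proof (cases "a = 0 \<or> b = 0")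
  case True
  moreover have "a powr p = a powr (p - 1) * a" using assms by (cases "a = 0") (auto simp: powr_diff)
  moreover have "1 * a powr p \<le> p * a powr p" using assms by (intro mult_right_mono) auto
  ultimately show ?thesis using assms by (auto simp: algebra_simps)
next
  case False
  then have a: "a > 0" "b > 0" using assms by auto
  have "(a powr p) powr ((p - 1) / p) * (b powr p) powr (1 / p) \<le> (p - 1) / p * a powr p + 1 / p * b powr p"
    using assms a by (intro Youngs_inequality_0) (auto simp: field_simps)
  then have "a powr (p - 1) * b \<le> (p - 1) / p * a powr p + 1 / p * b powr p"
    using assms by (simp add: powr_powr)
  from mult_left_mono[OF this, of p] have "p * (a powr (p - 1) * b) \<le> p * ((p - 1) / p * a powr p + 1 / p * b powr p)"
    using assms by simp
  also have "\<dots> = (p - 1) * a powr p + b powr p"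
    using assms by (simp add: distrib_left)
  finally have "p * (a powr (p - 1) * b) \<le> (p - 1) * a powr p + b powr p" .
  moreover have "a powr p = a powr (p - 1) * a" using a by (simp add: powr_diff)
  ultimately show ?thesis by (simp add: algebra_simps)
qed

text \<open>A case of Young's convolution inequality. Jensen bounds \<open>avg h G x powr p\<close>
  by \<open>Q(x) / W\<close> up to a constant, where \<open>Q(x)\<close> is the integral of
  \<open>G powr p\<close> over the ball and \<open>W\<close> its volume. In the power
  \<open>r / p\<close> of this, all but one factor \<open>Q(x)\<close> is estimated by the full
  integral \<open>I\<close>; the last factor integrates to \<open>I * W\<close>. What remains of the
  volume is \<open>W powr (1 - r / p)\<close>.\<close>

lemma avg_powr_integral:
  fixes G :: "'a::euclidean_space \<Rightarrow> real"
  assumes G: "G \<in> borel_measurable lebesgue" and nn: "\<And>y. G y \<ge> 0"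
    and p: "p \<ge> 1" and r: "r \<ge> p" and i: "integrable lebesgue (\<lambda>x. G x powr p)"
  shows "\<exists>C\<ge>0. \<forall>h>0. (\<integral>\<^sup>+x. ennreal (avg h G x powr r) \<partial>lebesgue)
            \<le> ennreal (C * h powr (DIM('a) * (1 - r / p)))"
proof -
  define \<beta> where "\<beta> = unit_ball_vol DIM('a)"
  have \<beta>: "\<beta> > 0" by (simp add: \<beta>_def unit_ball_vol_pos)
  define I where "I = (LINT x|lebesgue. G x powr p)"
  have I: "I \<ge> 0" unfolding I_def by simp
  have GL: "G \<in> L1_loc" using G p i nn by (intro powr_integrable_L1_loc[where p = p]) auto
  have rp: "r / p \<ge> 1" using p r by simp
  define C where "C = \<beta> powr r * \<beta> powr (1 - r / p) * I powr (r / p)"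
  have "(\<integral>\<^sup>+x. ennreal (avg h G x powr r) \<partial>lebesgue) \<le> ennreal (C * h powr (DIM('a) * (1 - r / p)))"
    if h: "h > 0" for h
  proof -
    define W where "W = \<beta> * h ^ DIM('a)"
    have W: "W > 0" using \<beta> h by (simp add: W_def)
    have cW: "measure lebesgue (cball x h) = W" for x :: 'a
      using h content_cball[of h x] by (simp add: W_def \<beta>_def)
    have iB: "integrable lebesgue (indicator (cball x h) :: 'a \<Rightarrow> real)" for x
      by (rule integrable_indicator_cball)
    let ?Q = "\<lambda>x. LINT y|lebesgue. G y powr p * indicator (cball x h) y"
    have Q0: "?Q x \<ge> 0" for x by (intro Bochner_Integration.integral_nonneg) simp
    have iQ: "integrable lebesgue (\<lambda>y. G y powr p * indicator (cball x h) y)" for x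
      by (rule integrable_cball_times[OF integrable_imp_L1_loc[OF i]])
    have QI: "?Q x \<le> I" for x
      unfolding I_def by (intro integral_mono iQ i) (simp add: indicator_def)
    define K where "K = (\<beta> powr p / W) powr (r / p) * I powr (r / p - 1)"
    have pt: "avg h G x powr r \<le> K * ?Q x" for x
    proof -
      define m where "m = avg h G x"
      have m: "m \<ge> 0" unfolding m_def by (rule avg_nonneg[OF nn h])
      \<comment> \<open>The true mean over the ball, since \<open>avg\<close> divides by
        \<open>h ^ DIM('a)\<close> only. With the tangent taken at the mean, the linear term
        integrates to zero.\<close>
      define a where "a = m / \<beta>"
      have a: "a \<ge> 0" using m \<beta> by (simp add: a_def)
      have iG: "integrable lebesgue (\<lambda>y. G y * indicator (cball x h) y)" by (rule integrable_cball_times[OF GL])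
      have eq: "(LINT y|lebesgue. G y * indicator (cball x h) y) = a * W"
        using \<beta> h by (simp add: a_def m_def avg_def W_def)
      have "(LINT y|lebesgue. (a powr p - p * a powr (p - 1) * a) * indicator (cball x h) y
              + p * a powr (p - 1) * (G y * indicator (cball x h) y)) \<le> ?Q x"
      proof (intro integral_mono iQ Bochner_Integration.integrable_add integrable_mult_right iG iB)
        fix y
        show "(a powr p - p * a powr (p - 1) * a) * indicator (cball x h) y
              + p * a powr (p - 1) * (G y * indicator (cball x h) y) \<le> G y powr p * indicator (cball x h) y"
          using powr_ge_tangent[OF a nn[of y] p] by (simp add: indicator_def algebra_simps)
      qed
      also have "(LINT y|lebesgue. (a powr p - p * a powr (p - 1) * a) * indicator (cball x h) y
              + p * a powr (p - 1) * (G y * indicator (cball x h) y))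
            = (a powr p - p * a powr (p - 1) * a) * W + p * a powr (p - 1) * (a * W)"
        by (subst Bochner_Integration.integral_add) (auto simp: iB iG eq cW)
      also have "\<dots> = a powr p * W" by (simp add: algebra_simps)
      finally have "a powr p * W \<le> ?Q x" .
      then have mp: "m powr p \<le> \<beta> powr p / W * ?Q x"
        using W \<beta> m by (simp add: a_def powr_divide field_simps)
      have "m powr r = (m powr p) powr (r / p)" using p by (simp add: powr_powr)
      also have "\<dots> \<le> (\<beta> powr p / W * ?Q x) powr (r / p)"
        using mp rp by (intro powr_mono2) auto
      also have "\<dots> = (\<beta> powr p / W) powr (r / p) * (?Q x powr (r / p - 1) * ?Q x)"
      proof -
        have "(\<beta> powr p / W * ?Q x) powr (r / p) = (\<beta> powr p / W) powr (r / p) * ?Q x powr (r / p)"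
          by (rule powr_mult)
        moreover have "?Q x powr (r / p) = ?Q x powr (r / p - 1) * ?Q x"
          using Q0[of x] by (cases "?Q x = 0") (auto simp: powr_diff)
        ultimately show ?thesis by simp
      qed
      also have "\<dots> \<le> (\<beta> powr p / W) powr (r / p) * (I powr (r / p - 1) * ?Q x)"
        using QI Q0 rp by (intro mult_left_mono mult_right_mono powr_mono2) auto
      finally show ?thesis by (simp add: m_def K_def)
    qed
    have K0: "K \<ge> 0" by (simp add: K_def)
    have "(\<integral>\<^sup>+x. ennreal (avg h G x powr r) \<partial>lebesgue) \<le> (\<integral>\<^sup>+x. ennreal K * ennreal (?Q x) \<partial>lebesgue)"
      using pt K0 Q0 by (intro nn_integral_mono) (auto simp flip: ennreal_mult intro!: ennreal_leI)
    also have "\<dots> = ennreal K * (\<integral>\<^sup>+x. ennreal (?Q x) \<partial>lebesgue)"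
    proof (rule nn_integral_cmult)
      have "(\<lambda>x. ennreal (?Q x)) \<in> borel_measurable borel"
        unfolding cball_integral_nn[OF integrable_imp_L1_loc[OF i] powr_ge_zero]
        using G by (intro nn_integral_conv(1) borel_measurable_indicator borel_closed) auto
      then show "(\<lambda>x. ennreal (?Q x)) \<in> borel_measurable lebesgue" by (intro measurable_completion) simp
    qed
    also have "(\<integral>\<^sup>+x. ennreal (?Q x) \<partial>lebesgue) = (\<integral>\<^sup>+y. ennreal (G y powr p) \<partial>lebesgue) * (\<integral>\<^sup>+z. indicator (cball (0::'a) h) z \<partial>lebesgue)"
      unfolding cball_integral_nn[OF integrable_imp_L1_loc[OF i] powr_ge_zero]
      using G by (intro nn_integral_conv(2) borel_measurable_indicator borel_closed) auto
    also have "(\<integral>\<^sup>+y. ennreal (G y powr p) \<partial>lebesgue) = ennreal I"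
      unfolding I_def by (intro nn_integral_eq_integral i) simp
    also have "(\<integral>\<^sup>+z. indicator (cball (0::'a) h) z \<partial>lebesgue) = ennreal W"
      using h emeasure_cball[of h "0::'a"] by (simp add: W_def \<beta>_def)
    also have "ennreal K * (ennreal I * ennreal W) = ennreal (K * (I * W))"
      using K0 I W by (simp add: ennreal_mult)
    also have "K * (I * W) = C * h powr (DIM('a) * (1 - r / p))"
    proof (cases "I = 0")
      case True then show ?thesis using p r by (simp add: K_def C_def)
    next
      case False
      then have I': "I > 0" using I by simp
      have hW: "W = \<beta> * h powr DIM('a)" using h by (simp add: W_def powr_realpow)
      have "K * (I * W) = (\<beta> powr p) powr (r / p) / W powr (r / p) * (I powr (r / p - 1) * I) * W"
        using W by (simp add: K_def powr_divide)
      also have "I powr (r / p - 1) * I = I powr (r / p)" using I' by (simp add: powr_diff)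
      also have "(\<beta> powr p) powr (r / p) = \<beta> powr r" using p by (simp add: powr_powr)
      also have "\<beta> powr r / W powr (r / p) * I powr (r / p) * W = \<beta> powr r * I powr (r / p) * W powr (1 - r / p)"
        using W by (simp add: powr_diff)
      also have "W powr (1 - r / p) = \<beta> powr (1 - r / p) * h powr (DIM('a) * (1 - r / p))"
        using \<beta> h by (simp add: hW powr_mult powr_powr)
      finally show ?thesis by (simp add: C_def)
    qed
    finally show ?thesis .
  qed
  moreover have "C \<ge> 0" by (simp add: C_def)
  ultimately show ?thesis by blast
qed

subsection \<open>Gain of integrability\<close>

text \<open>Half of the decay is spent on summability: with \<open>t = sqrt q\<close> the weighted
  sum \<open>S\<close> of \<open>A k x powr s / t ^ k\<close> still has finite integral, and
  \<open>S\<close> dominates each summand, so \<open>A k x\<close> is at most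
  \<open>S x powr (1 / s)\<close> times a geometric factor. The sum over \<open>k\<close> is thereby
  dominated pointwise by one function.\<close>

lemma geometric_series_bound:
  fixes A :: "nat \<Rightarrow> 'a \<Rightarrow> real"
  assumes meas: "\<And>k. A k \<in> borel_measurable M" and nn: "\<And>k x. A k x \<ge> 0"
    and s: "s > 0" and q: "0 < q" "q < 1" and D: "D \<ge> 0"
    and bd: "\<And>k. (\<integral>\<^sup>+x. ennreal (A k x powr s) \<partial>M) \<le> ennreal (D * q ^ k)"
  shows "\<exists>S C. S \<in> borel_measurable M \<and> (\<integral>\<^sup>+x. S x \<partial>M) < \<infinity> \<and> C \<ge> 0 \<and>
     (\<forall>x K. S x < \<infinity> \<longrightarrow> (\<Sum>k<K. A k x) \<le> C * enn2real (S x) powr (1 / s))"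
proof -
  define t where "t = sqrt q"
  have t: "0 < t" "t < 1" "q = t * t" using q by (auto simp: t_def)
  define v where "v = t powr (1 / s)"
  have v: "0 < v" "v < 1" using t s powr_less_mono2[of "1 / s" t 1] by (auto simp: v_def)
  define S where "S x = (\<Sum>k. ennreal (A k x powr s / t ^ k))" for x
  note [measurable] = meas
  have Sm: "S \<in> borel_measurable M" unfolding S_def by measurable
  have "(\<integral>\<^sup>+x. S x \<partial>M) = (\<Sum>k. \<integral>\<^sup>+x. ennreal (A k x powr s / t ^ k) \<partial>M)"
    unfolding S_def by (intro nn_integral_suminf) measurable
  also have "\<dots> \<le> (\<Sum>k. ennreal (D * t ^ k))"
  proof (intro suminf_le summableI)
    fix k
    have "(\<integral>\<^sup>+x. ennreal (A k x powr s / t ^ k) \<partial>M) = (\<integral>\<^sup>+x. ennreal (1 / t ^ k) * ennreal (A k x powr s) \<partial>M)"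
      using t by (intro nn_integral_cong) (simp flip: ennreal_mult)
    also have "\<dots> = ennreal (1 / t ^ k) * (\<integral>\<^sup>+x. ennreal (A k x powr s) \<partial>M)"
      by (intro nn_integral_cmult) measurable
    also have "\<dots> \<le> ennreal (1 / t ^ k) * ennreal (D * q ^ k)"
      by (intro mult_left_mono bd) simp
    also have "\<dots> = ennreal (D * t ^ k)"
      using t D by (simp flip: ennreal_mult) (simp add: power_mult_distrib)
    finally show "(\<integral>\<^sup>+x. ennreal (A k x powr s / t ^ k) \<partial>M) \<le> ennreal (D * t ^ k)" .
  qed
  also have "\<dots> = ennreal (\<Sum>k. D * t ^ k)"
    using t D by (intro suminf_ennreal2 summable_mult summable_geometric) auto
  also have "\<dots> < \<infinity>" by simp
  finally have Sf: "(\<integral>\<^sup>+x. S x \<partial>M) < \<infinity>" .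
  have "(\<Sum>k<K. A k x) \<le> 1 / (1 - v) * enn2real (S x) powr (1 / s)" if fin: "S x < \<infinity>" for x K
  proof -
    have Ak: "A k x \<le> enn2real (S x) powr (1 / s) * v ^ k" for k
    proof -
      have "ennreal (A k x powr s / t ^ k) \<le> S x"
        unfolding S_def using sum_le_suminf[of "\<lambda>k. ennreal (A k x powr s / t ^ k)" "{k}"] by simp
      then have "A k x powr s / t ^ k \<le> enn2real (S x)"
        using fin t by (metis enn2real_ennreal enn2real_mono infinity_ennreal_def divide_nonneg_pos powr_ge_zero zero_less_power)
      then have "A k x powr s \<le> enn2real (S x) * t ^ k" using t by (simp add: field_simps)
      then have "(A k x powr s) powr (1 / s) \<le> (enn2real (S x) * t ^ k) powr (1 / s)"
        using s by (intro powr_mono2) auto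
      also have "(A k x powr s) powr (1 / s) = A k x" using s nn by (simp add: powr_powr)
      also have "(enn2real (S x) * t ^ k) powr (1 / s) = enn2real (S x) powr (1 / s) * (t ^ k) powr (1 / s)"
        by (rule powr_mult)
      also have "(t ^ k) powr (1 / s) = v ^ k"
        using t by (simp add: v_def powr_powr mult.commute flip: powr_realpow)
      finally show ?thesis .
    qed
    have "(\<Sum>k<K. A k x) \<le> (\<Sum>k<K. enn2real (S x) powr (1 / s) * v ^ k)"
      by (intro sum_mono Ak)
    also have "\<dots> = enn2real (S x) powr (1 / s) * (\<Sum>k<K. v ^ k)" by (simp add: sum_distrib_left)
    also have "\<dots> \<le> enn2real (S x) powr (1 / s) * (1 / (1 - v))"
    proof (intro mult_left_mono)
      have "(\<Sum>k<K. v ^ k) \<le> (\<Sum>k. v ^ k)" using v by (intro sum_le_suminf summable_geometric) auto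
      then show "(\<Sum>k<K. v ^ k) \<le> 1 / (1 - v)" using v by (simp add: suminf_geometric)
    qed simp
    finally show ?thesis by (simp add: mult.commute)
  qed
  moreover have "1 / (1 - v) \<ge> 0" using v by simp
  ultimately show ?thesis using Sm Sf by blast
qed

lemma avg_zero [simp]: "avg h (\<lambda>x. 0) x = 0"
  by (simp add: avg_def)

text \<open>Replaces the average at an unknown intermediate scale by the one at the dyadic scale
  above it.\<close>

lemma avg_halve:
  fixes G :: "'a::euclidean_space \<Rightarrow> real"
  assumes G: "G \<in> L1_loc" "\<And>y. G y \<ge> 0" and h: "h / 2 \<le> t" "t \<le> h" "0 < h"
  shows "avg t G x \<le> 2 ^ DIM('a) * avg h G x"
proof -
  have "(LINT y|lebesgue. G y * indicator (cball x t) y) \<le> (LINT y|lebesgue. G y * indicator (cball x h) y)"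
    using h by (intro integral_mono integrable_cball_times G) (auto simp: indicator_def G)
  moreover have "(LINT y|lebesgue. G y * indicator (cball x h) y) \<ge> 0"
    by (intro Bochner_Integration.integral_nonneg) (simp add: G)
  moreover have "(h / 2) ^ DIM('a) \<le> t ^ DIM('a)" using h by (intro power_mono) auto
  ultimately have "avg t G x \<le> (LINT y|lebesgue. G y * indicator (cball x h) y) / (h / 2) ^ DIM('a)"
    using h unfolding avg_def by (intro frac_le) auto
  then show ?thesis using h by (simp add: avg_def power_divide mult.commute)
qed

lemma abs_integral_le_avg:
  fixes F G :: "'a::euclidean_space \<Rightarrow> real"
  assumes G: "G \<in> L1_loc"
    and bd: "\<And>y. \<bar>F y\<bar> \<le> c / t ^ DIM('a) * (G y * indicator (cball x t) y)"
  shows "\<bar>LINT y|lebesgue. F y\<bar> \<le> c * avg t G x"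
proof -
  have i: "integrable lebesgue (\<lambda>y. c / t ^ DIM('a) * (G y * indicator (cball x t) y))"
    by (intro integrable_mult_right integrable_cball_times G)
  have "norm (LINT y|lebesgue. F y) \<le> (LINT y|lebesgue. c / t ^ DIM('a) * (G y * indicator (cball x t) y))"
  proof (cases "integrable lebesgue F")
    case True
    then show ?thesis using bd by (intro Bochner_Integration.integral_norm_bound_integral i) auto
  next
    \<comment> \<open>A function that is not integrable has Bochner integral \<open>0\<close>, and
      the right-hand side is nonnegative.\<close>
    case False
    have "(LINT y|lebesgue. c / t ^ DIM('a) * (G y * indicator (cball x t) y)) \<ge> 0"
      by (intro Bochner_Integration.integral_nonneg) (meson abs_ge_zero bd order_trans)
    then show ?thesis using False by (simp add: not_integrable_integral_eq)
  qed
  then show ?thesis by (simp add: avg_def)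
qed

lemma powr_sum3_le:
  fixes a b c s :: real
  assumes "a \<ge> 0" "b \<ge> 0" "c \<ge> 0" "s \<ge> 0"
  shows "(a + b + c) powr s \<le> 3 powr s * (a powr s + b powr s + c powr s)"
proof -
  let ?m = "max a (max b c)"
  have "(a + b + c) powr s \<le> (3 * ?m) powr s" using assms by (intro powr_mono2) auto
  also have "\<dots> = 3 powr s * ?m powr s" by (rule powr_mult)
  also have "?m powr s \<le> a powr s + b powr s + c powr s" by (auto simp: max_def)
  finally show ?thesis by simp
qed

text \<open>Writing \<open>w\<close> as the telescoping sum of its dyadic mollifications,
  each difference is controlled by averages over balls, whose \<open>L\<^sup>s\<close> norms decay geometrically when the
  exponents are subcritical. This replaces both the Sobolev and the Calderon-Zygmund inequality.\<close>

lemma integrability_gain: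
  fixes w M U :: "'a::euclidean_space \<Rightarrow> real"
  assumes w: "w \<in> L1_loc"
    and M: "M \<in> borel_measurable lebesgue" "\<And>y. M y \<ge> 0" "integrable lebesgue (\<lambda>x. M x powr p)"
    and U: "U \<in> borel_measurable lebesgue" "\<And>y. U y \<ge> 0" "integrable lebesgue (\<lambda>x. U x powr r)"
    and exps: "1 \<le> p" "p \<le> s" "1 \<le> r" "r \<le> s"
    and e1: "2 * s + DIM('a) * (1 - s / p) > 0" and e2: "s + DIM('a) * (1 - s / r) > 0"
    and C: "C > 0" and wU: "\<And>x. \<bar>w x\<bar> \<le> C * U x"
    and dt: "\<And>t x. 0 < t \<Longrightarrow> t \<le> 1 \<Longrightarrow> \<bar>conv w (rho_dt t) x\<bar> \<le> C * (t * avg t M x + avg t U x)"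
  shows "integrable lebesgue (\<lambda>x. \<bar>w x\<bar> powr s)"
proof -
  have M_loc: "M \<in> L1_loc" using M exps by (intro powr_integrable_L1_loc[where p = p]) auto
  have U_loc: "U \<in> L1_loc" using U exps by (intro powr_integrable_L1_loc[where p = r]) auto
  define h :: "nat \<Rightarrow> real" where "h k = (1 / 2) ^ k" for k
  have h: "h k > 0" "h k \<le> 1" "h (Suc k) = h k / 2" for k
    by (auto simp: h_def power_le_one)
  have h0: "h \<longlonglongrightarrow> 0" unfolding h_def by (rule LIMSEQ_realpow_zero) auto
  \<comment> \<open>An interval \<open>[h / 2, h]\<close> of scales has length of order
    \<open>h\<close>, and this multiplies the bound \<open>t * avg t M x + avg t U x\<close>: hence
    the weights \<open>h\<^sup>2\<close> and \<open>h\<close>. Raised to the power \<open>s\<close>,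
    they become the \<open>2 * s\<close> and \<open>s\<close> of the exponent conditions.\<close>
  define A1 where "A1 k x = (h k)\<^sup>2 * avg (h k) M x" for k x
  define A2 where "A2 k x = h k * avg (h k) U x" for k x
  have hp: "h k powr e = ((1 / 2) powr e) ^ k" for k e
    by (simp add: h_def powr_powr mult.commute flip: powr_realpow)
  obtain C1 where C1: "C1 \<ge> 0" "\<And>h. h > 0 \<Longrightarrow> (\<integral>\<^sup>+x. ennreal (avg h M x powr s) \<partial>lebesgue)
            \<le> ennreal (C1 * h powr (DIM('a) * (1 - s / p)))"
    using avg_powr_integral[OF M(1,2) exps(1,2) M(3)] by blast
  obtain C2 where C2: "C2 \<ge> 0" "\<And>h. h > 0 \<Longrightarrow> (\<integral>\<^sup>+x. ennreal (avg h U x powr s) \<partial>lebesgue)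
            \<le> ennreal (C2 * h powr (DIM('a) * (1 - s / r)))"
    using avg_powr_integral[OF U(1,2) exps(3,4) U(3)] by blast
  have Mm: "avg h M \<in> borel_measurable lebesgue" for h
    by (intro measurable_completion) (simp add: avg_measurable M_loc M)
  have Um: "avg h U \<in> borel_measurable lebesgue" for h
    by (intro measurable_completion) (simp add: avg_measurable U_loc U)
  have scale: "(\<integral>\<^sup>+x. ennreal ((c * F x) powr s) \<partial>lebesgue) \<le> ennreal (c powr s * B)"
    if "c > 0" "F \<in> borel_measurable lebesgue" "B \<ge> 0" "(\<integral>\<^sup>+x. ennreal (F x powr s) \<partial>lebesgue) \<le> ennreal B"
    for c B and F :: "'a \<Rightarrow> real"
  proof -
    note [measurable] = that(2)
    have "(\<integral>\<^sup>+x. ennreal ((c * F x) powr s) \<partial>lebesgue) = (\<integral>\<^sup>+x. ennreal (c powr s) * ennreal (F x powr s) \<partial>lebesgue)"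
      by (simp add: powr_mult ennreal_mult)
    also have "\<dots> = ennreal (c powr s) * (\<integral>\<^sup>+x. ennreal (F x powr s) \<partial>lebesgue)"
      by (intro nn_integral_cmult) measurable
    also have "\<dots> \<le> ennreal (c powr s) * ennreal B" by (intro mult_left_mono that) simp
    finally show ?thesis using that by (simp add: ennreal_mult)
  qed
  have A1b: "(\<integral>\<^sup>+x. ennreal (A1 k x powr s) \<partial>lebesgue) \<le> ennreal (C1 * ((1 / 2) powr (2 * s + DIM('a) * (1 - s / p))) ^ k)" for k
  proof -
    have "(\<integral>\<^sup>+x. ennreal (A1 k x powr s) \<partial>lebesgue) \<le> ennreal (((h k)\<^sup>2) powr s * (C1 * h k powr (DIM('a) * (1 - s / p))))"
      unfolding A1_def using h(1)[of k] C1 Mm by (intro scale) (auto intro: C1(2))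
    also have "((h k)\<^sup>2) powr s = h k powr (2 * s)"
      using powr_powr[of "h k" 2 s] h(1)[of k] by simp
    also have "h k powr (2 * s) * (C1 * h k powr (DIM('a) * (1 - s / p))) = C1 * h k powr (2 * s + DIM('a) * (1 - s / p))"
      by (simp add: powr_add)
    finally show ?thesis by (simp add: hp)
  qed
  have A2b: "(\<integral>\<^sup>+x. ennreal (A2 k x powr s) \<partial>lebesgue) \<le> ennreal (C2 * ((1 / 2) powr (s + DIM('a) * (1 - s / r))) ^ k)" for k
  proof -
    have "(\<integral>\<^sup>+x. ennreal (A2 k x powr s) \<partial>lebesgue) \<le> ennreal (h k powr s * (C2 * h k powr (DIM('a) * (1 - s / r))))"
      unfolding A2_def using h(1)[of k] C2 Um by (intro scale) (auto intro: C2(2))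
    also have "h k powr s * (C2 * h k powr (DIM('a) * (1 - s / r))) = C2 * h k powr (s + DIM('a) * (1 - s / r))"
      by (simp add: powr_add)
    finally show ?thesis by (simp add: hp)
  qed
  have s: "s > 0" using exps by simp
  have lt1: "(1 / 2) powr e < (1::real)" "0 < (1 / 2::real) powr e" if "e > 0" for e :: real
    using powr_less_mono2[of e "1 / 2" 1] that by auto
  have A1m: "A1 k \<in> borel_measurable lebesgue" for k unfolding A1_def using Mm by measurable
  have A2m: "A2 k \<in> borel_measurable lebesgue" for k unfolding A2_def using Um by measurable
  have A1n: "A1 k x \<ge> 0" for k x unfolding A1_def using h by (intro mult_nonneg_nonneg avg_nonneg M) auto
  have A2n: "A2 k x \<ge> 0" for k x unfolding A2_def using h less_imp_le[OF h(1)] by (intro mult_nonneg_nonneg avg_nonneg U) auto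
  obtain S1 D1 where S1: "S1 \<in> borel_measurable lebesgue" "(\<integral>\<^sup>+x. S1 x \<partial>lebesgue) < \<infinity>" "D1 \<ge> 0"
     "\<And>x K. S1 x < \<infinity> \<Longrightarrow> (\<Sum>k<K. A1 k x) \<le> D1 * enn2real (S1 x) powr (1 / s)"
    using geometric_series_bound[OF A1m A1n s lt1(2)[OF e1] lt1(1)[OF e1] C1(1) A1b] by blast
  obtain S2 D2 where S2: "S2 \<in> borel_measurable lebesgue" "(\<integral>\<^sup>+x. S2 x \<partial>lebesgue) < \<infinity>" "D2 \<ge> 0"
     "\<And>x K. S2 x < \<infinity> \<Longrightarrow> (\<Sum>k<K. A2 k x) \<le> D2 * enn2real (S2 x) powr (1 / s)"
    using geometric_series_bound[OF A2m A2n s lt1(2)[OF e2] lt1(1)[OF e2] C2(1) A2b] by blast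
  obtain B where B: "B > 0" "\<And>t z. t > 0 \<Longrightarrow> \<bar>rho t (z::'a)\<bar> \<le> B / t ^ DIM('a)"
    using moll_bounded unfolding rho_def by blast
  \<comment> \<open>The coarsest scale starts the telescoping sum and is bounded directly through
    \<open>wU\<close>.\<close>
  have start: "\<bar>conv w (rho 1) x\<bar> \<le> C * B * avg 1 U x" for x
    unfolding conv_def
  proof (rule abs_integral_le_avg[OF U_loc])
    fix y
    show "\<bar>w y * rho 1 (y - x)\<bar> \<le> C * B / 1 ^ DIM('a) * (U y * indicator (cball x 1) y)"
    proof (cases "dist x y \<le> 1")
      case True
      have "\<bar>w y\<bar> * \<bar>rho 1 (y - x)\<bar> \<le> (C * U y) * B"
        using wU[of y] B(2)[of 1 "y - x"] C U by (intro mult_mono) auto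
      then show ?thesis using True by (simp add: abs_mult mult_ac)
    next
      case False
      then have "rho 1 (y - x) = 0" by (simp add: rho_def moll_eq_0 dist_norm norm_minus_commute)
      then show ?thesis using C B U by simp
    qed
  qed
  let ?P = "(2::real) ^ DIM('a)"
  have step: "\<bar>conv w (rho (h (Suc k))) x - conv w (rho (h k)) x\<bar> \<le> C * ?P * (A1 k x + A2 k x)" for k x
  proof -
    have lt: "h k / 2 < h k" using h(1)[of k] by simp
    have der: "((\<lambda>t. conv w (rho t) x) has_real_derivative conv w (rho_dt u) x) (at u)"
      if "h k / 2 \<le> u" "u \<le> h k" for u
      using conv_rho_has_derivative_t[OF w, of u x] that h(1)[of k] by simp
    \<comment> \<open>The mean value theorem supplies some scale in between;
      \<open>avg_halve\<close> leads back to \<open>h k\<close>.\<close>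
    obtain z where z: "h k / 2 < z" "z < h k"
      "conv w (rho (h k)) x - conv w (rho (h k / 2)) x = (h k - h k / 2) * conv w (rho_dt z) x"
      using MVT2[OF lt der] by blast
    have zp: "z > 0" "z \<le> 1" using z h[of k] by auto
    have "\<bar>conv w (rho (h (Suc k))) x - conv w (rho (h k)) x\<bar> = h k / 2 * \<bar>conv w (rho_dt z) x\<bar>"
      unfolding h(3) abs_minus_commute[of "conv w (rho (h k / 2)) x"] z(3)
      using h(1)[of k] by (simp add: abs_mult)
    also have "\<dots> \<le> h k * \<bar>conv w (rho_dt z) x\<bar>" using h(1)[of k] by (intro mult_right_mono) auto
    also have "\<dots> \<le> h k * (C * (z * avg z M x + avg z U x))"
      using dt[OF zp] h(1)[of k] by (intro mult_left_mono) auto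
    also have "\<dots> \<le> h k * (C * (h k * (?P * avg (h k) M x) + ?P * avg (h k) U x))"
      using C h(1)[of k] z zp
      by (intro mult_left_mono add_mono mult_mono avg_halve M_loc M U_loc U avg_nonneg) auto
    also have "\<dots> = C * ?P * (A1 k x + A2 k x)"
      by (simp add: A1_def A2_def power2_eq_square algebra_simps)
    finally show ?thesis .
  qed
  have tele: "\<bar>conv w (rho (h K)) x\<bar> \<le> C * B * avg 1 U x + C * ?P * ((\<Sum>k<K. A1 k x) + (\<Sum>k<K. A2 k x))" for K x
  proof (induction K)
    case 0 then show ?case using start by (simp add: h_def)
  next
    case (Suc K)
    then show ?case using step[of K x] by (simp add: algebra_simps)
  qed
  define E where "E = C * (B + ?P * (D1 + D2))"
  have E: "E > 0" unfolding E_def using C B S1 S2 by (intro mult_pos_pos add_pos_nonneg) auto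
  define X where "X x = avg 1 U x + enn2real (S1 x) powr (1 / s) + enn2real (S2 x) powr (1 / s)" for x
  have a0: "avg 1 U x \<ge> 0" for x by (intro avg_nonneg U) auto
  have bd: "\<bar>conv w (rho (h K)) x\<bar> \<le> E * X x" if fin: "S1 x < \<infinity>" "S2 x < \<infinity>" for K x
  proof -
    let ?a = "enn2real (S1 x) powr (1 / s)" and ?b = "enn2real (S2 x) powr (1 / s)"
    have "\<bar>conv w (rho (h K)) x\<bar> \<le> C * B * avg 1 U x + C * ?P * (D1 * ?a + D2 * ?b)"
      using B(1) a0[of x] C S1(4)[OF fin(1), of K] S2(4)[OF fin(2), of K]
      by (intro order_trans[OF tele] add_mono mult_left_mono) auto
    also have "\<dots> \<le> E * avg 1 U x + (E * ?a + E * ?b)"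
    proof -
      have "C * B \<le> E" "C * ?P * D1 \<le> E" "C * ?P * D2 \<le> E"
        unfolding E_def using C B S1(3) S2(3) by (auto simp: algebra_simps)
      then have "C * B * avg 1 U x \<le> E * avg 1 U x" "C * ?P * D1 * ?a \<le> E * ?a" "C * ?P * D2 * ?b \<le> E * ?b"
        using a0 by (auto intro!: mult_right_mono)
      then show ?thesis by (simp add: algebra_simps)
    qed
    finally show ?thesis by (simp add: X_def algebra_simps)
  qed
  \<comment> \<open>Where \<open>S1\<close> or \<open>S2\<close> is infinite the bound is set to
    infinity. There the right-hand side of the next estimate is infinite as well, because
    \<open>E > 0\<close>, so no exceptional set has to be split off.\<close>
  have "AE x in lebesgue. ennreal \<bar>w x\<bar> \<le> (if S1 x < \<infinity> \<and> S2 x < \<infinity> then ennreal (E * X x) else \<infinity>)"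
    by (rule AE_bound_of_conv_rho[OF w h(1,2) h0]) (use bd in \<open>auto intro: ennreal_leI\<close>)
  then have ae: "AE x in lebesgue. ennreal (\<bar>w x\<bar> powr s) \<le> ennreal (E powr s * 3 powr s) * (ennreal (avg 1 U x powr s) + S1 x + S2 x)"
  proof eventually_elim
    case (elim x)
    show ?case
    proof (cases "S1 x < \<infinity> \<and> S2 x < \<infinity>")
      case True
      have X0: "X x \<ge> 0" unfolding X_def using a0 by simp
      have "\<bar>w x\<bar> \<le> E * X x" using elim True E X0 by (simp add: ennreal_le_iff)
      then have "\<bar>w x\<bar> powr s \<le> (E * X x) powr s" using s by (intro powr_mono2) auto
      also have "\<dots> = E powr s * X x powr s" by (rule powr_mult)
      also have "X x powr s \<le> 3 powr s * (avg 1 U x powr s + (enn2real (S1 x) powr (1 / s)) powr s + (enn2real (S2 x) powr (1 / s)) powr s)"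
        unfolding X_def using a0 s by (intro powr_sum3_le) auto
      also have "(enn2real (S1 x) powr (1 / s)) powr s = enn2real (S1 x)" using s by (simp add: powr_powr)
      also have "(enn2real (S2 x) powr (1 / s)) powr s = enn2real (S2 x)" using s by (simp add: powr_powr)
      finally have "\<bar>w x\<bar> powr s \<le> E powr s * 3 powr s * (avg 1 U x powr s + enn2real (S1 x) + enn2real (S2 x))"
        by (simp add: mult_left_mono)
      then have "ennreal (\<bar>w x\<bar> powr s) \<le> ennreal (E powr s * 3 powr s * (avg 1 U x powr s + enn2real (S1 x) + enn2real (S2 x)))"
        by (rule ennreal_leI)
      also have "\<dots> = ennreal (E powr s * 3 powr s) * (ennreal (avg 1 U x powr s) + ennreal (enn2real (S1 x)) + ennreal (enn2real (S2 x)))"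
        by (simp add: ennreal_mult ennreal_plus)
      finally show ?thesis using True by simp
    next
      case False
      then have infinite: "ennreal (avg 1 U x powr s) + S1 x + S2 x = top" by (auto simp: less_top[symmetric])
      show ?thesis unfolding infinite using E by (simp add: ennreal_mult_top)
    qed
  qed
  have [measurable]: "w \<in> borel_measurable lebesgue" using w by (simp add: L1_loc_def)
  note [measurable] = S1(1) S2(1) Um
  have "(\<integral>\<^sup>+x. ennreal (\<bar>w x\<bar> powr s) \<partial>lebesgue) \<le>
     (\<integral>\<^sup>+x. ennreal (E powr s * 3 powr s) * (ennreal (avg 1 U x powr s) + S1 x + S2 x) \<partial>lebesgue)"
    by (rule nn_integral_mono_AE[OF ae])
  also have "\<dots> = ennreal (E powr s * 3 powr s) * ((\<integral>\<^sup>+x. ennreal (avg 1 U x powr s) \<partial>lebesgue) + (\<integral>\<^sup>+x. S1 x \<partial>lebesgue) + (\<integral>\<^sup>+x. S2 x \<partial>lebesgue))"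
    by (subst nn_integral_cmult) (auto simp: nn_integral_add)
  also have "\<dots> < \<infinity>"
    using S1(2) S2(2) le_less_trans[OF C2(2)[of 1] ennreal_less_top]
    by (auto simp: ennreal_mult_less_top)
  finally show ?thesis
    by (intro integrableI_bounded) auto
qed

subsection \<open>Weak gradients\<close>

definition pd :: "'a \<Rightarrow> ('a::euclidean_space \<Rightarrow> real) \<Rightarrow> 'a \<Rightarrow> real" where
  "pd b g x = grad g x \<bullet> b"

lemma smooth_fun_pd: "smooth_fun g \<Longrightarrow> smooth_fun (pd b g)"
  unfolding pd_def[abs_def] by (rule smooth_fun_grad)

lemma pd_mult:
  assumes "smooth_fun g" "smooth_fun h"
  shows "pd b (\<lambda>x. g x * h x) = (\<lambda>x. g x * pd b h x + h x * pd b g x)"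
proof
  fix x
  have "GDERIV (\<lambda>x. g x * h x) x :> g x *\<^sub>R grad h x + h x *\<^sub>R grad g x"
    using assms by (intro GDERIV_mult smooth_fun_GDERIV)
  then show "pd b (\<lambda>x. g x * h x) x = g x * pd b h x + h x * pd b g x"
    by (simp add: pd_def grad_eq inner_add_left)
qed

lemma pd_add:
  assumes "smooth_fun g" "smooth_fun h"
  shows "pd b (\<lambda>x. g x + h x) = (\<lambda>x. pd b g x + pd b h x)"
proof
  fix x
  have "GDERIV (\<lambda>x. g x + h x) x :> grad g x + grad h x"
    using assms by (intro GDERIV_add smooth_fun_GDERIV)
  then show "pd b (\<lambda>x. g x + h x) x = pd b g x + pd b h x"
    by (simp add: pd_def grad_eq inner_add_left)
qed

lemma pd_moll:
  "pd b (\<lambda>y. moll p t (y - a)) = (\<lambda>y. - 2 / t\<^sup>2 * moll (flat_deriv p) t (y - a) * ((y - a) \<bullet> b))"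
  unfolding pd_def grad_eq[OF moll_GDERIV] by (simp add: fun_eq_iff)

lemma pd_coord: "pd b (\<lambda>y. (y - a) \<bullet> c) = (\<lambda>y. c \<bullet> b)"
proof
  fix y
  have "GDERIV (\<lambda>y. (y - a) \<bullet> c) y :> c"
    unfolding gderiv_def by (auto intro!: derivative_eq_intros)
  then show "pd b (\<lambda>y. (y - a) \<bullet> c) y = c \<bullet> b" by (simp add: pd_def grad_eq)
qed

lemma smooth_fun_coord_shift: "smooth_fun (\<lambda>y. (y - a) \<bullet> c)"
  using smooth_fun.add[OF smooth_fun.coord[of c] smooth_fun.const[of "- (a \<bullet> c)"]]
  by (simp add: inner_diff_left)

lemma pd_cmult: "smooth_fun g \<Longrightarrow> pd b (\<lambda>x. c * g x) = (\<lambda>x. c * pd b g x)"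
proof
  fix x assume g: "smooth_fun g"
  have "GDERIV (\<lambda>x. c * g x) x :> c *\<^sub>R grad g x + g x *\<^sub>R 0"
    by (rule GDERIV_mult[OF GDERIV_const smooth_fun_GDERIV[OF g]])
  then show "pd b (\<lambda>x. c * g x) x = c * pd b g x" by (simp add: pd_def grad_eq)
qed

text \<open>The closed form serves twice: its trace is the Laplacian of the kernel, and its symmetry
  in \<open>b\<close> and \<open>c\<close> lets mixed derivatives of \<open>rho\<close>
  commute.\<close>

lemma pd_pd_moll:
  "pd c (pd b (\<lambda>y. moll p t (y - a))) = (\<lambda>y. - 2 / t\<^sup>2 * (moll (flat_deriv p) t (y - a) * (b \<bullet> c)
     - 2 / t\<^sup>2 * moll (flat_deriv (flat_deriv p)) t (y - a) * ((y - a) \<bullet> c) * ((y - a) \<bullet> b)))"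
proof -
  have "pd b (\<lambda>y. moll p t (y - a)) = (\<lambda>y. - 2 / t\<^sup>2 * (moll (flat_deriv p) t (y - a) * ((y - a) \<bullet> b)))"
    by (simp add: pd_moll mult.assoc)
  moreover have "pd c (\<lambda>y. - 2 / t\<^sup>2 * (moll (flat_deriv p) t (y - a) * ((y - a) \<bullet> b)))
     = (\<lambda>y. - 2 / t\<^sup>2 * pd c (\<lambda>y. moll (flat_deriv p) t (y - a) * ((y - a) \<bullet> b)) y)"
    by (intro pd_cmult smooth_fun.mult smooth_fun_moll smooth_fun_coord_shift)
  moreover have "pd c (\<lambda>y. moll (flat_deriv p) t (y - a) * ((y - a) \<bullet> b)) = (\<lambda>y.
      moll (flat_deriv p) t (y - a) * (b \<bullet> c) + ((y - a) \<bullet> b) * (- 2 / t\<^sup>2 * moll (flat_deriv (flat_deriv p)) t (y - a) * ((y - a) \<bullet> c)))"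
    by (subst pd_mult[OF smooth_fun_moll smooth_fun_coord_shift]) (simp only: pd_coord pd_moll)
  moreover have "- k * (M * d + B * (- k * S * C)) = - k * (M * d - k * S * C * B)" for k M d B S C :: real
    by (simp add: algebra_simps)
  from this[of "2 / t\<^sup>2"]
  have "- 2 / t\<^sup>2 * (M * d + B * (- 2 / t\<^sup>2 * S * C)) = - 2 / t\<^sup>2 * (M * d - 2 / t\<^sup>2 * S * C * B)" for M d B S C :: real
    by simp
  ultimately show ?thesis by (simp only:)
qed

text \<open>Dilation with constant mass gives
  \<open>\<partial>_t \<rho>_t = - div (z \<rho>_t) / t\<close>, and \<open>z \<rho>_t\<close> is
  \<open>- t\<^sup>2 / 2\<close> times the gradient of \<open>moll 1 t\<close>. The proof compares
  the two closed forms after taking the trace.\<close>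

lemma rho_dt_eq_laplacian:
  fixes x y :: "'a::euclidean_space"
  assumes t: "t > 0"
  shows "rho_dt t (y - x) = t / 2 * (\<Sum>b\<in>Basis. pd b (pd b (\<lambda>y. moll 1 t (y - x))) y)"
proof -
  let ?z = "y - x"
  have "(\<Sum>b\<in>Basis. pd b (pd b (\<lambda>y. moll 1 t (y - x))) y) =
     (\<Sum>b\<in>(Basis::'a set). - 2 / t\<^sup>2 * (rho t ?z - 2 / t\<^sup>2 * moll (flat_deriv (flat_deriv 1)) t ?z * ((?z \<bullet> b) * (?z \<bullet> b))))"
    unfolding pd_pd_moll by (intro sum.cong refl) (simp add: inner_same_Basis rho_def)
  also have "\<dots> = - 2 / t\<^sup>2 * (DIM('a) * rho t ?z - 2 / t\<^sup>2 * moll (flat_deriv (flat_deriv 1)) t ?z * (?z \<bullet> ?z))"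
    unfolding euclidean_inner[of ?z ?z] by (simp only: sum_distrib_left[symmetric] sum_subtractf sum_constant)
  finally show ?thesis
    using t by (simp add: rho_dt_def field_simps power2_eq_square power3_eq_cube)
qed

lemma smooth_fun_bounded:
  fixes \<phi> :: "'a::euclidean_space \<Rightarrow> real"
  assumes "smooth_fun \<phi>" "\<And>y. y \<notin> cball a r \<Longrightarrow> \<phi> y = 0"
  shows "\<exists>B>0. \<forall>y. \<bar>\<phi> y\<bar> \<le> B"
proof -
  have "compact (\<phi> ` cball a r)" by (intro compact_continuous_image smooth_fun_continuous assms) auto
  then obtain B where B: "B > 0" "\<forall>y\<in>cball a r. \<bar>\<phi> y\<bar> \<le> B"
    using compact_imp_bounded[of "\<phi> ` cball a r"] unfolding bounded_pos by auto
  then have "\<bar>\<phi> y\<bar> \<le> B" for y using assms(2)[of y] by (cases "y \<in> cball a r") auto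
  with B show ?thesis by blast
qed

lemma integrable_L1_loc_smooth:
  fixes v \<phi> :: "'a::euclidean_space \<Rightarrow> real"
  assumes v: "v \<in> L1_loc" and \<phi>: "smooth_fun \<phi>" "\<And>y. y \<notin> cball a r \<Longrightarrow> \<phi> y = 0"
  shows "integrable lebesgue (\<lambda>y. v y * \<phi> y)"
proof -
  obtain B where "\<forall>y. \<bar>\<phi> y\<bar> \<le> B" using smooth_fun_bounded[OF \<phi>] by blast
  then show ?thesis
    using \<phi> by (intro integrable_L1_loc_times[OF v, where B = B and a = a and r = r])
      (auto intro: continuous_lebesgue_measurable smooth_fun_continuous)
qed

lemma L1_loc_inner:
  fixes F :: "'a::euclidean_space \<Rightarrow> 'b::euclidean_space"
  shows "F \<in> L1_loc \<Longrightarrow> (\<lambda>x. F x \<bullet> b) \<in> L1_loc"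
  unfolding L1_loc_def set_integrable_def
  by (auto simp: inner_scaleR_left[symmetric] simp del: inner_scaleR_left)

lemma L1_loc_norm:
  fixes F :: "'a::euclidean_space \<Rightarrow> 'b::euclidean_space"
  assumes "F \<in> L1_loc" shows "(\<lambda>x. norm (F x)) \<in> L1_loc"
proof -
  have "integrable lebesgue (\<lambda>x. indicator K x *\<^sub>R norm (F x))" if "compact K" for K
  proof -
    have "integrable lebesgue (\<lambda>x. norm (indicator K x *\<^sub>R F x))"
      using assms that by (intro integrable_norm) (auto simp: L1_loc_def set_integrable_def)
    then show ?thesis by simp
  qed
  then show ?thesis using assms by (auto simp: L1_loc_def set_integrable_def)
qed

lemma L1_loc_add:
  "v \<in> L1_loc \<Longrightarrow> w \<in> L1_loc \<Longrightarrow> (\<lambda>x. v x + w x) \<in> L1_loc"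
  unfolding L1_loc_def by auto

lemma L1_loc_diff:
  "v \<in> L1_loc \<Longrightarrow> w \<in> L1_loc \<Longrightarrow> (\<lambda>x. v x - w x) \<in> L1_loc"
  unfolding L1_loc_def by auto

lemma L1_loc_times_smooth:
  fixes v \<phi> :: "'a::euclidean_space \<Rightarrow> real"
  assumes "v \<in> L1_loc" "smooth_fun \<phi>" "\<And>y. y \<notin> cball a r \<Longrightarrow> \<phi> y = 0"
  shows "(\<lambda>x. v x * \<phi> x) \<in> L1_loc"
  by (rule integrable_imp_L1_loc[OF integrable_L1_loc_smooth[OF assms]])

lemma weak_gradientD:
  fixes u \<phi> :: "'a::euclidean_space \<Rightarrow> real"
  assumes "has_weak_gradient u Du" "smooth_fun \<phi>" "\<And>y. y \<notin> cball a r \<Longrightarrow> \<phi> y = 0" "b \<in> Basis"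
  shows "(LINT x|lebesgue. u x * pd b \<phi> x) = - (LINT x|lebesgue. (Du x \<bullet> b) * \<phi> x)"
  using assms smooth_fun_Cc_infinity[OF assms(2,3)] by (simp add: has_weak_gradient_def pd_def)

lemma pd_outside:
  assumes "\<And>x. x \<notin> cball a r \<Longrightarrow> g x = 0" "x \<notin> cball a r"
  shows "pd b g x = 0"
  using grad_outside[OF assms] by (simp add: pd_def)

lemma moll_shift_outside: "t > 0 \<Longrightarrow> y \<notin> cball x t \<Longrightarrow> moll p t (y - x) = 0"
  by (rule moll_eq_0) (auto simp: dist_norm norm_minus_commute)

lemma rho_shift_outside: "t > 0 \<Longrightarrow> y \<notin> cball x t \<Longrightarrow> rho t (y - x) = 0"
  unfolding rho_def by (rule moll_shift_outside)

lemma weak_gradient_rho: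
  fixes u :: "'a::euclidean_space \<Rightarrow> real"
  assumes "has_weak_gradient u D" "t > 0" "b \<in> Basis"
  shows "(LINT y|lebesgue. u y * pd b (\<lambda>y. rho t (y - x)) y) = - conv (\<lambda>y. D y \<bullet> b) (rho t) x"
  unfolding conv_def
  by (rule weak_gradientD[OF assms(1) smooth_fun_rho_shift _ assms(3)]) (rule rho_shift_outside[OF assms(2)])

text \<open>Differentiation brings out \<open>2 / t\<^sup>2\<close> times a coordinate of
  \<open>y - x\<close>, which on the support is at most \<open>t\<close>: a net loss of
  \<open>1 / t\<close>.\<close>

lemma pd_moll_bound:
  fixes x y :: "'a::euclidean_space"
  assumes B: "\<And>t z. t > 0 \<Longrightarrow> \<bar>rho t (z::'a)\<bar> \<le> B / t ^ DIM('a)" and t: "t > 0" and b: "b \<in> Basis"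
  shows "\<bar>pd b (\<lambda>y. moll 1 t (y - x)) y\<bar> \<le> 2 * B / t / t ^ DIM('a) * indicator (cball x t) y"
proof (cases "y \<in> cball x t")
  case True
  then have n: "\<bar>(y - x) \<bullet> b\<bar> \<le> t"
    using Basis_le_norm[OF b, of "y - x"] by (simp add: dist_norm norm_minus_commute)
  have "\<bar>pd b (\<lambda>y. moll 1 t (y - x)) y\<bar> = 2 / t\<^sup>2 * (\<bar>rho t (y - x)\<bar> * \<bar>(y - x) \<bullet> b\<bar>)"
    unfolding pd_moll by (simp add: abs_mult rho_def)
  also have "\<dots> \<le> 2 / t\<^sup>2 * (B / t ^ DIM('a) * t)"
    using n B[OF t, of "y - x"] t by (intro mult_left_mono mult_mono) auto
  finally show ?thesis using True t by (simp add: power2_eq_square)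
next
  case False
  then show ?thesis using pd_outside[OF moll_shift_outside[OF t] False] by simp
qed

text \<open>Only one of the two derivatives is moved onto \<open>u\<close>. The first derivative
  left on \<open>moll 1 t\<close> costs \<open>1 / t\<close>, which the prefactor absorbs, so the
  scale derivative is comparable to an average of \<open>norm (Du y)\<close>.\<close>

lemma conv_rho_dt_weak_gradient:
  fixes u :: "'a::euclidean_space \<Rightarrow> real"
  assumes w: "has_weak_gradient u Du" and t: "t > 0"
  shows "conv u (rho_dt t) x = - (t / 2) * (\<Sum>b\<in>Basis. LINT y|lebesgue. (Du y \<bullet> b) * pd b (\<lambda>y. moll 1 t (y - x)) y)"
proof -
  let ?J = "\<lambda>y. moll 1 t (y - x)"
  have uL: "u \<in> L1_loc" using w by (simp add: has_weak_gradient_def)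
  note J0 = moll_shift_outside[OF t, of _ x 1]
  have i: "integrable lebesgue (\<lambda>y. u y * pd b (pd b ?J) y)" for b
    by (rule integrable_L1_loc_smooth[OF uL, of _ x t])
       (auto intro!: smooth_fun_pd smooth_fun_moll pd_outside J0)
  have "conv u (rho_dt t) x = (LINT y|lebesgue. t / 2 * (\<Sum>b\<in>Basis. u y * pd b (pd b ?J) y))"
    unfolding conv_def
    by (intro Bochner_Integration.integral_cong refl)
       (simp add: rho_dt_eq_laplacian[OF t] sum_distrib_left mult_ac)
  also have "\<dots> = t / 2 * (\<Sum>b\<in>Basis. LINT y|lebesgue. u y * pd b (pd b ?J) y)"
    by (subst integral_mult_right_zero, subst Bochner_Integration.integral_sum) (auto simp: i)
  also have "(\<Sum>b\<in>Basis. LINT y|lebesgue. u y * pd b (pd b ?J) y)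
     = (\<Sum>b\<in>Basis. - (LINT y|lebesgue. (Du y \<bullet> b) * pd b ?J y))"
    by (intro sum.cong refl weak_gradientD[OF w, of _ x t] smooth_fun_pd smooth_fun_moll pd_outside J0) auto
  finally show ?thesis by (simp add: sum_negf)
qed

text \<open>An instance of \<open>integrability_gain\<close> in which the square integrable
  \<open>U = \<bar>u\<bar> + norm Du\<close> carries everything with \<open>r = 2\<close>, while
  \<open>M = 0\<close> and \<open>p = s\<close> turn the other exponent condition into
  \<open>2 * s > 0\<close>. In dimension \<open>N > 2\<close> the assumption on \<open>s\<close>
  reads \<open>s < 2N/(N-2)\<close>.\<close>

lemma subcritical_embedding:
  fixes u :: "'a::euclidean_space \<Rightarrow> real"
  assumes w: "has_weak_gradient u Du" and u2: "u \<in> Lp 2" and D2: "Du \<in> Lp 2"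
    and s: "2 \<le> s" "s + DIM('a) * (1 - s / 2) > 0"
  shows "integrable lebesgue (\<lambda>x. \<bar>u x\<bar> powr s)"
proof -
  have uL: "u \<in> L1_loc" and DL: "Du \<in> L1_loc" using w by (auto simp: has_weak_gradient_def)
  define U where "U x = \<bar>u x\<bar> + norm (Du x)" for x
  have U_loc: "U \<in> L1_loc"
    unfolding U_def using L1_loc_add[OF L1_loc_norm[OF uL] L1_loc_norm[OF DL]] by simp
  then have Um[measurable]: "U \<in> borel_measurable lebesgue" by (simp add: L1_loc_def)
  have Un: "U x \<ge> 0" for x by (simp add: U_def)
  have Ui: "integrable lebesgue (\<lambda>x. U x powr 2)"
  proof (rule Bochner_Integration.integrable_bound)
    show "integrable lebesgue (\<lambda>x. 2 * (norm (u x) powr 2) + 2 * (norm (Du x) powr 2))"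
      using u2 D2 by (intro Bochner_Integration.integrable_add integrable_mult_right) (auto simp: Lp_def)
    have "(a + b)\<^sup>2 \<le> 2 * a\<^sup>2 + 2 * b\<^sup>2" for a b :: real
      using zero_le_power2[of "a - b"] by (simp add: power2_sum power2_diff)
    from this[of "\<bar>u _\<bar>" "norm (Du _)"]
    show "AE x in lebesgue. norm (U x powr 2) \<le> norm (2 * (norm (u x) powr 2) + 2 * (norm (Du x) powr 2))"
      using Un by (intro AE_I2) (simp add: U_def)
  qed measurable
  obtain B where B: "B > 0" "\<And>t z. t > 0 \<Longrightarrow> \<bar>rho t (z::'a)\<bar> \<le> B / t ^ DIM('a)"
    using moll_bounded unfolding rho_def by blast
  \<comment> \<open>The \<open>1\<close> serves the comparison of \<open>u\<close> with
    \<open>U\<close>; each of the \<open>DIM('a)\<close> partial derivatives contributes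
    \<open>t / 2 * (2 * B / t) = B\<close>.\<close>
  define C where "C = 1 + DIM('a) * B"
  have C: "C > 0" unfolding C_def using B by (intro add_pos_nonneg) auto
  show ?thesis
  proof (rule integrability_gain[OF uL, where M = "\<lambda>x. 0" and U = U and p = s and r = 2 and C = C])
    show "\<bar>u x\<bar> \<le> C * U x" for x
    proof -
      have "\<bar>u x\<bar> \<le> 1 * U x" by (simp add: U_def)
      also have "\<dots> \<le> C * U x" unfolding C_def using B Un by (intro mult_right_mono) auto
      finally show ?thesis .
    qed
    show "\<bar>conv u (rho_dt t) x\<bar> \<le> C * (t * avg t (\<lambda>x. 0) x + avg t U x)" if t: "0 < t" "t \<le> 1" for t x
    proof -
      let ?I = "\<lambda>b. LINT y|lebesgue. (Du y \<bullet> b) * pd b (\<lambda>y. moll 1 t (y - x)) y"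
      have Ib: "\<bar>?I b\<bar> \<le> 2 * B / t * avg t U x" if b: "b \<in> Basis" for b
      proof (rule abs_integral_le_avg[OF U_loc])
        fix y
        have "\<bar>Du y \<bullet> b\<bar> \<le> U y" using Basis_le_norm[OF b, of "Du y"] by (simp add: U_def)
        then have "\<bar>Du y \<bullet> b\<bar> * \<bar>pd b (\<lambda>y. moll 1 t (y - x)) y\<bar>
            \<le> U y * (2 * B / t / t ^ DIM('a) * indicator (cball x t) y)"
          using pd_moll_bound[OF B(2) t(1) b, of x y] Un by (intro mult_mono) auto
        then show "\<bar>(Du y \<bullet> b) * pd b (\<lambda>y. moll 1 t (y - x)) y\<bar> \<le> 2 * B / t / t ^ DIM('a) * (U y * indicator (cball x t) y)"
          by (simp add: abs_mult mult_ac)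
      qed
      have "\<bar>conv u (rho_dt t) x\<bar> = t / 2 * \<bar>\<Sum>b\<in>Basis. ?I b\<bar>"
        unfolding conv_rho_dt_weak_gradient[OF w t(1)] using t by (simp add: abs_mult)
      also have "\<dots> \<le> t / 2 * (\<Sum>b\<in>(Basis::'a set). 2 * B / t * avg t U x)"
        using t Ib by (intro mult_left_mono order_trans[OF sum_abs] sum_mono) auto
      also have "\<dots> = DIM('a) * B * avg t U x" using t by simp
      also have "\<dots> \<le> C * avg t U x"
        unfolding C_def using avg_nonneg[OF Un t(1), where x = x] by (intro mult_right_mono) auto
      finally show ?thesis by simp
    qed
  qed (use s C Un Ui in auto)
qed

text \<open>The fundamental lemma of the calculus of variations, with mollifiers as the only test
  functions.\<close>

lemma AE_zero_of_conv_rho: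
  fixes w :: "'a::euclidean_space \<Rightarrow> real"
  assumes w: "w \<in> L1_loc" and z: "\<And>t x. 0 < t \<Longrightarrow> t \<le> 1 \<Longrightarrow> conv w (rho t) x = 0"
  shows "AE x in lebesgue. w x = 0"
proof -
  have "AE x in lebesgue. ennreal \<bar>w x\<bar> \<le> 0"
  proof (rule AE_bound_of_conv_rho[OF w, where h = "\<lambda>n. (1 / 2) ^ n"])
    show "(\<lambda>n. (1 / 2) ^ n :: real) \<longlonglongrightarrow> 0" by (rule LIMSEQ_realpow_zero) auto
  qed (auto simp: z power_le_one)
  then show ?thesis by eventually_elim simp
qed

text \<open>Membership in \<open>H1\<close> yields some square integrable weak gradient, whereas
  \<open>weak_solution\<close> comes with its own, locally integrable representative. Uniqueness
  carries the square integrability over.\<close>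

lemma weak_gradient_unique:
  fixes u :: "'a::euclidean_space \<Rightarrow> real"
  assumes D: "has_weak_gradient u D" and E: "has_weak_gradient u E"
  shows "AE x in lebesgue. D x = E x"
proof -
  have L: "D \<in> L1_loc" "E \<in> L1_loc" using D E by (auto simp: has_weak_gradient_def)
  have "AE x in lebesgue. D x \<bullet> b - E x \<bullet> b = 0" if b: "b \<in> Basis" for b
  proof (rule AE_zero_of_conv_rho[OF L1_loc_diff[OF L1_loc_inner[OF L(1)] L1_loc_inner[OF L(2)]]])
    fix t :: real and x :: 'a assume t: "0 < t" "t \<le> 1"
    show "conv (\<lambda>x. D x \<bullet> b - E x \<bullet> b) (rho t) x = 0"
      unfolding conv_diff[OF L1_loc_inner[OF L(1)] L1_loc_inner[OF L(2)] kernel_rho[OF t(1)]]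
      using weak_gradient_rho[OF D t(1) b, of x] weak_gradient_rho[OF E t(1) b, of x] by simp
  qed
  then have "AE x in lebesgue. \<forall>b\<in>Basis. D x \<bullet> b - E x \<bullet> b = 0"
    by (intro AE_finite_allI) auto
  then show ?thesis by eventually_elim (auto intro: euclidean_eqI)
qed

lemma smooth_fun_bump: "smooth_fun (bump p t)"
  using smooth_fun.bump[of p t 0] by simp

text \<open>The gain is applied to \<open>u\<close> times a cutoff \<open>\<eta>\<close>. With
  \<open>J = moll 1 t\<close> centred at \<open>x\<close>, one has \<open>\<eta> \<Delta>J =
  \<Delta>(\<eta> J) - 2 \<nabla>\<eta> \<bullet> \<nabla>J - J \<Delta>\<eta>\<close>. The first
  term tests the equation with \<open>\<eta> J\<close> and yields \<open>t\<close> times an average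
  of \<open>g\<close>; the others contain \<open>u\<close> undifferentiated and at most one
  derivative of \<open>J\<close>, which yields an average of \<open>u\<close>.\<close>

lemma local_integrability_gain:
  fixes u g :: "'a::euclidean_space \<Rightarrow> real"
  assumes w: "has_weak_gradient u Du" and g: "g \<in> L1_loc"
    and eq: "\<And>v. v \<in> Cc_infinity \<Longrightarrow> (LINT x|lebesgue. Du x \<bullet> grad v x) = (LINT x|lebesgue. g x * v x)"
    and R: "R > 0"
    and gi: "integrable lebesgue (\<lambda>x. (indicator (cball 0 R) x * \<bar>g x\<bar>) powr p)"
    and ui: "integrable lebesgue (\<lambda>x. (indicator (cball 0 R) x * \<bar>u x\<bar>) powr r)"
    and exps: "1 \<le> p" "p \<le> s" "1 \<le> r" "r \<le> s"
    and e1: "2 * s + DIM('a) * (1 - s / p) > 0" and e2: "s + DIM('a) * (1 - s / r) > 0"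
  shows "integrable lebesgue (\<lambda>x. (indicator (cball 0 (R / 2)) x * \<bar>u x\<bar>) powr s)"
proof -
  have uL: "u \<in> L1_loc" and DL: "Du \<in> L1_loc" using w by (auto simp: has_weak_gradient_def)
  have [measurable]: "u \<in> borel_measurable lebesgue" "g \<in> borel_measurable lebesgue"
    using uL g by (auto simp: L1_loc_def)
  define \<eta> where "\<eta> = (bump 1 R :: 'a \<Rightarrow> real)"
  have \<eta>: "smooth_fun \<eta>" unfolding \<eta>_def by (rule smooth_fun_bump)
  have \<eta>0: "\<eta> y = 0" if "y \<notin> cball 0 R" for y
    unfolding \<eta>_def using that R by (intro bump_eq_0) auto
  \<comment> \<open>One continuous function dominating the cutoff and all its derivatives that
    occur, so that compactness provides a single constant \<open>K\<close>.\<close>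
  define F where "F y = \<bar>\<eta> y\<bar> + ((\<Sum>b\<in>Basis. \<bar>pd b \<eta> y\<bar>) + (\<Sum>b\<in>Basis. \<bar>pd b (pd b \<eta>) y\<bar>))" for y
  have F0: "F y = 0" if y: "norm y > R" for y
  proof -
    have y': "y \<notin> cball 0 R" using y by simp
    have p1: "pd b \<eta> z = 0" if "z \<notin> cball 0 R" for b z
      using \<eta>0 that by (rule pd_outside)
    have p2: "pd c (pd b \<eta>) y = 0" for b c
      using p1 y' by (rule pd_outside)
    show ?thesis unfolding F_def using \<eta>0[OF y'] p1[OF y'] p2 by simp
  qed
  have "kernel R F"
  proof (rule kernelI[OF _ F0])
    show "continuous_on UNIV F"
      unfolding F_def by (intro continuous_intros smooth_fun_continuous smooth_fun_pd \<eta>)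
  qed
  then obtain K where K: "K > 0" "\<And>y. \<bar>F y\<bar> \<le> K" using kernel_bounded by blast
  have F_nonneg: "F y \<ge> 0" for y unfolding F_def by (intro add_nonneg_nonneg sum_nonneg) auto
  have FK: "F y \<le> K * indicator (cball 0 R) y" for y
    using F0[of y] K(2)[of y] F_nonneg[of y] by (cases "norm y \<le> R") auto
  have Kb: "\<bar>\<eta> y\<bar> \<le> K * indicator (cball 0 R) y" "b \<in> Basis \<Longrightarrow> \<bar>pd b \<eta> y\<bar> \<le> K * indicator (cball 0 R) y"
    "b \<in> Basis \<Longrightarrow> \<bar>pd b (pd b \<eta>) y\<bar> \<le> K * indicator (cball 0 R) y" for b y
  proof -
    have s: "(\<Sum>b\<in>Basis. \<bar>pd b \<eta> y\<bar>) \<ge> 0" "(\<Sum>b\<in>Basis. \<bar>pd b (pd b \<eta>) y\<bar>) \<ge> 0"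
      by (auto intro!: sum_nonneg)
    show "\<bar>\<eta> y\<bar> \<le> K * indicator (cball 0 R) y" using FK[of y] s unfolding F_def by linarith
    { assume b: "b \<in> Basis"
      have "\<bar>pd b \<eta> y\<bar> \<le> (\<Sum>b\<in>Basis. \<bar>pd b \<eta> y\<bar>)" by (rule member_le_sum[OF b]) auto
      then show "\<bar>pd b \<eta> y\<bar> \<le> K * indicator (cball 0 R) y" using FK[of y] s unfolding F_def by linarith
      have "\<bar>pd b (pd b \<eta>) y\<bar> \<le> (\<Sum>b\<in>Basis. \<bar>pd b (pd b \<eta>) y\<bar>)" by (rule member_le_sum[OF b]) auto
      then show "\<bar>pd b (pd b \<eta>) y\<bar> \<le> K * indicator (cball 0 R) y" using FK[of y] s unfolding F_def by linarith }
  qed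
  obtain B0 where B0: "B0 > 0" "\<And>t z. t > 0 \<Longrightarrow> \<bar>moll 1 t (z::'a)\<bar> \<le> B0 / t ^ DIM('a)"
    using moll_bounded by blast
  obtain B1 where B1: "B1 > 0" "\<And>t z. t > 0 \<Longrightarrow> \<bar>rho t (z::'a)\<bar> \<le> B1 / t ^ DIM('a)"
    using moll_bounded unfolding rho_def by blast
  define M where "M x = indicator (cball 0 R) x * \<bar>g x\<bar>" for x
  define U where "U x = indicator (cball 0 R) x * \<bar>u x\<bar>" for x
  have M_loc: "M \<in> L1_loc" unfolding M_def
    using L1_loc_cball_integrable[OF L1_loc_norm[OF g], of 0 R] by (intro integrable_imp_L1_loc) simp
  have U_loc: "U \<in> L1_loc" unfolding U_def
    using L1_loc_cball_integrable[OF L1_loc_norm[OF uL], of 0 R] by (intro integrable_imp_L1_loc) simp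
  have MU: "M x \<ge> 0" "U x \<ge> 0" for x by (auto simp: M_def U_def)
  have wL: "(\<lambda>x. u x * \<eta> x) \<in> L1_loc" by (rule L1_loc_times_smooth[OF uL \<eta> \<eta>0])
  define C where "C = K + (K * B0 + DIM('a) * (4 * B1 * K + B0 * K))"
  have CK: "K * B0 \<le> C" "DIM('a) * (4 * B1 * K + B0 * K) \<le> C" "K \<le> C" "C > 0"
    unfolding C_def using K(1) B0(1) B1(1) by (auto intro!: add_pos_nonneg mult_nonneg_nonneg add_nonneg_nonneg)
  have main: "integrable lebesgue (\<lambda>x. \<bar>u x * \<eta> x\<bar> powr s)"
  proof (rule integrability_gain[OF wL, where M = M and U = U and p = p and r = r and C = C])
    show "\<bar>u x * \<eta> x\<bar> \<le> C * U x" for x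
    proof -
      have "\<bar>u x\<bar> * \<bar>\<eta> x\<bar> \<le> \<bar>u x\<bar> * (K * indicator (cball 0 R) x)" by (intro mult_left_mono Kb) simp
      also have "\<dots> = K * U x" by (simp add: U_def)
      also have "\<dots> \<le> C * U x" by (intro mult_right_mono CK MU)
      finally show ?thesis by (simp add: abs_mult)
    qed
    show "\<bar>conv (\<lambda>x. u x * \<eta> x) (rho_dt t) x\<bar> \<le> C * (t * avg t M x + avg t U x)" if t: "0 < t" "t \<le> 1" for t x
    proof -
      define J where "J y = moll 1 t (y - x)" for y
      have J: "smooth_fun J" unfolding J_def by (rule smooth_fun_moll)
      have J0: "J y = 0" if "y \<notin> cball x t" for y unfolding J_def by (rule moll_shift_outside[OF t(1) that])
      have \<eta>J: "smooth_fun (\<lambda>y. \<eta> y * J y)" by (intro smooth_fun.mult \<eta> J)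
      have \<eta>J0: "\<eta> y * J y = 0" if "y \<notin> cball x t" for y using J0[OF that] by simp
      \<comment> \<open>The Leibniz rule solved for the product with the second derivative of
        \<open>J\<close>; the subtracted commutator is \<open>G\<close> below.\<close>
      have prod: "\<eta> y * pd b (pd b J) y = pd b (pd b (\<lambda>y. \<eta> y * J y)) y - (2 * pd b J y * pd b \<eta> y + J y * pd b (pd b \<eta>) y)" for b y
        by (simp add: pd_mult[OF \<eta> J] pd_add[OF smooth_fun.mult[OF \<eta> smooth_fun_pd[OF J]] smooth_fun.mult[OF J smooth_fun_pd[OF \<eta>]]]
           pd_mult[OF \<eta> smooth_fun_pd[OF J]] pd_mult[OF J smooth_fun_pd[OF \<eta>]])
      define G where "G b y = 2 * pd b J y * pd b \<eta> y + J y * pd b (pd b \<eta>) y" for b y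
      have Gs: "smooth_fun (G b)" for b
        unfolding G_def by (intro smooth_fun.intros smooth_fun_pd J \<eta>)
      have G0: "G b y = 0" if "y \<notin> cball x t" for b y
        unfolding G_def using J0[OF that] pd_outside[OF J0 that] by simp
      have i1: "integrable lebesgue (\<lambda>y. u y * pd b (pd b (\<lambda>y. \<eta> y * J y)) y)" for b
        by (rule integrable_L1_loc_smooth[OF uL, of _ x t])
           (auto intro!: smooth_fun_pd \<eta>J pd_outside \<eta>J0)
      have i2: "integrable lebesgue (\<lambda>y. u y * G b y)" for b
        by (rule integrable_L1_loc_smooth[OF uL Gs G0])
      have i3: "integrable lebesgue (\<lambda>y. (Du y \<bullet> b) * pd b (\<lambda>y. \<eta> y * J y) y)" for b
        by (rule integrable_L1_loc_smooth[OF L1_loc_inner[OF DL], of _ x t])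
           (auto intro!: smooth_fun_pd \<eta>J pd_outside \<eta>J0)
      have "conv (\<lambda>x. u x * \<eta> x) (rho_dt t) x
         = (LINT y|lebesgue. t / 2 * ((\<Sum>b\<in>Basis. u y * pd b (pd b (\<lambda>y. \<eta> y * J y)) y) - (\<Sum>b\<in>Basis. u y * G b y)))"
        unfolding conv_def
      proof (intro Bochner_Integration.integral_cong refl)
        fix y
        have "u y * \<eta> y * rho_dt t (y - x) = t / 2 * (\<Sum>b\<in>Basis. u y * (\<eta> y * pd b (pd b J) y))"
          by (simp add: rho_dt_eq_laplacian[OF t(1)] sum_distrib_left mult_ac flip: J_def)
        also have "\<dots> = t / 2 * (\<Sum>b\<in>Basis. u y * pd b (pd b (\<lambda>y. \<eta> y * J y)) y - u y * G b y)"
          unfolding prod G_def by (simp add: right_diff_distrib)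
        finally show "u y * \<eta> y * rho_dt t (y - x) = t / 2 * ((\<Sum>b\<in>Basis. u y * pd b (pd b (\<lambda>y. \<eta> y * J y)) y) - (\<Sum>b\<in>Basis. u y * G b y))"
          by (simp add: sum_subtractf)
      qed
      also have "\<dots> = t / 2 * ((\<Sum>b\<in>Basis. LINT y|lebesgue. u y * pd b (pd b (\<lambda>y. \<eta> y * J y)) y) - (\<Sum>b\<in>Basis. LINT y|lebesgue. u y * G b y))"
        by (subst integral_mult_right_zero, subst Bochner_Integration.integral_diff)
           (auto simp: i1 i2 Bochner_Integration.integral_sum)
      also have "(\<Sum>b\<in>Basis. LINT y|lebesgue. u y * pd b (pd b (\<lambda>y. \<eta> y * J y)) y)
          = (\<Sum>b\<in>Basis. - (LINT y|lebesgue. (Du y \<bullet> b) * pd b (\<lambda>y. \<eta> y * J y) y))"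
        by (intro sum.cong refl weak_gradientD[OF w, of _ x t] smooth_fun_pd \<eta>J pd_outside \<eta>J0) auto
      also have "\<dots> = - (LINT y|lebesgue. (\<Sum>b\<in>Basis. (Du y \<bullet> b) * pd b (\<lambda>y. \<eta> y * J y) y))"
        by (subst Bochner_Integration.integral_sum) (auto simp: i3 sum_negf)
      also have "(LINT y|lebesgue. (\<Sum>b\<in>Basis. (Du y \<bullet> b) * pd b (\<lambda>y. \<eta> y * J y) y))
          = (LINT y|lebesgue. Du y \<bullet> grad (\<lambda>y. \<eta> y * J y) y)"
        by (simp add: pd_def flip: euclidean_inner)
      also have "\<dots> = (LINT y|lebesgue. g y * (\<eta> y * J y))"
        by (rule eq[OF smooth_fun_Cc_infinity[OF \<eta>J \<eta>J0]])
      finally have ceq: "conv (\<lambda>x. u x * \<eta> x) (rho_dt t) x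
         = t / 2 * (- (LINT y|lebesgue. g y * (\<eta> y * J y)) - (\<Sum>b\<in>Basis. LINT y|lebesgue. u y * G b y))" .
      have Jb: "\<bar>J y\<bar> \<le> B0 / t ^ DIM('a) * indicator (cball x t) y" for y
        using B0(2)[OF t(1), of "y - x"] J0[of y] by (cases "y \<in> cball x t") (auto simp: J_def)
      have pJb: "\<bar>pd b J y\<bar> \<le> 2 * B1 / t / t ^ DIM('a) * indicator (cball x t) y" if "b \<in> Basis" for b y
        unfolding J_def by (rule pd_moll_bound[OF B1(2) t(1) that])
      have gb: "\<bar>LINT y|lebesgue. g y * (\<eta> y * J y)\<bar> \<le> K * B0 * avg t M x"
      proof (rule abs_integral_le_avg[OF M_loc])
        fix y
        have "\<bar>g y\<bar> * (\<bar>\<eta> y\<bar> * \<bar>J y\<bar>) \<le> \<bar>g y\<bar> * ((K * indicator (cball 0 R) y) * (B0 / t ^ DIM('a) * indicator (cball x t) y))"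
          using K(1) by (intro mult_left_mono mult_mono Kb Jb) auto
        then show "\<bar>g y * (\<eta> y * J y)\<bar> \<le> K * B0 / t ^ DIM('a) * (M y * indicator (cball x t) y)"
          by (simp add: abs_mult M_def mult_ac)
      qed
      have ub: "\<bar>LINT y|lebesgue. u y * G b y\<bar> \<le> (4 * B1 * K / t + B0 * K) * avg t U x" if b: "b \<in> Basis" for b
      proof (rule abs_integral_le_avg[OF U_loc])
        fix y
        let ?i = "indicator (cball 0 R) y :: real" and ?j = "indicator (cball x t) y :: real"
        have "\<bar>G b y\<bar> \<le> 2 * (\<bar>pd b J y\<bar> * \<bar>pd b \<eta> y\<bar>) + \<bar>J y\<bar> * \<bar>pd b (pd b \<eta>) y\<bar>"
          unfolding G_def by (rule order_trans[OF abs_triangle_ineq]) (simp add: abs_mult)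
        also have "\<dots> \<le> 2 * ((2 * B1 / t / t ^ DIM('a) * ?j) * (K * ?i)) + (B0 / t ^ DIM('a) * ?j) * (K * ?i)"
          using K(1) B1(1) B0(1) t by (intro add_mono mult_left_mono mult_mono Kb(2)[OF b] Kb(3)[OF b] Jb pJb[OF b]) auto
        also have "\<dots> = (4 * B1 * K / t + B0 * K) / t ^ DIM('a) * (?i * ?j)"
          by (simp add: add_divide_distrib distrib_right distrib_left mult_ac)
        finally have "\<bar>u y\<bar> * \<bar>G b y\<bar> \<le> \<bar>u y\<bar> * ((4 * B1 * K / t + B0 * K) / t ^ DIM('a) * (?i * ?j))"
          by (intro mult_left_mono) auto
        then show "\<bar>u y * G b y\<bar> \<le> (4 * B1 * K / t + B0 * K) / t ^ DIM('a) * (U y * ?j)"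
          by (simp add: abs_mult U_def mult_ac)
      qed
      have aM: "avg t M x \<ge> 0" and aU: "avg t U x \<ge> 0" using avg_nonneg[OF _ t(1)] MU by auto
      have "\<bar>conv (\<lambda>x. u x * \<eta> x) (rho_dt t) x\<bar>
          \<le> t / 2 * (\<bar>LINT y|lebesgue. g y * (\<eta> y * J y)\<bar> + (\<Sum>b\<in>Basis. \<bar>LINT y|lebesgue. u y * G b y\<bar>))"
      proof -
        have "\<bar>\<Sum>b\<in>Basis. LINT y|lebesgue. u y * G b y\<bar> \<le> (\<Sum>b\<in>Basis. \<bar>LINT y|lebesgue. u y * G b y\<bar>)"
          by (rule sum_abs)
        then have "\<bar>- (LINT y|lebesgue. g y * (\<eta> y * J y)) - (\<Sum>b\<in>Basis. LINT y|lebesgue. u y * G b y)\<bar>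
            \<le> \<bar>LINT y|lebesgue. g y * (\<eta> y * J y)\<bar> + (\<Sum>b\<in>Basis. \<bar>LINT y|lebesgue. u y * G b y\<bar>)"
          by linarith
        from mult_left_mono[OF this, of "t / 2"] show ?thesis unfolding ceq abs_mult using t by simp
      qed
      also have "\<dots> \<le> t / 2 * (K * B0 * avg t M x + (\<Sum>b\<in>(Basis::'a set). (4 * B1 * K / t + B0 * K) * avg t U x))"
        using t by (intro mult_left_mono add_mono gb sum_mono ub) auto
      \<comment> \<open>The prefactor \<open>t / 2\<close> cancels the \<open>1 / t\<close> of the
        first derivative of \<open>J\<close>; the zeroth order term keeps a factor \<open>t\<close>,
        which is at most \<open>1\<close>.\<close>
      also have "\<dots> = K * B0 * (t / 2 * avg t M x) + DIM('a) * (4 * B1 * K + t * (B0 * K)) / 2 * avg t U x"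
        using t by (simp add: field_simps)
      also have "\<dots> \<le> C * (t * avg t M x) + C * avg t U x"
      proof (intro add_mono mult_mono)
        have "DIM('a) * (4 * B1 * K + t * (B0 * K)) / 2 \<le> DIM('a) * (4 * B1 * K + 1 * (B0 * K)) / 2"
          using t K(1) B0(1) by (intro divide_right_mono mult_left_mono add_left_mono mult_right_mono) auto
        also have "\<dots> \<le> DIM('a) * (4 * B1 * K + B0 * K)"
          using K(1) B0(1) B1(1) by (simp add: mult_nonneg_nonneg add_nonneg_nonneg)
        also have "\<dots> \<le> C" by (rule CK)
        finally show "DIM('a) * (4 * B1 * K + t * (B0 * K)) / 2 \<le> C" .
      qed (use CK aM aU t in auto)
      finally show ?thesis by (simp add: algebra_simps)
    qed
  qed (use exps e1 e2 CK MU gi ui M_loc U_loc in \<open>auto simp: L1_loc_def M_def U_def\<close>)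
  show ?thesis
  proof (rule Bochner_Integration.integrable_bound)
    \<comment> \<open>On the half ball \<open>1 - (x \<bullet> x) / R\<^sup>2\<close> is at least
      \<open>3 / 4\<close>, so the cutoff is at least \<open>exp (- (4 / 3))\<close>.\<close>
    show "integrable lebesgue (\<lambda>x. exp (4 / 3) powr s * (\<bar>u x * \<eta> x\<bar> powr s))"
      by (intro integrable_mult_right main)
    show "(\<lambda>x. (indicator (cball 0 (R / 2)) x * \<bar>u x\<bar>) powr s) \<in> borel_measurable lebesgue"
      by measurable
    show "AE x in lebesgue. norm ((indicator (cball 0 (R / 2)) x * \<bar>u x\<bar>) powr s)
        \<le> norm (exp (4 / 3) powr s * (\<bar>u x * \<eta> x\<bar> powr s))"
    proof (rule AE_I2)
      fix x :: 'a
      have "indicator (cball 0 (R / 2)) x * \<bar>u x\<bar> \<le> exp (4 / 3) * \<bar>u x * \<eta> x\<bar>"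
      proof (cases "norm x \<le> R / 2")
        case True
        then have "(norm x)\<^sup>2 \<le> (R / 2)\<^sup>2" by (intro power_mono) auto
        then have *: "1 - (x \<bullet> x) / R\<^sup>2 \<ge> 3 / 4"
          using R by (simp add: power2_norm_eq_inner field_simps)
        then have pos: "1 - (x \<bullet> x) / R\<^sup>2 > 0" by linarith
        have "1 / (1 - (x \<bullet> x) / R\<^sup>2) \<le> 1 / (3 / 4)" using * by (intro divide_left_mono) auto
        then have "\<eta> x \<ge> exp (- (4 / 3))"
          unfolding \<eta>_def bump_def using pos by (simp add: flat_pos)
        then have "exp (4 / 3) * \<eta> x \<ge> exp (4 / 3) * exp (- (4 / 3))" by (intro mult_left_mono) auto
        then have "exp (4 / 3) * \<eta> x \<ge> 1" by (simp add: exp_minus)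
        from mult_right_mono[OF this, of "\<bar>u x\<bar>"] have "\<bar>u x\<bar> \<le> exp (4 / 3) * (\<bar>u x\<bar> * \<eta> x)" by (simp add: mult_ac)
        also have "\<dots> \<le> exp (4 / 3) * \<bar>u x * \<eta> x\<bar>" by (intro mult_left_mono) (auto simp: abs_mult intro!: mult_left_mono)
        finally show ?thesis using True by simp
      qed simp
      then have "(indicator (cball 0 (R / 2)) x * \<bar>u x\<bar>) powr s \<le> (exp (4 / 3) * \<bar>u x * \<eta> x\<bar>) powr s"
        using exps by (intro powr_mono2) auto
      then show "norm ((indicator (cball 0 (R / 2)) x * \<bar>u x\<bar>) powr s)
        \<le> norm (exp (4 / 3) powr s * (\<bar>u x * \<eta> x\<bar> powr s))"
        by (simp add: powr_mult)
    qed
  qed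
qed

subsection \<open>Bootstrapping and the classical identity\<close>

lemma powr_sum2_le:
  fixes a b s :: real
  assumes "a \<ge> 0" "b \<ge> 0" "s \<ge> 0"
  shows "(a + b) powr s \<le> 2 powr s * (a powr s + b powr s)"
proof -
  let ?m = "max a b"
  have "(a + b) powr s \<le> (2 * ?m) powr s" using assms by (intro powr_mono2) auto
  also have "\<dots> = 2 powr s * ?m powr s" by (rule powr_mult)
  also have "?m powr s \<le> a powr s + b powr s" by (auto simp: max_def)
  finally show ?thesis by simp
qed

text \<open>With \<open>\<delta> = 2/N - (q - 2)/q\<close>, which is positive exactly for subcritical \<open>q\<close>, each application of the
  local gain lowers \<open>1/r\<close> by \<open>\<delta>/2\<close>.\<close>

lemma bootstrap:
  fixes u g :: "'a::euclidean_space \<Rightarrow> real"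
  assumes w: "has_weak_gradient u Du" and g: "g \<in> L1_loc"
    and eq: "\<And>v. v \<in> Cc_infinity \<Longrightarrow> (LINT x|lebesgue. Du x \<bullet> grad v x) = (LINT x|lebesgue. g x * v x)"
    and q: "2 < q" and \<delta>: "(q - 2) / q < 2 / DIM('a)"
    and uq: "integrable lebesgue (\<lambda>x. \<bar>u x\<bar> powr q)"
    and growth: "\<And>R. \<exists>K\<ge>0. AE x in lebesgue. x \<in> cball 0 R \<longrightarrow> \<bar>g x\<bar> \<le> K * (1 + \<bar>u x\<bar> powr (q - 1))"
    and R: "R > 0"
  shows "integrable lebesgue (\<lambda>x. (indicator (cball 0 R) x * \<bar>u x\<bar>) powr (2 * (q - 1)))"
proof -
  have [measurable]: "u \<in> borel_measurable lebesgue" "g \<in> borel_measurable lebesgue"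
    using w g by (auto simp: has_weak_gradient_def L1_loc_def)
  define N where "N = real DIM('a)"
  have N: "N > 0" by (simp add: N_def)
  define \<delta> where "\<delta> = 2 / N - (q - 2) / q"
  have \<delta>: "\<delta> > 0" "\<delta> < 2 / N" using \<delta> q by (auto simp: \<delta>_def N_def)
  \<comment> \<open>The induction runs over reciprocals, where the gain is additive, and over all
    radii at once, because each application of the local gain halves the ball.\<close>
  have "\<forall>r. q \<le> r \<longrightarrow> 1 / r \<ge> 1 / q - real n * (\<delta> / 2) \<longrightarrow>
      (\<forall>R>0. integrable lebesgue (\<lambda>x. (indicator (cball 0 R) x * \<bar>u x\<bar>) powr r))" for n
  proof (induction n)
    case 0
    show ?case
    proof (intro allI impI)
      fix r R :: real assume "q \<le> r" "1 / r \<ge> 1 / q - real 0 * (\<delta> / 2)" "R > 0"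
      then have "r = q" using q by (auto simp: field_simps)
      show "integrable lebesgue (\<lambda>x. (indicator (cball 0 R) x * \<bar>u x\<bar>) powr r)"
        unfolding \<open>r = q\<close>
      proof (rule Bochner_Integration.integrable_bound[OF uq])
        show "(\<lambda>x. (indicator (cball 0 R) x * \<bar>u x\<bar>) powr q) \<in> borel_measurable lebesgue" by measurable
      qed (auto simp: indicator_def)
    qed
  next
    case (Suc n)
    show ?case
    proof (intro allI impI)
      fix r R :: real assume r: "q \<le> r" "1 / r \<ge> 1 / q - real (Suc n) * (\<delta> / 2)" and R: "R > 0"
      \<comment> \<open>The reciprocal of the exponent \<open>r0\<close> to start from:
        \<open>\<delta> / 2\<close> above the target \<open>1 / r\<close>, but capped at
        \<open>1 / q\<close> so that \<open>r0\<close> is at least \<open>q\<close>.\<close>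
      define i where "i = min (1 / q) (1 / r + \<delta> / 2)"
      define r0 where "r0 = 1 / i"
      have rpos: "r > 0" using r q by simp
      have pos: "1 / r > 0" "1 / q > 0" "1 / r \<le> 1 / q" "real n * (\<delta> / 2) \<ge> 0"
        using rpos q r \<delta>(1) by (auto simp: frac_le)
      have r2: "1 / r \<ge> 1 / q - real n * (\<delta> / 2) - \<delta> / 2" using r(2) by (simp add: algebra_simps add_divide_distrib)
      have "i = 1 / q \<or> i = 1 / r + \<delta> / 2" unfolding i_def by linarith
      moreover have "i \<le> 1 / q" "i \<le> 1 / r + \<delta> / 2" unfolding i_def by linarith+
      ultimately have i: "i > 0" "i \<le> 1 / q" "i \<le> 1 / r + \<delta> / 2" "i \<ge> 1 / q - real n * (\<delta> / 2)" "i \<ge> 1 / r"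
        using pos r2 \<delta>(1) by (elim disjE; linarith)+
      have ir0: "1 / r0 = i" by (simp add: r0_def)
      have r0: "q \<le> r0" "r0 \<le> r"
        using i q rpos by (auto simp: r0_def field_simps)
      have r0pos: "r0 > 0" using r0 q by simp
      have P0: "integrable lebesgue (\<lambda>x. (indicator (cball 0 (2 * R)) x * \<bar>u x\<bar>) powr r0)"
        using Suc.IH i(4) r0(1) R unfolding ir0[symmetric] by auto
      \<comment> \<open>Locally \<open>g\<close> grows at most like
        \<open>1 + \<bar>u\<bar> powr (q - 1)\<close>, so this is the exponent at which
        integrability of \<open>\<bar>u\<bar> powr r0\<close> passes to \<open>g\<close>.\<close>
      define p where "p = r0 / (q - 1)"
      have p: "1 \<le> p" "p \<le> r0" using r0 q by (auto simp: p_def field_simps)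
      have gi: "integrable lebesgue (\<lambda>x. (indicator (cball 0 (2 * R)) x * \<bar>g x\<bar>) powr p)"
      proof -
        obtain K where K: "K \<ge> 0" "AE x in lebesgue. x \<in> cball 0 (2 * R) \<longrightarrow> \<bar>g x\<bar> \<le> K * (1 + \<bar>u x\<bar> powr (q - 1))"
          using growth by blast
        show ?thesis
        proof (rule Bochner_Integration.integrable_bound)
          have "integrable lebesgue (indicator (cball (0::'a) (2 * R)) :: 'a \<Rightarrow> real)"
            by (rule integrable_indicator_cball)
          then show "integrable lebesgue (\<lambda>x. K powr p * 2 powr p * (indicator (cball 0 (2 * R)) x + (indicator (cball 0 (2 * R)) x * \<bar>u x\<bar>) powr r0))"
            using P0 by (intro integrable_mult_right Bochner_Integration.integrable_add)
          show "AE x in lebesgue. norm ((indicator (cball 0 (2 * R)) x * \<bar>g x\<bar>) powr p) \<le>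
             norm (K powr p * 2 powr p * (indicator (cball 0 (2 * R)) x + (indicator (cball 0 (2 * R)) x * \<bar>u x\<bar>) powr r0))"
            using K(2)
          proof eventually_elim
            case (elim x)
            show ?case
            proof (cases "x \<in> cball 0 (2 * R)")
              case True
              with elim have "\<bar>g x\<bar> \<le> K * (1 + \<bar>u x\<bar> powr (q - 1))" by simp
              then have "\<bar>g x\<bar> powr p \<le> (K * (1 + \<bar>u x\<bar> powr (q - 1))) powr p"
                using p by (intro powr_mono2) auto
              also have "\<dots> = K powr p * (1 + \<bar>u x\<bar> powr (q - 1)) powr p" by (rule powr_mult)
              also have "\<dots> \<le> K powr p * (2 powr p * (1 powr p + (\<bar>u x\<bar> powr (q - 1)) powr p))"
                using p by (intro mult_left_mono powr_sum2_le) auto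
              also have "(\<bar>u x\<bar> powr (q - 1)) powr p = \<bar>u x\<bar> powr r0"
                using q by (simp add: powr_powr p_def)
              finally show ?thesis using True by (simp add: mult.assoc)
            qed simp
          qed
        qed measurable
      qed
      have e2: "r + DIM('a) * (1 - r / r0) > 0"
      proof -
        have "1 / r0 - 1 / r \<le> \<delta> / 2" unfolding ir0 using i by simp
        also have "\<dots> < 1 / N" using \<delta> by simp
        finally have "N * (1 / r0 - 1 / r) < 1" using N by (simp add: field_simps)
        then have "r * (N * (1 / r0 - 1 / r)) < r * 1" using rpos by (intro mult_strict_left_mono)
        moreover have "r * (N * (1 / r0 - 1 / r)) = N * (r / r0 - 1)" using rpos by (simp add: algebra_simps)
        ultimately show ?thesis by (simp add: N_def algebra_simps)
      qed
      \<comment> \<open>Splitting \<open>(q - 1) / r0 - 1 / r\<close> into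
        \<open>(q - 2) / r0\<close> and \<open>1 / r0 - 1 / r\<close> bounds it by
        \<open>(q - 2) / q + \<delta> / 2\<close>, which is below \<open>2 / N\<close> by the
        definition of \<open>\<delta>\<close>.\<close>
      have e1: "2 * r + DIM('a) * (1 - r / p) > 0"
      proof -
        have "(q - 2) * (1 / r0) \<le> (q - 2) * (1 / q)"
          unfolding ir0 using i q by (intro mult_left_mono) auto
        moreover have "1 / r0 - 1 / r \<le> \<delta> / 2" unfolding ir0 using i by simp
        ultimately have "(q - 1) / r0 - 1 / r \<le> (q - 2) / q + \<delta> / 2"
          by (simp add: diff_divide_distrib)
        also have "\<dots> < (q - 2) / q + \<delta>" using \<delta> by simp
        also have "\<dots> = 2 / N" by (simp add: \<delta>_def)
        finally have "N * ((q - 1) / r0 - 1 / r) < 2" using N by (simp add: field_simps)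
        then have "r * (N * ((q - 1) / r0 - 1 / r)) < r * 2" using rpos by (intro mult_strict_left_mono)
        moreover have "r * (N * ((q - 1) / r0 - 1 / r)) = N * (r / p - 1)"
          using rpos by (simp add: algebra_simps p_def)
        ultimately show ?thesis by (simp add: N_def algebra_simps)
      qed
      have "integrable lebesgue (\<lambda>x. (indicator (cball 0 (2 * R / 2)) x * \<bar>u x\<bar>) powr r)"
        using p r0 q R by (intro local_integrability_gain[OF w g eq _ gi P0 _ _ _ _ e1 e2]) auto
      then show "integrable lebesgue (\<lambda>x. (indicator (cball 0 R) x * \<bar>u x\<bar>) powr r)" by simp
    qed
  qed
  moreover have "q \<le> 2 * (q - 1)" using q by simp
  moreover have "\<exists>n. 1 / (2 * (q - 1)) \<ge> 1 / q - real n * (\<delta> / 2)"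
  proof -
    obtain n where "(1 / q) / (\<delta> / 2) \<le> real n" using real_arch_simple by blast
    then have "1 / q \<le> real n * (\<delta> / 2)" using \<delta>(1) by (subst (asm) pos_divide_le_eq) auto
    moreover have "1 / (2 * (q - 1)) \<ge> 0" using q by simp
    ultimately show ?thesis by (intro exI[of _ n]) linarith
  qed
  ultimately show ?thesis using R by blast
qed

section \<open>Products of square integrable functions, and the identity for smooth fields\<close>

lemma cauchy_schwarz_integral:
  fixes a b :: "'a \<Rightarrow> real"
  assumes [measurable]: "a \<in> borel_measurable M" "b \<in> borel_measurable M"
    and i: "integrable M (\<lambda>x. (a x)\<^sup>2)" "integrable M (\<lambda>x. (b x)\<^sup>2)"
  shows "integrable M (\<lambda>x. a x * b x)"
    and "(LINT x|M. \<bar>a x * b x\<bar>) \<le> sqrt (LINT x|M. (a x)\<^sup>2) * sqrt (LINT x|M. (b x)\<^sup>2)"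
proof -
  show ab: "integrable M (\<lambda>x. a x * b x)"
  proof (rule Bochner_Integration.integrable_bound)
    show "integrable M (\<lambda>x. (a x)\<^sup>2 + (b x)\<^sup>2)" using i by auto
    have "\<bar>s * t\<bar> \<le> s\<^sup>2 + t\<^sup>2" for s t :: real
      using zero_le_power2[of "\<bar>s\<bar> - \<bar>t\<bar>"] zero_le_power2[of s] zero_le_power2[of t]
      unfolding power2_diff abs_mult power2_abs by linarith
    then show "AE x in M. norm (a x * b x) \<le> norm ((a x)\<^sup>2 + (b x)\<^sup>2)"
      by (intro AE_I2) auto
  qed measurable
  have "(\<integral>\<^sup>+x. ennreal \<bar>a x\<bar> * ennreal \<bar>b x\<bar> \<partial>M)\<^sup>2 \<le> (\<integral>\<^sup>+x. ennreal \<bar>a x\<bar> ^ 2 \<partial>M) * (\<integral>\<^sup>+x. ennreal \<bar>b x\<bar> ^ 2 \<partial>M)"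
    by (intro Cauchy_Schwarz_nn_integral) measurable
  also have "(\<integral>\<^sup>+x. ennreal \<bar>a x\<bar> * ennreal \<bar>b x\<bar> \<partial>M) = ennreal (LINT x|M. \<bar>a x * b x\<bar>)"
    using integrable_abs[OF ab] by (subst nn_integral_eq_integral[symmetric]) (auto simp: abs_mult ennreal_mult)
  also have "(\<integral>\<^sup>+x. ennreal \<bar>a x\<bar> ^ 2 \<partial>M) = ennreal (LINT x|M. (a x)\<^sup>2)"
    using i(1) by (subst nn_integral_eq_integral[symmetric]) (auto simp: ennreal_power)
  also have "(\<integral>\<^sup>+x. ennreal \<bar>b x\<bar> ^ 2 \<partial>M) = ennreal (LINT x|M. (b x)\<^sup>2)"
    using i(2) by (subst nn_integral_eq_integral[symmetric]) (auto simp: ennreal_power)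
  finally have "(LINT x|M. \<bar>a x * b x\<bar>)\<^sup>2 \<le> (LINT x|M. (a x)\<^sup>2) * (LINT x|M. (b x)\<^sup>2)"
    by (simp add: ennreal_power flip: ennreal_mult)
  then have "(LINT x|M. \<bar>a x * b x\<bar>) \<le> sqrt ((LINT x|M. (a x)\<^sup>2) * (LINT x|M. (b x)\<^sup>2))"
    by (rule real_le_rsqrt)
  then show "(LINT x|M. \<bar>a x * b x\<bar>) \<le> sqrt (LINT x|M. (a x)\<^sup>2) * sqrt (LINT x|M. (b x)\<^sup>2)"
    by (simp add: real_sqrt_mult)
qed

lemma integrable_bounded_times:
  fixes \<beta> h :: "'a \<Rightarrow> real"
  assumes h: "integrable M h" and \<beta>: "\<beta> \<in> borel_measurable M" "\<And>x. \<bar>\<beta> x\<bar> \<le> B"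
  shows "integrable M (\<lambda>x. \<beta> x * h x)"
proof (rule Bochner_Integration.integrable_bound)
  show "integrable M (\<lambda>x. B * h x)" using h by simp
  have "B \<ge> 0" using \<beta>(2)[of undefined] by linarith
  then show "AE x in M. norm (\<beta> x * h x) \<le> norm (B * h x)"
    using \<beta>(2) by (intro AE_I2) (auto simp: abs_mult intro!: mult_right_mono)
  show "(\<lambda>x. \<beta> x * h x) \<in> borel_measurable M" using h \<beta> by measurable
qed

text \<open>Expand \<open>F G - f g = (F - f) (G - g) + (F - f) g + f (G - g)\<close> and apply
  Cauchy-Schwarz to each product.\<close>

lemma tendsto_integral_L2_product:
  fixes f g \<beta> :: "'a \<Rightarrow> real" and F G :: "nat \<Rightarrow> 'a \<Rightarrow> real"
  assumes f: "f \<in> borel_measurable M" "integrable M (\<lambda>x. (f x)\<^sup>2)"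
    and g: "g \<in> borel_measurable M" "integrable M (\<lambda>x. (g x)\<^sup>2)"
    and F: "\<And>n. F n \<in> borel_measurable M" "\<And>n. integrable M (\<lambda>x. (F n x)\<^sup>2)"
    and G: "\<And>n. G n \<in> borel_measurable M" "\<And>n. integrable M (\<lambda>x. (G n x)\<^sup>2)"
    and Ff: "(\<lambda>n. LINT x|M. (F n x - f x)\<^sup>2) \<longlonglongrightarrow> 0"
    and Gg: "(\<lambda>n. LINT x|M. (G n x - g x)\<^sup>2) \<longlonglongrightarrow> 0"
    and \<beta>: "\<beta> \<in> borel_measurable M" "\<And>x. \<bar>\<beta> x\<bar> \<le> B"
  shows "(\<lambda>n. LINT x|M. \<beta> x * (F n x * G n x)) \<longlonglongrightarrow> (LINT x|M. \<beta> x * (f x * g x))"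
proof -
  have B: "B \<ge> 0" using \<beta>(2)[of undefined] by linarith
  note dF = square_integrable_diff[OF F(1) f(1) F(2) f(2)]
  note dG = square_integrable_diff[OF G(1) g(1) G(2) g(2)]
  have m: "(\<lambda>x. F n x - f x) \<in> borel_measurable M" "(\<lambda>x. G n x - g x) \<in> borel_measurable M" for n
    using F(1)[of n] f(1) G(1)[of n] g(1) by auto
  let ?n = "\<lambda>h. sqrt (LINT x|M. (h x)\<^sup>2)"
  let ?E = "\<lambda>n. B * (?n (\<lambda>x. F n x - f x) * ?n (\<lambda>x. G n x - g x) + (?n (\<lambda>x. F n x - f x) * ?n g + ?n f * ?n (\<lambda>x. G n x - g x)))"
  have le: "\<bar>(LINT x|M. \<beta> x * (F n x * G n x)) - (LINT x|M. \<beta> x * (f x * g x))\<bar> \<le> ?E n" for n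
  proof -
    let ?a = "\<lambda>x. F n x - f x" and ?b = "\<lambda>x. G n x - g x"
    note cs1 = cauchy_schwarz_integral[OF m(1)[of n] m(2)[of n] dF dG]
    note cs2 = cauchy_schwarz_integral[OF m(1)[of n] g(1) dF g(2)]
    note cs3 = cauchy_schwarz_integral[OF f(1) m(2)[of n] f(2) dG]
    have i1: "integrable M (\<lambda>x. \<beta> x * (F n x * G n x))" "integrable M (\<lambda>x. \<beta> x * (f x * g x))"
      by (intro integrable_bounded_times[OF _ \<beta>] cauchy_schwarz_integral(1) F G f g)+
    have "(LINT x|M. \<beta> x * (F n x * G n x)) - (LINT x|M. \<beta> x * (f x * g x))
        = (LINT x|M. \<beta> x * (F n x * G n x) - \<beta> x * (f x * g x))" using i1 by simp
    then have "\<bar>(LINT x|M. \<beta> x * (F n x * G n x)) - (LINT x|M. \<beta> x * (f x * g x))\<bar>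
        \<le> (LINT x|M. \<bar>\<beta> x * (F n x * G n x) - \<beta> x * (f x * g x)\<bar>)"
      by (simp only: integral_abs_bound)
    also have "\<dots> \<le> (LINT x|M. B * (\<bar>?a x * ?b x\<bar> + (\<bar>?a x * g x\<bar> + \<bar>f x * ?b x\<bar>)))"
    proof (intro integral_mono)
      fix x
      have "\<beta> x * (F n x * G n x) - \<beta> x * (f x * g x) = \<beta> x * (?a x * ?b x + (?a x * g x + f x * ?b x))"
        by (simp add: algebra_simps)
      then have "\<bar>\<beta> x * (F n x * G n x) - \<beta> x * (f x * g x)\<bar> = \<bar>\<beta> x\<bar> * \<bar>?a x * ?b x + (?a x * g x + f x * ?b x)\<bar>"
        by (simp only: abs_mult)
      also have "\<dots> \<le> B * (\<bar>?a x * ?b x\<bar> + (\<bar>?a x * g x\<bar> + \<bar>f x * ?b x\<bar>))"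
        by (intro mult_mono \<beta> B) linarith+
      finally show "\<bar>\<beta> x * (F n x * G n x) - \<beta> x * (f x * g x)\<bar> \<le> B * (\<bar>?a x * ?b x\<bar> + (\<bar>?a x * g x\<bar> + \<bar>f x * ?b x\<bar>))" .
    qed (use i1 cs1(1) cs2(1) cs3(1) in auto)
    also have "\<dots> = B * ((LINT x|M. \<bar>?a x * ?b x\<bar>) + ((LINT x|M. \<bar>?a x * g x\<bar>) + (LINT x|M. \<bar>f x * ?b x\<bar>)))"
      using cs1(1) cs2(1) cs3(1) by simp
    also have "\<dots> \<le> ?E n"
      by (intro mult_left_mono add_mono cs1(2) cs2(2) cs3(2) B)
    finally show ?thesis .
  qed
  have "?E \<longlonglongrightarrow> B * (sqrt 0 * sqrt 0 + (sqrt 0 * ?n g + ?n f * sqrt 0))"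
    by (intro tendsto_intros Ff Gg)
  then have "?E \<longlonglongrightarrow> 0" by simp
  then have "(\<lambda>n. (LINT x|M. \<beta> x * (F n x * G n x)) - (LINT x|M. \<beta> x * (f x * g x))) \<longlonglongrightarrow> 0"
    by (rule Lim_null_comparison[rotated]) (use le in auto)
  then show ?thesis by (rule LIM_zero_cancel)
qed

lemma smooth_fun_has_directional_derivative:
  assumes "smooth_fun \<phi>"
  shows "((\<lambda>s. \<phi> (x + s *\<^sub>R b)) has_real_derivative pd b \<phi> (x + s *\<^sub>R b)) (at s)"
proof -
  have "((\<lambda>s. x + s *\<^sub>R b) has_derivative (\<lambda>h. h *\<^sub>R b)) (at s)"
    by (auto intro!: derivative_eq_intros)
  moreover have "(\<phi> has_derivative (\<lambda>h. h \<bullet> grad \<phi> (x + s *\<^sub>R b))) (at (x + s *\<^sub>R b))"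
    using smooth_fun_GDERIV[OF assms] by (simp add: gderiv_def)
  ultimately have "((\<lambda>s. \<phi> (x + s *\<^sub>R b)) has_derivative (\<lambda>h. (h *\<^sub>R b) \<bullet> grad \<phi> (x + s *\<^sub>R b))) (at s)"
    by (rule has_derivative_compose)
  then show ?thesis
    by (rule has_derivative_imp_has_field_derivative) (simp add: pd_def inner_commute mult.commute)
qed

text \<open>The divergence of \<open>\<phi> (x \<bullet> w) w - \<phi> |w|\<^sup>2 x / 2\<close> integrates to zero; symmetry of \<open>dw\<close> cancels
  the terms in which \<open>w\<close> is differentiated, except for its divergence.\<close>

lemma pohozaev_classical:
  fixes w :: "'a::euclidean_space \<Rightarrow> 'a \<Rightarrow> real" and dw :: "'a \<Rightarrow> 'a \<Rightarrow> 'a \<Rightarrow> real"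
  assumes cw: "\<And>b. b \<in> Basis \<Longrightarrow> continuous_on UNIV (w b)"
    and cdw: "\<And>a b. a \<in> Basis \<Longrightarrow> b \<in> Basis \<Longrightarrow> continuous_on UNIV (dw a b)"
    and der: "\<And>a b x. a \<in> Basis \<Longrightarrow> b \<in> Basis \<Longrightarrow>
        ((\<lambda>s. w b (x + s *\<^sub>R a)) has_real_derivative dw a b x) (at 0)"
    and sym: "\<And>a b x. a \<in> Basis \<Longrightarrow> b \<in> Basis \<Longrightarrow> dw a b x = dw b a x"
    and \<phi>: "smooth_fun \<phi>" and \<phi>0: "\<And>x. x \<notin> cball 0 R \<Longrightarrow> \<phi> x = 0"
  defines "S \<equiv> \<lambda>x. \<Sum>a\<in>Basis. w a x * w a x"
    and "P \<equiv> \<lambda>x. \<Sum>a\<in>Basis. (x \<bullet> a) * w a x"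
  shows "(LINT x|lebesgue. ((DIM('a) / 2 - 1) * \<phi> x + (\<Sum>b\<in>Basis. (x \<bullet> b) * pd b \<phi> x) / 2) * S x
            - P x * (\<Sum>b\<in>Basis. pd b \<phi> x * w b x))
       = (LINT x|lebesgue. \<phi> x * P x * (\<Sum>b\<in>Basis. dw b b x))"
proof -
  define F where "F b x = \<phi> x * P x * w b x - \<phi> x * S x * (x \<bullet> b) / 2" for b x
  define F' where "F' b x = pd b \<phi> x * P x * w b x
      + \<phi> x * (w b x + (\<Sum>a\<in>Basis. (x \<bullet> a) * dw b a x)) * w b x + \<phi> x * P x * dw b b x
      - (pd b \<phi> x * S x * (x \<bullet> b) + \<phi> x * (2 * (\<Sum>a\<in>Basis. w a x * dw b a x)) * (x \<bullet> b) + \<phi> x * S x) / 2" for b x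
  have c\<phi>: "continuous_on UNIV \<phi>" "continuous_on UNIV (pd b \<phi>)" for b
    by (intro smooth_fun_continuous smooth_fun_pd \<phi>)+
  have cS: "continuous_on UNIV S" unfolding S_def by (intro continuous_intros cw)
  have cP: "continuous_on UNIV P" unfolding P_def by (intro continuous_intros cw)
  have z: "\<phi> x = 0" "pd b \<phi> x = 0" if "norm x > R" for b x
    using that \<phi>0[of x] pd_outside[of 0 R \<phi> x b] \<phi>0 by auto
  have kF: "kernel R (F b)" if b: "b \<in> Basis" for b
    using z unfolding F_def by (intro kernelI continuous_intros c\<phi> cS cP cw b) auto
  have kF': "kernel R (F' b)" if b: "b \<in> Basis" for b
    using z unfolding F'_def by (intro kernelI continuous_intros c\<phi> cS cP cw cdw b) auto
  have "(LINT x|lebesgue. F' b x) = 0" if b: "b \<in> Basis" for b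
  proof (rule integral_directional_derivative_eq_0[OF kF[OF b] kF'[OF b]])
    fix x
    note d = der[OF b]
    have dx: "((\<lambda>s. (x + s *\<^sub>R b) \<bullet> a) has_real_derivative b \<bullet> a) (at 0)" for a
      by (auto intro!: derivative_eq_intros simp: inner_add_left)
    have d\<phi>: "((\<lambda>s. \<phi> (x + s *\<^sub>R b)) has_real_derivative pd b \<phi> x) (at 0)"
      using smooth_fun_has_directional_derivative[OF \<phi>, of x b 0] by simp
    have dP: "((\<lambda>s. P (x + s *\<^sub>R b)) has_real_derivative w b x + (\<Sum>a\<in>Basis. (x \<bullet> a) * dw b a x)) (at 0)"
    proof -
      have "((\<lambda>s. P (x + s *\<^sub>R b)) has_real_derivative (\<Sum>a\<in>Basis. (b \<bullet> a) * w a (x + 0 *\<^sub>R b) + dw b a x * ((x + 0 *\<^sub>R b) \<bullet> a))) (at 0)"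
        unfolding P_def by (intro DERIV_sum DERIV_mult dx d)
      moreover have "(\<Sum>a\<in>Basis. (b \<bullet> a) * w a x) = w b x"
        using b by (simp add: inner_Basis if_distrib[of "\<lambda>c. c * _"] sum.delta cong: if_cong)
      ultimately show ?thesis by (simp add: sum.distrib mult.commute)
    qed
    have dS: "((\<lambda>s. S (x + s *\<^sub>R b)) has_real_derivative 2 * (\<Sum>a\<in>Basis. w a x * dw b a x)) (at 0)"
    proof -
      have "((\<lambda>s. S (x + s *\<^sub>R b)) has_real_derivative (\<Sum>a\<in>Basis. dw b a x * w a (x + 0 *\<^sub>R b) + dw b a x * w a (x + 0 *\<^sub>R b))) (at 0)"
        unfolding S_def by (intro DERIV_sum DERIV_mult d)
      then show ?thesis by (simp add: sum_distrib_left mult.commute)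
    qed
    show "((\<lambda>s. F b (x + s *\<^sub>R b)) has_real_derivative F' b x) (at 0)"
      unfolding F_def
      by (rule DERIV_cong[OF DERIV_diff[OF DERIV_mult[OF DERIV_mult[OF d\<phi> dP] d[OF b]]
            DERIV_cdivide[OF DERIV_mult[OF DERIV_mult[OF d\<phi> dS] dx]]]])
         (use b in \<open>simp add: F'_def algebra_simps\<close>)
  qed
  then have "(\<Sum>b\<in>Basis. LINT x|lebesgue. F' b x) = 0" by simp
  moreover have iF': "integrable lebesgue (F' b)" if "b \<in> Basis" for b
    by (rule integrable_kernel[OF kF'[OF that]])
  ultimately have zero: "(LINT x|lebesgue. (\<Sum>b\<in>Basis. F' b x)) = 0"
    by (subst Bochner_Integration.integral_sum) auto
  \<comment> \<open>Minus the part of the divergence free of derivatives of \<open>w\<close>: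
    \<open>DIM('a) / 2\<close> stems from the divergence of \<open>x\<close> in
    \<open>\<phi> S x / 2\<close>, and \<open>- 1\<close> from differentiating the explicit
    \<open>x\<close> in \<open>P\<close>.\<close>
  define A where "A x = ((DIM('a) / 2 - 1) * \<phi> x + (\<Sum>b\<in>Basis. (x \<bullet> b) * pd b \<phi> x) / 2) * S x
            - P x * (\<Sum>b\<in>Basis. pd b \<phi> x * w b x)" for x
  define L where "L x = \<phi> x * P x * (\<Sum>b\<in>Basis. dw b b x)" for x
  have sumF': "(\<Sum>b\<in>Basis. F' b x) = L x - A x" for x
  proof -
    have swap: "(\<Sum>b\<in>Basis. (\<Sum>a\<in>Basis. w a x * dw b a x) * (x \<bullet> b)) = (\<Sum>b\<in>Basis. (\<Sum>a\<in>Basis. (x \<bullet> a) * dw b a x) * w b x)"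
    proof -
      have "(\<Sum>b\<in>Basis. (\<Sum>a\<in>Basis. w a x * dw b a x) * (x \<bullet> b)) = (\<Sum>b\<in>Basis. \<Sum>a\<in>Basis. w a x * dw b a x * (x \<bullet> b))"
        by (simp add: sum_distrib_right)
      also have "\<dots> = (\<Sum>a\<in>Basis. \<Sum>b\<in>Basis. w a x * dw b a x * (x \<bullet> b))" by (rule sum.swap)
      also have "\<dots> = (\<Sum>a\<in>Basis. \<Sum>b\<in>Basis. (x \<bullet> b) * dw a b x * w a x)"
        by (intro sum.cong refl) (simp add: sym mult_ac)
      finally show ?thesis by (simp add: sum_distrib_right)
    qed
    have "(\<Sum>b\<in>Basis. F' b x) = (\<Sum>b\<in>Basis. P x * (pd b \<phi> x * w b x) + \<phi> x * (w b x * w b x)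
         + \<phi> x * ((\<Sum>a\<in>Basis. (x \<bullet> a) * dw b a x) * w b x) + \<phi> x * P x * dw b b x
         - S x / 2 * ((x \<bullet> b) * pd b \<phi> x) - \<phi> x * ((\<Sum>a\<in>Basis. w a x * dw b a x) * (x \<bullet> b)) - \<phi> x * S x / 2)"
      by (intro sum.cong refl) (simp add: F'_def field_simps)
    also have "\<dots> = P x * (\<Sum>b\<in>Basis. pd b \<phi> x * w b x) + \<phi> x * S x
         + \<phi> x * (\<Sum>b\<in>Basis. (\<Sum>a\<in>Basis. (x \<bullet> a) * dw b a x) * w b x) + L x
         - S x / 2 * (\<Sum>b\<in>Basis. (x \<bullet> b) * pd b \<phi> x) - \<phi> x * (\<Sum>b\<in>Basis. (\<Sum>a\<in>Basis. w a x * dw b a x) * (x \<bullet> b)) - DIM('a) * (\<phi> x * S x / 2)"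
      unfolding sum_subtractf sum.distrib sum_distrib_left[symmetric] L_def
      by (simp add: S_def)
    also have "\<dots> = L x - A x"
      unfolding swap A_def by (simp add: field_simps)
    finally show ?thesis .
  qed
  have "kernel R A"
    using z unfolding A_def by (intro kernelI continuous_intros c\<phi> cS cP cw) auto
  moreover have "kernel R L"
    using z unfolding L_def by (intro kernelI continuous_intros c\<phi> cS cP cdw) auto
  ultimately have "integrable lebesgue A" "integrable lebesgue L" by (auto intro: integrable_kernel)
  then have "(LINT x|lebesgue. A x) = (LINT x|lebesgue. L x)" using zero by (simp add: sumF')
  then show ?thesis by (simp add: A_def L_def)
qed

subsection \<open>The weak identity\<close>

lemma integrable_inner_Basis_square:
  fixes F :: "'a \<Rightarrow> 'b::euclidean_space"
  assumes [measurable]: "F \<in> borel_measurable M" and i: "integrable M (\<lambda>x. (norm (F x))\<^sup>2)" and b: "b \<in> Basis"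
  shows "integrable M (\<lambda>x. (F x \<bullet> b)\<^sup>2)"
proof (rule Bochner_Integration.integrable_bound[OF i])
  have "\<bar>F x \<bullet> b\<bar>\<^sup>2 \<le> (norm (F x))\<^sup>2" for x by (intro power_mono Basis_le_norm b) simp
  then show "AE x in M. norm ((F x \<bullet> b)\<^sup>2) \<le> norm ((norm (F x))\<^sup>2)" by (intro AE_I2) simp
qed measurable

lemma conv_product_limit:
  fixes v w \<beta> :: "'a::euclidean_space \<Rightarrow> real"
  assumes v: "v \<in> borel_measurable lebesgue" "integrable lebesgue (\<lambda>x. (v x)\<^sup>2)"
    and w: "w \<in> borel_measurable lebesgue" "integrable lebesgue (\<lambda>x. (w x)\<^sup>2)"
    and \<beta>: "kernel R \<beta>" and h: "\<And>n. h n > 0" "h \<longlonglongrightarrow> 0"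
  shows "(\<lambda>n. LINT x|lebesgue. \<beta> x * (conv v (rho (h n)) x * conv w (rho (h n)) x)) \<longlonglongrightarrow> (LINT x|lebesgue. \<beta> x * (v x * w x))"
proof -
  obtain B where B: "\<And>z. \<bar>\<beta> z\<bar> \<le> B" using kernel_bounded[OF \<beta>] by blast
  have m: "conv v (rho (h n)) \<in> borel_measurable lebesgue" "conv w (rho (h n)) \<in> borel_measurable lebesgue" for n
    by (intro continuous_lebesgue_measurable conv_continuous[OF _ kernel_rho[OF h(1)]] square_integrable_L1_loc v w)+
  show ?thesis
    by (rule tendsto_integral_L2_product[OF v w m(1) _ m(2) _ conv_rho_L2[OF v h] conv_rho_L2[OF w h] kernel_measurable[OF \<beta>] B])
       (rule conv_rho_L2_contraction(1)[OF v h(1)] conv_rho_L2_contraction(1)[OF w h(1)])+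
qed

lemma conv_product_integrable:
  fixes v w \<beta> :: "'a::euclidean_space \<Rightarrow> real"
  assumes v: "v \<in> borel_measurable lebesgue" "integrable lebesgue (\<lambda>x. (v x)\<^sup>2)"
    and w: "w \<in> borel_measurable lebesgue" "integrable lebesgue (\<lambda>x. (w x)\<^sup>2)"
    and \<beta>: "kernel R \<beta>"
  shows "integrable lebesgue (\<lambda>x. \<beta> x * (v x * w x))"
proof -
  obtain B where B: "\<And>z. \<bar>\<beta> z\<bar> \<le> B" using kernel_bounded[OF \<beta>] by blast
  show ?thesis
    by (rule integrable_bounded_times[OF cauchy_schwarz_integral(1)[OF v(1) w(1) v(2) w(2)] kernel_measurable[OF \<beta>] B])
qed

lemma kernel_rho_pd: "t > 0 \<Longrightarrow> kernel t (pd b (rho t :: 'a::euclidean_space \<Rightarrow> real))"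
proof (rule kernelI)
  assume t: "t > 0"
  show "continuous_on UNIV (pd b (rho t :: 'a \<Rightarrow> real))"
    by (intro smooth_fun_continuous smooth_fun_pd smooth_fun_rho)
  show "pd b (rho t) z = 0" if "norm z > t" for z :: 'a
    using that moll_eq_0[OF t, where ?'a='a] by (intro pd_outside[of 0 t]) (auto simp: rho_def)
qed

lemma pd_rho_shift: "pd a (rho t) (y - x) = pd a (\<lambda>y. rho t (y - x)) y"
  using pd_moll[of a "flat_deriv 1" t 0] pd_moll[of a "flat_deriv 1" t x] by (simp add: rho_def)

lemma pd_pd_rho_commute: "pd a (pd b (\<lambda>y. rho t (y - x))) = pd b (pd a (\<lambda>y. rho t (y - x)))"
  unfolding rho_def pd_pd_moll by (simp add: inner_commute mult_ac)

text \<open>Splits the integrand into finitely many terms, each a fixed coefficient times a product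
  of two components, so that the limit theorem for products applies entrywise.\<close>

lemma quadratic_form_expand:
  fixes w :: "'a::euclidean_space \<Rightarrow> real"
  shows "\<alpha> * (\<Sum>a\<in>Basis. w a * w a) - (\<Sum>a\<in>Basis. x a * w a) * (\<Sum>b\<in>Basis. d b * w b)
    = (\<Sum>a\<in>Basis. \<Sum>b\<in>Basis. ((if a = b then \<alpha> else 0) - x a * d b) * (w a * w b))"
proof -
  have "(\<Sum>a\<in>Basis. \<Sum>b\<in>Basis. ((if a = b then \<alpha> else 0) - x a * d b) * (w a * w b))
     = (\<Sum>a\<in>Basis. \<Sum>b\<in>Basis. (if a = b then \<alpha> * (w a * w b) else 0) - (x a * w a) * (d b * w b))"
    by (intro sum.cong refl) (auto simp: algebra_simps)
  also have "\<dots> = (\<Sum>a\<in>Basis. \<alpha> * (w a * w a)) - (\<Sum>a\<in>Basis. x a * w a) * (\<Sum>b\<in>Basis. d b * w b)"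
    by (simp add: sum_subtractf sum_product)
  finally show ?thesis by (simp add: sum_distrib_left)
qed

text \<open>A mollified weak gradient has a symmetric derivative, and its divergence is minus the
  mollified \<open>g\<close>. Apart from this divergence the classical identity is quadratic in the
  field with compactly supported coefficients, so mean square convergence of the gradient and of
  \<open>g\<close> suffices for the limit.\<close>

lemma pohozaev_local:
  fixes u g :: "'a::euclidean_space \<Rightarrow> real"
  assumes wg: "has_weak_gradient u Du" and D2: "integrable lebesgue (\<lambda>x. (norm (Du x))\<^sup>2)"
    and g: "g \<in> L1_loc" and g2: "integrable lebesgue (\<lambda>x. (indicator (cball 0 (R + 1)) x * g x)\<^sup>2)"
    and eq: "\<And>v. v \<in> Cc_infinity \<Longrightarrow> (LINT x|lebesgue. Du x \<bullet> grad v x) = (LINT x|lebesgue. g x * v x)"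
    and \<phi>: "smooth_fun \<phi>" and \<phi>0: "\<And>x. x \<notin> cball 0 R \<Longrightarrow> \<phi> x = 0"
  shows "(LINT x|lebesgue. ((DIM('a) / 2 - 1) * \<phi> x + (x \<bullet> grad \<phi> x) / 2) * (norm (Du x))\<^sup>2
            - (x \<bullet> Du x) * (grad \<phi> x \<bullet> Du x))
       = - (LINT x|lebesgue. \<phi> x * (x \<bullet> Du x) * g x)"
proof -
  have uL: "u \<in> L1_loc" and DL: "Du \<in> L1_loc" using wg by (auto simp: has_weak_gradient_def)
  note DbL = L1_loc_inner[OF DL]
  have [measurable]: "Du \<in> borel_measurable lebesgue" "g \<in> borel_measurable lebesgue"
    using DL g by (auto simp: L1_loc_def)
  have Dm: "(\<lambda>x. Du x \<bullet> b) \<in> borel_measurable lebesgue" for b by measurable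
  have Di: "integrable lebesgue (\<lambda>x. (Du x \<bullet> b)\<^sup>2)" if b: "b \<in> Basis" for b
    by (rule integrable_inner_Basis_square[OF _ D2 b]) measurable
  \<comment> \<open>Truncation makes \<open>g\<close> globally square integrable; for scales up to
    \<open>1\<close> its mollifications are unaffected on the support of
    \<open>\<phi>\<close>.\<close>
  define gm where "gm x = indicator (cball 0 (R + 1)) x * g x" for x
  have gmm: "gm \<in> borel_measurable lebesgue" unfolding gm_def by measurable
  have gm2: "integrable lebesgue (\<lambda>x. (gm x)\<^sup>2)" using g2 by (simp add: gm_def)
  define h :: "nat \<Rightarrow> real" where "h n = (1 / 2) ^ n" for n
  have h: "h n > 0" "h n \<le> 1" for n by (auto simp: h_def power_le_one)
  have h0: "h \<longlonglongrightarrow> 0" unfolding h_def by (rule LIMSEQ_realpow_zero) auto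
  define w where "w n b = conv (\<lambda>y. Du y \<bullet> b) (rho (h n))" for n b
  define dw where "dw n a b x = - conv (\<lambda>y. Du y \<bullet> b) (pd a (rho (h n))) x" for n a b x
  define \<alpha> where "\<alpha> x = (DIM('a) / 2 - 1) * \<phi> x + (\<Sum>b\<in>Basis. (x \<bullet> b) * pd b \<phi> x) / 2" for x
  define \<beta> where "\<beta> a b x = (if a = b then \<alpha> x else 0) - (x \<bullet> a) * pd b \<phi> x" for a b x
  have c\<phi>: "continuous_on UNIV \<phi>" "continuous_on UNIV (pd b \<phi>)" for b
    by (intro smooth_fun_continuous smooth_fun_pd \<phi>)+
  have z: "\<phi> x = 0" "pd b \<phi> x = 0" if "norm x > R" for b x
    using that \<phi>0[of x] pd_outside[of 0 R \<phi> x b] \<phi>0 by auto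
  have k\<beta>: "kernel R (\<beta> a b)" for a b
    using z unfolding \<beta>_def \<alpha>_def by (cases "a = b") (auto intro!: kernelI continuous_intros c\<phi>)
  have k\<phi>: "kernel R (\<lambda>x. \<phi> x * (x \<bullet> a))" for a
    using z by (intro kernelI continuous_intros c\<phi>) auto
  \<comment> \<open>With both derivatives on the kernel, the symmetry demanded by
    \<open>pohozaev_classical\<close> becomes commutation of derivatives of an explicit
    kernel.\<close>
  have dw_eq: "dw n a b x = (LINT y|lebesgue. u y * pd b (pd a (\<lambda>y. rho (h n) (y - x))) y)" if b: "b \<in> Basis" for n a b x
  proof -
    have "(LINT y|lebesgue. u y * pd b (pd a (\<lambda>y. rho (h n) (y - x))) y)
       = - (LINT y|lebesgue. (Du y \<bullet> b) * pd a (\<lambda>y. rho (h n) (y - x)) y)"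
    proof (rule weak_gradientD[OF wg smooth_fun_pd[OF smooth_fun_rho_shift] _ b])
      show "pd a (\<lambda>y. rho (h n) (y - x)) y = 0" if "y \<notin> cball x (h n)" for y
        using rho_shift_outside[OF h(1)] that by (rule pd_outside)
    qed
    then show ?thesis by (simp add: dw_def conv_def pd_rho_shift)
  qed
  \<comment> \<open>The mollifier centred at \<open>x\<close> is itself a test function for the
    equation. The minus sign stems from differentiating \<open>y - x\<close> in
    \<open>x\<close>.\<close>
  have lap: "(\<Sum>b\<in>Basis. dw n b b x) = - conv g (rho (h n)) x" for n x
  proof -
    have i: "integrable lebesgue (\<lambda>y. (Du y \<bullet> b) * pd b (rho (h n)) (y - x))" for b
      by (rule integrable_L1_loc_kernel[OF DbL kernel_rho_pd[OF h(1)]])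
    have "(\<Sum>b\<in>Basis. dw n b b x) = - (LINT y|lebesgue. (\<Sum>b\<in>Basis. (Du y \<bullet> b) * pd b (rho (h n)) (y - x)))"
      unfolding dw_def conv_def by (subst Bochner_Integration.integral_sum) (auto simp: i sum_negf)
    also have "\<dots> = - (LINT y|lebesgue. Du y \<bullet> grad (\<lambda>y. rho (h n) (y - x)) y)"
      unfolding pd_rho_shift by (simp add: pd_def flip: euclidean_inner)
    also have "\<dots> = - (LINT y|lebesgue. g y * rho (h n) (y - x))"
      by (subst eq[OF smooth_fun_Cc_infinity[OF smooth_fun_rho_shift rho_shift_outside[OF h(1)]]]) auto
    finally show ?thesis by (simp add: conv_def)
  qed
  have classical: "(LINT x|lebesgue. \<alpha> x * (\<Sum>a\<in>Basis. w n a x * w n a x)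
            - (\<Sum>a\<in>Basis. (x \<bullet> a) * w n a x) * (\<Sum>b\<in>Basis. pd b \<phi> x * w n b x))
       = (LINT x|lebesgue. \<phi> x * (\<Sum>a\<in>Basis. (x \<bullet> a) * w n a x) * (\<Sum>b\<in>Basis. dw n b b x))" for n
    unfolding \<alpha>_def
  proof (rule pohozaev_classical[where w = "w n" and dw = "dw n", OF _ _ _ _ \<phi> \<phi>0])
    show "continuous_on UNIV (w n b)" for b
      unfolding w_def by (rule conv_continuous[OF DbL kernel_rho[OF h(1)]])
    show "continuous_on UNIV (dw n a b)" for a b
      unfolding dw_def by (intro continuous_on_minus conv_continuous[OF DbL kernel_rho_pd[OF h(1)]])
    show "((\<lambda>s. w n b (x + s *\<^sub>R a)) has_real_derivative dw n a b x) (at 0)" for a b x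
    proof -
      show ?thesis
        using conv_has_derivative[OF DbL kernel_rho[OF h(1)[of n]] smooth_fun_GDERIV[OF smooth_fun_rho], where b = a and x = x and s = 0]
          kernel_rho_pd[OF h(1), of n a]
        by (simp add: w_def dw_def pd_def[abs_def])
    qed
    show "dw n a b x = dw n b a x" if "a \<in> Basis" "b \<in> Basis" for a b x
      using that by (simp add: dw_eq pd_pd_rho_commute[of a b])
  qed
  have wm: "w n b \<in> borel_measurable lebesgue" for n b
    unfolding w_def by (intro continuous_lebesgue_measurable conv_continuous[OF DbL kernel_rho[OF h(1)]])
  have wi: "integrable lebesgue (\<lambda>x. (w n b x)\<^sup>2)" if "b \<in> Basis" for n b
    unfolding w_def by (rule conv_rho_L2_contraction(1)[OF Dm Di[OF that] h(1)])
  let ?G = "\<lambda>n. conv gm (rho (h n))"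
  have Gm: "?G n \<in> borel_measurable lebesgue" for n
    by (intro continuous_lebesgue_measurable conv_continuous[OF _ kernel_rho[OF h(1)]] square_integrable_L1_loc gmm gm2)
  have Gi: "integrable lebesgue (\<lambda>x. (?G n x)\<^sup>2)" for n
    by (rule conv_rho_L2_contraction(1)[OF gmm gm2 h(1)])
  have lhs_n: "(LINT x|lebesgue. \<alpha> x * (\<Sum>a\<in>Basis. w n a x * w n a x)
            - (\<Sum>a\<in>Basis. (x \<bullet> a) * w n a x) * (\<Sum>b\<in>Basis. pd b \<phi> x * w n b x))
       = (\<Sum>a\<in>Basis. \<Sum>b\<in>Basis. LINT x|lebesgue. \<beta> a b x * (w n a x * w n b x))" for n
    unfolding quadratic_form_expand \<beta>_def[symmetric]
    by (subst Bochner_Integration.integral_sum;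
        (intro Bochner_Integration.integrable_sum sum.cong refl Bochner_Integration.integral_sum)?;
        (rule conv_product_integrable[OF wm wi wm wi k\<beta>]; assumption)?)
  have rhs_n: "(LINT x|lebesgue. \<phi> x * (\<Sum>a\<in>Basis. (x \<bullet> a) * w n a x) * (\<Sum>b\<in>Basis. dw n b b x))
      = - (\<Sum>a\<in>Basis. LINT x|lebesgue. \<phi> x * (x \<bullet> a) * (w n a x * ?G n x))" for n
  proof -
    have "\<phi> x * (\<Sum>a\<in>Basis. (x \<bullet> a) * w n a x) * (\<Sum>b\<in>Basis. dw n b b x)
      = - (\<Sum>a\<in>Basis. \<phi> x * (x \<bullet> a) * (w n a x * ?G n x))" for x
    proof (cases "norm x \<le> R")
      case True
      have "?G n x = conv g (rho (h n)) x" unfolding gm_def by (rule conv_rho_cball[OF h True])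
      then show ?thesis by (simp add: lap sum_distrib_left sum_distrib_right sum_negf mult_ac)
    next
      case False then show ?thesis by (simp add: \<phi>0)
    qed
    then have "(LINT x|lebesgue. \<phi> x * (\<Sum>a\<in>Basis. (x \<bullet> a) * w n a x) * (\<Sum>b\<in>Basis. dw n b b x))
       = - (LINT x|lebesgue. (\<Sum>a\<in>Basis. \<phi> x * (x \<bullet> a) * (w n a x * ?G n x)))" by simp
    also have "(LINT x|lebesgue. (\<Sum>a\<in>Basis. \<phi> x * (x \<bullet> a) * (w n a x * ?G n x)))
       = (\<Sum>a\<in>Basis. LINT x|lebesgue. \<phi> x * (x \<bullet> a) * (w n a x * ?G n x))"
      by (rule Bochner_Integration.integral_sum) (rule conv_product_integrable[OF wm wi Gm Gi k\<phi>])
    finally show ?thesis .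
  qed
  have "(\<lambda>n. \<Sum>a\<in>Basis. \<Sum>b\<in>Basis. LINT x|lebesgue. \<beta> a b x * (w n a x * w n b x))
      \<longlonglongrightarrow> (\<Sum>a\<in>Basis. \<Sum>b\<in>Basis. LINT x|lebesgue. \<beta> a b x * ((Du x \<bullet> a) * (Du x \<bullet> b)))"
    unfolding w_def by (intro tendsto_sum conv_product_limit[OF Dm Di Dm Di k\<beta> h(1) h0])
  moreover have "(\<lambda>n. - (\<Sum>a\<in>Basis. LINT x|lebesgue. \<phi> x * (x \<bullet> a) * (w n a x * ?G n x)))
      \<longlonglongrightarrow> - (\<Sum>a\<in>Basis. LINT x|lebesgue. \<phi> x * (x \<bullet> a) * ((Du x \<bullet> a) * gm x))"
    unfolding w_def by (intro tendsto_minus tendsto_sum conv_product_limit[OF Dm Di gmm gm2 k\<phi> h(1) h0])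
  ultimately have lim: "(\<Sum>a\<in>Basis. \<Sum>b\<in>Basis. LINT x|lebesgue. \<beta> a b x * ((Du x \<bullet> a) * (Du x \<bullet> b)))
      = - (\<Sum>a\<in>Basis. LINT x|lebesgue. \<phi> x * (x \<bullet> a) * ((Du x \<bullet> a) * gm x))"
    unfolding lhs_n[symmetric] classical rhs_n by (rule LIMSEQ_unique)
  have "(\<Sum>a\<in>Basis. \<Sum>b\<in>Basis. LINT x|lebesgue. \<beta> a b x * ((Du x \<bullet> a) * (Du x \<bullet> b)))
     = (LINT x|lebesgue. (\<Sum>a\<in>Basis. \<Sum>b\<in>Basis. \<beta> a b x * ((Du x \<bullet> a) * (Du x \<bullet> b))))"
    by (subst Bochner_Integration.integral_sum;
        (intro Bochner_Integration.integrable_sum sum.cong refl Bochner_Integration.integral_sum[symmetric])?;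
        (rule conv_product_integrable[OF Dm Di Dm Di k\<beta>]; assumption)?)
  also have "\<dots> = (LINT x|lebesgue. ((DIM('a) / 2 - 1) * \<phi> x + (x \<bullet> grad \<phi> x) / 2) * (norm (Du x))\<^sup>2
            - (x \<bullet> Du x) * (grad \<phi> x \<bullet> Du x))"
    unfolding \<beta>_def quadratic_form_expand[symmetric] \<alpha>_def
    by (simp add: pd_def power2_norm_eq_inner flip: euclidean_inner)
  finally have l: "(\<Sum>a\<in>Basis. \<Sum>b\<in>Basis. LINT x|lebesgue. \<beta> a b x * ((Du x \<bullet> a) * (Du x \<bullet> b)))
     = (LINT x|lebesgue. ((DIM('a) / 2 - 1) * \<phi> x + (x \<bullet> grad \<phi> x) / 2) * (norm (Du x))\<^sup>2
            - (x \<bullet> Du x) * (grad \<phi> x \<bullet> Du x))" .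
  have "(\<Sum>a\<in>Basis. LINT x|lebesgue. \<phi> x * (x \<bullet> a) * ((Du x \<bullet> a) * gm x))
     = (LINT x|lebesgue. (\<Sum>a\<in>Basis. \<phi> x * (x \<bullet> a) * ((Du x \<bullet> a) * gm x)))"
    by (rule Bochner_Integration.integral_sum[symmetric]) (rule conv_product_integrable[OF Dm Di gmm gm2 k\<phi>])
  also have "\<dots> = (LINT x|lebesgue. \<phi> x * (x \<bullet> Du x) * g x)"
  proof (intro Bochner_Integration.integral_cong refl)
    fix x
    show "(\<Sum>a\<in>Basis. \<phi> x * (x \<bullet> a) * ((Du x \<bullet> a) * gm x)) = \<phi> x * (x \<bullet> Du x) * g x"
    proof (cases "norm x \<le> R")
      case True
      then have "gm x = g x" by (simp add: gm_def)
      then show ?thesis by (simp add: euclidean_inner[of x "Du x"] sum_distrib_left sum_distrib_right mult_ac)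
    next
      case False then show ?thesis by (simp add: \<phi>0)
    qed
  qed
  finally show ?thesis using lim l by simp
qed

text \<open>For the mollified function this is the ordinary chain rule followed by integration by
  parts. Boundedness of \<open>f\<close> makes \<open>F\<close> Lipschitz, so \<open>F\<close> of
  the mollifications converges in the mean on the support of \<open>\<beta>\<close>, and it keeps
  \<open>f\<close> of them uniformly bounded.\<close>

lemma weak_chain_rule:
  fixes u :: "'a::euclidean_space \<Rightarrow> real"
  assumes wg: "has_weak_gradient u Du"
    and f: "continuous_on UNIV f" "\<And>t. \<bar>f t\<bar> \<le> B"
    and F: "\<And>t. (F has_real_derivative f t) (at t)"
    and \<beta>: "smooth_fun \<beta>" and \<beta>0: "\<And>x. x \<notin> cball 0 R \<Longrightarrow> \<beta> x = 0" and b: "b \<in> Basis"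
  shows "(LINT x|lebesgue. f (u x) * (Du x \<bullet> b) * \<beta> x) = - (LINT x|lebesgue. F (u x) * pd b \<beta> x)"
proof -
  have uL: "u \<in> L1_loc" and DL: "Du \<in> L1_loc" using wg by (auto simp: has_weak_gradient_def)
  note DbL = L1_loc_inner[OF DL, of b]
  have [measurable]: "u \<in> borel_measurable lebesgue" "Du \<in> borel_measurable lebesgue"
    using uL DL by (auto simp: L1_loc_def)
  have [measurable]: "f \<in> borel_measurable borel" by (rule borel_measurable_continuous_onI[OF f(1)])
  have cF: "continuous_on UNIV F" using F by (auto intro!: DERIV_continuous_on)
  have [measurable]: "F \<in> borel_measurable borel" by (rule borel_measurable_continuous_onI[OF cF])
  have B0: "B \<ge> 0" using f(2)[of 0] by linarith
  have Lip: "\<bar>F s - F t\<bar> \<le> B * \<bar>s - t\<bar>" for s t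
    using field_differentiable_bound[of UNIV F f B s t] F f(2) by auto
  define v where "v x = indicator (cball 0 (R + 1)) x * u x" for x
  define d where "d x = indicator (cball 0 (R + 1)) x * (Du x \<bullet> b)" for x
  have vi: "integrable lebesgue v" unfolding v_def by (rule L1_loc_cball_integrable[OF uL])
  have di: "integrable lebesgue d" unfolding d_def by (rule L1_loc_cball_integrable[OF DbL])
  have [measurable]: "v \<in> borel_measurable lebesgue" "d \<in> borel_measurable lebesgue" using vi di by auto
  define h :: "nat \<Rightarrow> real" where "h n = (1 / 2) ^ n" for n
  have h: "h n > 0" "h n \<le> 1" for n by (auto simp: h_def power_le_one)
  have h0: "h \<longlonglongrightarrow> 0" unfolding h_def by (rule LIMSEQ_realpow_zero) auto
  have c\<beta>: "continuous_on UNIV \<beta>" "continuous_on UNIV (pd b \<beta>)"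
    by (intro smooth_fun_continuous smooth_fun_pd \<beta>)+
  have z: "\<beta> x = 0" "pd b \<beta> x = 0" if "norm x > R" for x
    using that \<beta>0[of x] pd_outside[of 0 R \<beta> x b] \<beta>0 by auto
  have k\<beta>: "kernel R \<beta>" "kernel R (pd b \<beta>)" using z by (auto intro: kernelI c\<beta>)
  obtain K1 where K1: "\<And>x. \<bar>\<beta> x\<bar> \<le> K1" using kernel_bounded[OF k\<beta>(1)] by blast
  obtain K2 where K2: "\<And>x. \<bar>pd b \<beta> x\<bar> \<le> K2" using kernel_bounded[OF k\<beta>(2)] by blast
  have K0: "K1 \<ge> 0" "K2 \<ge> 0" using K1[of 0] K2[of 0] by linarith+
  note [measurable] = kernel_measurable[OF k\<beta>(1)] kernel_measurable[OF k\<beta>(2)]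
  \<comment> \<open>Since \<open>f\<close> is only continuous, convergence of \<open>f\<close> along
    the mollifications has to be pointwise; this is the reason for passing to a subsequence.\<close>
  obtain s where s: "strict_mono s" "AE x in lebesgue. (\<lambda>n. conv v (rho (h (s n))) x) \<longlonglongrightarrow> v x"
    using conv_rho_subseq_AE[OF vi h(1) h0] by blast
  define U where "U n = conv v (rho (h (s n)))" for n
  define W where "W n = conv d (rho (h (s n)))" for n
  have Ui: "integrable lebesgue (U n)" and Wi: "integrable lebesgue (W n)" for n
    unfolding U_def W_def by (intro conv_integrable(1)[OF _ kernel_rho[OF h(1)]] vi di)+
  have [measurable]: "U n \<in> borel_measurable lebesgue" "W n \<in> borel_measurable lebesgue" for n
    using Ui[of n] Wi[of n] by auto
  have UL1: "(\<lambda>n. LINT x|lebesgue. \<bar>U n x - v x\<bar>) \<longlonglongrightarrow> 0"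
    unfolding U_def using LIMSEQ_subseq_LIMSEQ[OF conv_rho_L1[OF vi h(1) h0] s(1)] by (simp add: o_def)
  have WL1: "(\<lambda>n. LINT x|lebesgue. \<bar>W n x - d x\<bar>) \<longlonglongrightarrow> 0"
    unfolding W_def using LIMSEQ_subseq_LIMSEQ[OF conv_rho_L1[OF di h(1) h0] s(1)] by (simp add: o_def)
  have ident: "(LINT x|lebesgue. f (U n x) * W n x * \<beta> x + F (U n x) * pd b \<beta> x) = 0" for n
  proof -
    define t where "t = h (s n)"
    have t: "t > 0" "t \<le> 1" using h by (auto simp: t_def)
    let ?u = "conv u (rho t)" and ?w = "conv (\<lambda>y. Du y \<bullet> b) (rho t)"
    have cu: "continuous_on UNIV ?u" and cw: "continuous_on UNIV ?w"
      by (intro conv_continuous[OF _ kernel_rho[OF t(1)]] uL DbL)+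
    have cf: "continuous_on UNIV (\<lambda>x. f (?u x))" "continuous_on UNIV (\<lambda>x. F (?u x))"
      by (auto intro: continuous_on_compose2[OF f(1) cu] continuous_on_compose2[OF cF cu])
    have du: "((\<lambda>s. ?u (x + s *\<^sub>R b)) has_real_derivative ?w x) (at 0)" for x
    proof -
      have "(LINT y|lebesgue. u y * pd b (\<lambda>y. rho t (y - x)) y) = - ?w x"
        by (rule weak_gradient_rho[OF wg t(1) b])
      then have "- conv u (pd b (rho t)) x = ?w x" by (simp add: conv_def pd_rho_shift)
      then show ?thesis
        using conv_has_derivative[OF uL kernel_rho[OF t(1)] smooth_fun_GDERIV[OF smooth_fun_rho], where b = b and x = x and s = 0]
          kernel_rho_pd[OF t(1), of b]
        by (simp add: pd_def[abs_def])
    qed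
    have "(LINT x|lebesgue. f (?u x) * ?w x * \<beta> x + pd b \<beta> x * F (?u x)) = 0"
    proof (rule integral_directional_derivative_eq_0[where r = R])
      show "kernel R (\<lambda>x. F (?u x) * \<beta> x)" by (rule kernel_mult_left[OF cf(2) k\<beta>(1)])
      show "kernel R (\<lambda>x. f (?u x) * ?w x * \<beta> x + pd b \<beta> x * F (?u x))"
        by (intro kernel_add kernel_mult_left kernel_mult_right k\<beta> continuous_intros cf cw)
      fix x
      have "((\<lambda>s. F (?u (x + s *\<^sub>R b))) has_real_derivative f (?u (x + 0 *\<^sub>R b)) * ?w x) (at 0)"
        by (rule DERIV_chain2[OF F du])
      from DERIV_mult[OF this smooth_fun_has_directional_derivative[OF \<beta>, of x b 0]]
      show "((\<lambda>s. F (?u (x + s *\<^sub>R b)) * \<beta> (x + s *\<^sub>R b)) has_real_derivative f (?u x) * ?w x * \<beta> x + pd b \<beta> x * F (?u x)) (at 0)"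
        by simp
    qed
    moreover have "f (?u x) * ?w x * \<beta> x + pd b \<beta> x * F (?u x) = f (U n x) * W n x * \<beta> x + F (U n x) * pd b \<beta> x" for x
    proof (cases "norm x \<le> R")
      case True
      have "U n x = ?u x" "W n x = ?w x"
        unfolding U_def W_def v_def d_def t_def[symmetric] by (intro conv_rho_cball[OF t True])+
      then show ?thesis by simp
    next
      case False then show ?thesis by (simp add: z)
    qed
    ultimately show ?thesis by simp
  qed
  have eq_v: "f (u x) * (Du x \<bullet> b) * \<beta> x = f (v x) * d x * \<beta> x" "F (u x) * pd b \<beta> x = F (v x) * pd b \<beta> x" for x
    by (cases "norm x \<le> R"; simp add: z v_def d_def)+
  have fb: "integrable lebesgue (\<lambda>x. f (k x) * e x * \<beta> x)"
    if [measurable]: "k \<in> borel_measurable lebesgue" and e: "integrable lebesgue e" for k e :: "'a \<Rightarrow> real"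
  proof -
    have "integrable lebesgue (\<lambda>x. (f (k x) * \<beta> x) * e x)"
    proof (rule integrable_bounded_times[OF e])
      show "\<bar>f (k x) * \<beta> x\<bar> \<le> B * K1" for x unfolding abs_mult by (intro mult_mono f(2) K1 B0) auto
    qed measurable
    then show ?thesis by (simp add: mult_ac)
  qed
  have Fb: "integrable lebesgue (\<lambda>x. F (k x) * pd b \<beta> x)" if k: "integrable lebesgue k" for k :: "'a \<Rightarrow> real"
  proof (rule Bochner_Integration.integrable_bound)
    have [measurable]: "k \<in> borel_measurable lebesgue" using k by auto
    show "(\<lambda>x. F (k x) * pd b \<beta> x) \<in> borel_measurable lebesgue" by measurable
    show "integrable lebesgue (\<lambda>x. \<bar>F 0\<bar> * \<bar>pd b \<beta> x\<bar> + B * K2 * \<bar>k x\<bar>)"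
      using k integrable_kernel[OF k\<beta>(2)] by auto
    have "\<bar>F (k x) * pd b \<beta> x\<bar> \<le> \<bar>F 0\<bar> * \<bar>pd b \<beta> x\<bar> + B * K2 * \<bar>k x\<bar>" for x
    proof -
      have "\<bar>F (k x)\<bar> * \<bar>pd b \<beta> x\<bar> \<le> (\<bar>F 0\<bar> + B * \<bar>k x\<bar>) * \<bar>pd b \<beta> x\<bar>"
        using Lip[of "k x" 0] by (intro mult_right_mono) auto
      also have "\<dots> \<le> \<bar>F 0\<bar> * \<bar>pd b \<beta> x\<bar> + (B * \<bar>k x\<bar>) * K2"
        unfolding distrib_right using K2 B0 by (intro add_left_mono mult_left_mono) auto
      finally show ?thesis by (simp add: abs_mult mult_ac)
    qed
    then show "AE x in lebesgue. norm (F (k x) * pd b \<beta> x) \<le> norm (\<bar>F 0\<bar> * \<bar>pd b \<beta> x\<bar> + B * K2 * \<bar>k x\<bar>)"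
      by (intro AE_I2) (metis abs_ge_self order_trans real_norm_def)
  qed
  have limF: "(\<lambda>n. LINT x|lebesgue. F (U n x) * pd b \<beta> x) \<longlonglongrightarrow> (LINT x|lebesgue. F (v x) * pd b \<beta> x)"
  proof (rule LIM_zero_cancel, rule Lim_null_comparison)
    show "(\<lambda>n. B * K2 * (LINT x|lebesgue. \<bar>U n x - v x\<bar>)) \<longlonglongrightarrow> 0"
      using tendsto_mult_left[OF UL1, of "B * K2"] by simp
    show "\<forall>\<^sub>F n in sequentially. norm ((LINT x|lebesgue. F (U n x) * pd b \<beta> x) - (LINT x|lebesgue. F (v x) * pd b \<beta> x))
        \<le> B * K2 * (LINT x|lebesgue. \<bar>U n x - v x\<bar>)"
    proof (intro always_eventually allI)
      fix n
      have "(LINT x|lebesgue. F (U n x) * pd b \<beta> x) - (LINT x|lebesgue. F (v x) * pd b \<beta> x)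
         = (LINT x|lebesgue. F (U n x) * pd b \<beta> x - F (v x) * pd b \<beta> x)" using Fb Ui vi by simp
      also have "norm \<dots> \<le> (LINT x|lebesgue. B * K2 * \<bar>U n x - v x\<bar>)"
      proof (rule Bochner_Integration.integral_norm_bound_integral)
        fix x
        have "\<bar>F (U n x) - F (v x)\<bar> * \<bar>pd b \<beta> x\<bar> \<le> (B * \<bar>U n x - v x\<bar>) * K2"
          using B0 by (intro mult_mono Lip K2) auto
        then show "norm (F (U n x) * pd b \<beta> x - F (v x) * pd b \<beta> x) \<le> B * K2 * \<bar>U n x - v x\<bar>"
          by (simp add: mult_ac flip: left_diff_distrib abs_mult)
      qed (use Fb Ui vi in auto)
      finally show "norm ((LINT x|lebesgue. F (U n x) * pd b \<beta> x) - (LINT x|lebesgue. F (v x) * pd b \<beta> x))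
        \<le> B * K2 * (LINT x|lebesgue. \<bar>U n x - v x\<bar>)" by simp
    qed
  qed
  have lim1: "(\<lambda>n. LINT x|lebesgue. f (U n x) * d x * \<beta> x) \<longlonglongrightarrow> (LINT x|lebesgue. f (v x) * d x * \<beta> x)"
  proof (rule integral_dominated_convergence[where w = "\<lambda>x. B * K1 * \<bar>d x\<bar>"])
    show "AE x in lebesgue. (\<lambda>n. f (U n x) * d x * \<beta> x) \<longlonglongrightarrow> f (v x) * d x * \<beta> x"
      using s(2)
    proof eventually_elim
      case (elim x)
      have "isCont f (v x)" using f(1) by (simp add: continuous_on_eq_continuous_at)
      then have "(\<lambda>n. f (U n x)) \<longlonglongrightarrow> f (v x)" unfolding U_def using elim by (rule isCont_tendsto_compose)
      then show ?case by (intro tendsto_intros)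
    qed
    show "integrable lebesgue (\<lambda>x. B * K1 * \<bar>d x\<bar>)" using di by auto
    show "AE x in lebesgue. norm (f (U n x) * d x * \<beta> x) \<le> B * K1 * \<bar>d x\<bar>" for n
    proof (rule AE_I2)
      fix x
      have "\<bar>f (U n x)\<bar> * \<bar>\<beta> x\<bar> * \<bar>d x\<bar> \<le> B * K1 * \<bar>d x\<bar>"
        by (intro mult_right_mono mult_mono f(2) K1 B0) auto
      then show "norm (f (U n x) * d x * \<beta> x) \<le> B * K1 * \<bar>d x\<bar>" by (simp add: abs_mult mult_ac)
    qed
  qed measurable
  \<comment> \<open>The product of two varying factors is split: the bounded factor meets the mean
    error of the gradient here, and in \<open>lim1\<close> it varies against the fixed
    gradient.\<close>
  have lim2: "(\<lambda>n. LINT x|lebesgue. f (U n x) * (W n x - d x) * \<beta> x) \<longlonglongrightarrow> 0"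
  proof (rule Lim_null_comparison)
    show "(\<lambda>n. B * K1 * (LINT x|lebesgue. \<bar>W n x - d x\<bar>)) \<longlonglongrightarrow> 0"
      using tendsto_mult_left[OF WL1, of "B * K1"] by simp
    show "\<forall>\<^sub>F n in sequentially. norm (LINT x|lebesgue. f (U n x) * (W n x - d x) * \<beta> x)
        \<le> B * K1 * (LINT x|lebesgue. \<bar>W n x - d x\<bar>)"
    proof (intro always_eventually allI)
      fix n
      have "norm (LINT x|lebesgue. f (U n x) * (W n x - d x) * \<beta> x) \<le> (LINT x|lebesgue. B * K1 * \<bar>W n x - d x\<bar>)"
      proof (rule Bochner_Integration.integral_norm_bound_integral)
        fix x
        have "\<bar>f (U n x)\<bar> * \<bar>\<beta> x\<bar> * \<bar>W n x - d x\<bar> \<le> B * K1 * \<bar>W n x - d x\<bar>"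
          by (intro mult_right_mono mult_mono f(2) K1 B0) auto
        then show "norm (f (U n x) * (W n x - d x) * \<beta> x) \<le> B * K1 * \<bar>W n x - d x\<bar>" by (simp add: abs_mult mult_ac)
      qed (use fb[of "U n" "\<lambda>x. W n x - d x"] Wi di in auto)
      then show "norm (LINT x|lebesgue. f (U n x) * (W n x - d x) * \<beta> x)
        \<le> B * K1 * (LINT x|lebesgue. \<bar>W n x - d x\<bar>)" by simp
    qed
  qed
  have "(LINT x|lebesgue. f (U n x) * (W n x - d x) * \<beta> x) + (LINT x|lebesgue. f (U n x) * d x * \<beta> x)
      + (LINT x|lebesgue. F (U n x) * pd b \<beta> x) = 0" for n
  proof -
    have "(LINT x|lebesgue. f (U n x) * (W n x - d x) * \<beta> x) + (LINT x|lebesgue. f (U n x) * d x * \<beta> x)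
        = (LINT x|lebesgue. f (U n x) * W n x * \<beta> x)"
      using fb[of "U n" "\<lambda>x. W n x - d x"] fb[of "U n" d] Wi di
      by (subst Bochner_Integration.integral_add[symmetric]) (auto simp: algebra_simps)
    then show ?thesis using ident[of n] fb[of "U n" "W n"] Fb[OF Ui[of n]] Wi by simp
  qed
  moreover have "(\<lambda>n. (LINT x|lebesgue. f (U n x) * (W n x - d x) * \<beta> x) + (LINT x|lebesgue. f (U n x) * d x * \<beta> x)
      + (LINT x|lebesgue. F (U n x) * pd b \<beta> x)) \<longlonglongrightarrow> 0 + (LINT x|lebesgue. f (v x) * d x * \<beta> x) + (LINT x|lebesgue. F (v x) * pd b \<beta> x)"
    by (intro tendsto_add lim2 lim1 limF)
  ultimately have "0 + (LINT x|lebesgue. f (v x) * d x * \<beta> x) + (LINT x|lebesgue. F (v x) * pd b \<beta> x) = 0"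
    by (simp add: LIMSEQ_const_iff)
  then show ?thesis by (simp add: eq_v)
qed

lemma primitive_has_real_derivative:
  assumes "continuous_on UNIV f"
  shows "(primitive f has_real_derivative f t) (at t)"
proof -
  let ?a = "- \<bar>t\<bar> - 1" and ?b = "\<bar>t\<bar> + 1"
  have "((\<lambda>u. LBINT y=(0::real)..u. f y) has_vector_derivative f t) (at t within {?a..?b})"
    by (rule interval_integral_FTC2) (use assms continuous_on_subset in auto)
  moreover have "at t within {?a..?b} = at t"
    by (rule at_within_Icc_at) auto
  ultimately show ?thesis
    unfolding primitive_def[abs_def] has_real_derivative_iff_has_vector_derivative
    by (simp add: zero_ereal_def)
qed

lemma primitive_0 [simp]: "primitive f 0 = 0"
  unfolding primitive_def by (simp add: zero_ereal_def)

lemma primitive_cong: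
  assumes "\<And>x. \<bar>x\<bar> \<le> \<bar>t\<bar> \<Longrightarrow> f x = g x"
  shows "primitive f t = primitive g t"
  unfolding primitive_def
proof (rule interval_integral_cong)
  fix x assume "x \<in> einterval (min 0 (ereal t)) (max 0 (ereal t))"
  then have "\<bar>x\<bar> \<le> \<bar>t\<bar>" by (auto simp: einterval_def zero_ereal_def min_def max_def split: if_splits)
  then show "f x = g x" by (rule assms)
qed

lemma primitive_growth:
  assumes f: "continuous_on UNIV f" and a: "a > 0" "b > 0" and c: "c \<ge> 0"
    and gr: "\<And>t. \<bar>f t\<bar> \<le> c * (\<bar>t\<bar> powr a + \<bar>t\<bar> powr b)"
  shows "\<bar>primitive f t\<bar> \<le> c * (\<bar>t\<bar> powr (a + 1) + \<bar>t\<bar> powr (b + 1))"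
proof -
  let ?B = "c * (\<bar>t\<bar> powr a + \<bar>t\<bar> powr b)"
  have "norm (primitive f t - primitive f 0) \<le> ?B * norm (t - 0)"
  proof (rule field_differentiable_bound[where S = "{- \<bar>t\<bar>..\<bar>t\<bar>}"])
    show "(primitive f has_field_derivative f z) (at z within {- \<bar>t\<bar>..\<bar>t\<bar>})" for z
      using primitive_has_real_derivative[OF f] by (rule DERIV_subset) simp
    show "norm (f z) \<le> ?B" if "z \<in> {- \<bar>t\<bar>..\<bar>t\<bar>}" for z
    proof -
      have "\<bar>z\<bar> \<le> \<bar>t\<bar>" using that by auto
      then have "c * (\<bar>z\<bar> powr a + \<bar>z\<bar> powr b) \<le> ?B"
        using a c by (intro mult_left_mono add_mono powr_mono2) auto
      with gr[of z] show ?thesis by simp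
    qed
  qed auto
  also have "?B * norm (t - 0) = c * (\<bar>t\<bar> powr (a + 1) + \<bar>t\<bar> powr (b + 1))"
    by (cases "t = 0") (auto simp: powr_add algebra_simps)
  finally show ?thesis by simp
qed

text \<open>Clamping the argument instead of the value leaves \<open>f\<close> unchanged on
  \<open>[-n, n]\<close>, so the primitives agree there too, and it preserves every growth bound
  that increases with the size of the argument.\<close>

definition clamp_fun :: "nat \<Rightarrow> (real \<Rightarrow> real) \<Rightarrow> real \<Rightarrow> real" where
  "clamp_fun n f t = f (max (- real n) (min (real n) t))"

lemma clamp_fun_eq: "\<bar>t\<bar> \<le> real n \<Longrightarrow> clamp_fun n f t = f t"
proof -
  assume "\<bar>t\<bar> \<le> real n"
  then have "max (- real n) (min (real n) t) = t" by linarith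
  then show ?thesis by (simp add: clamp_fun_def)
qed

lemma continuous_on_clamp_fun:
  "continuous_on UNIV f \<Longrightarrow> continuous_on UNIV (clamp_fun n f)"
  unfolding clamp_fun_def[abs_def]
  by (rule continuous_on_compose2[of UNIV f]) (auto intro!: continuous_intros)

text \<open>The bounded case applied to clamped functions, followed by dominated convergence. The
  gradient side is dominated through Cauchy-Schwarz, which is where the powers of \<open>u\<close>
  must be square integrable on the ball; the primitive side is dominated by the integrable powers
  \<open>q\<close> and \<open>s\<close> of \<open>u\<close>.\<close>

lemma weak_chain_rule_growth:
  fixes u :: "'a::euclidean_space \<Rightarrow> real"
  assumes wg: "has_weak_gradient u Du"
    and f: "continuous_on UNIV f" and exps: "q > 1" "s > 1" and c: "c \<ge> 0"
    and gr: "\<And>t. \<bar>f t\<bar> \<le> c * (\<bar>t\<bar> powr (q - 1) + \<bar>t\<bar> powr (s - 1))"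
    and uq: "integrable lebesgue (\<lambda>x. \<bar>u x\<bar> powr q)" and us: "integrable lebesgue (\<lambda>x. \<bar>u x\<bar> powr s)"
    and D2: "integrable lebesgue (\<lambda>x. (norm (Du x))\<^sup>2)"
    and H2: "integrable lebesgue (\<lambda>x. (indicator (cball 0 R) x * (\<bar>u x\<bar> powr (q - 1) + \<bar>u x\<bar> powr (s - 1)))\<^sup>2)"
    and \<beta>: "smooth_fun \<beta>" and \<beta>0: "\<And>x. x \<notin> cball 0 R \<Longrightarrow> \<beta> x = 0" and b: "b \<in> Basis"
  shows "integrable lebesgue (\<lambda>x. f (u x) * (Du x \<bullet> b) * \<beta> x)"
    and "(LINT x|lebesgue. f (u x) * (Du x \<bullet> b) * \<beta> x) = - (LINT x|lebesgue. primitive f (u x) * pd b \<beta> x)"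
proof -
  have [measurable]: "u \<in> borel_measurable lebesgue" "Du \<in> borel_measurable lebesgue"
    using wg by (auto simp: has_weak_gradient_def L1_loc_def)
  have fm[measurable]: "clamp_fun n f \<in> borel_measurable borel" "f \<in> borel_measurable borel" for n
    by (auto intro!: borel_measurable_continuous_onI continuous_on_clamp_fun f)
  have pm[measurable]: "primitive k \<in> borel_measurable borel" if "continuous_on UNIV k" for k
    by (rule borel_measurable_continuous_onI)
       (auto intro!: DERIV_continuous_on primitive_has_real_derivative that)
  note pm1 = pm[OF f] and pm2 = pm[OF continuous_on_clamp_fun[OF f]]
  note [measurable] = pm1 pm2
  have z: "\<beta> x = 0" "pd b \<beta> x = 0" if "norm x > R" for x
    using that \<beta>0[of x] pd_outside[of 0 R \<beta> x b] \<beta>0 by auto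
  have k\<beta>: "kernel R \<beta>" "kernel R (pd b \<beta>)"
    using z by (auto intro!: kernelI smooth_fun_continuous smooth_fun_pd \<beta>)
  obtain K1 where K1: "\<And>x. \<bar>\<beta> x\<bar> \<le> K1" using kernel_bounded[OF k\<beta>(1)] by blast
  obtain K2 where K2: "\<And>x. \<bar>pd b \<beta> x\<bar> \<le> K2" using kernel_bounded[OF k\<beta>(2)] by blast
  have K0: "K1 \<ge> 0" "K2 \<ge> 0" using K1[of 0] K2[of 0] by linarith+
  note [measurable] = kernel_measurable[OF k\<beta>(1)] kernel_measurable[OF k\<beta>(2)]
  have grn: "\<bar>clamp_fun n f t\<bar> \<le> c * (\<bar>t\<bar> powr (q - 1) + \<bar>t\<bar> powr (s - 1))" for n t
  proof -
    let ?t = "max (- real n) (min (real n) t)"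
    have "\<bar>?t\<bar> \<le> \<bar>t\<bar>" by auto
    then have "c * (\<bar>?t\<bar> powr (q - 1) + \<bar>?t\<bar> powr (s - 1)) \<le> c * (\<bar>t\<bar> powr (q - 1) + \<bar>t\<bar> powr (s - 1))"
      using exps c by (intro mult_left_mono add_mono powr_mono2) auto
    with gr[of ?t] show ?thesis by (simp add: clamp_fun_def)
  qed
  define H where "H x = indicator (cball 0 R) x * (\<bar>u x\<bar> powr (q - 1) + \<bar>u x\<bar> powr (s - 1))" for x
  have [measurable]: "H \<in> borel_measurable lebesgue" unfolding H_def by measurable
  have Db2: "integrable lebesgue (\<lambda>x. (Du x \<bullet> b)\<^sup>2)"
    by (rule integrable_inner_Basis_square[OF _ D2 b]) measurable
  have "integrable lebesgue (\<lambda>x. H x * (Du x \<bullet> b))"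
    by (rule cauchy_schwarz_integral(1)) (use H2 Db2 in \<open>auto simp: H_def[symmetric]\<close>)
  then have wi: "integrable lebesgue (\<lambda>x. c * K1 * \<bar>H x * (Du x \<bullet> b)\<bar>)" by auto
  have dom: "\<bar>k (u x) * (Du x \<bullet> b) * \<beta> x\<bar> \<le> c * K1 * \<bar>H x * (Du x \<bullet> b)\<bar>"
    if k: "\<And>t. \<bar>k t\<bar> \<le> c * (\<bar>t\<bar> powr (q - 1) + \<bar>t\<bar> powr (s - 1))" for k and x
  proof (cases "norm x \<le> R")
    case True
    have "\<bar>k (u x)\<bar> * \<bar>\<beta> x\<bar> * \<bar>Du x \<bullet> b\<bar> \<le> c * (\<bar>u x\<bar> powr (q - 1) + \<bar>u x\<bar> powr (s - 1)) * K1 * \<bar>Du x \<bullet> b\<bar>"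
      using c by (intro mult_right_mono mult_mono k K1) auto
    moreover have "\<bar>H x\<bar> = \<bar>u x\<bar> powr (q - 1) + \<bar>u x\<bar> powr (s - 1)" using True by (simp add: H_def)
    ultimately show ?thesis by (simp add: abs_mult mult_ac)
  next
    case False
    then show ?thesis using c K0 by (simp add: z)
  qed
  show "integrable lebesgue (\<lambda>x. f (u x) * (Du x \<bullet> b) * \<beta> x)"
  proof (rule Bochner_Integration.integrable_bound[OF wi])
    show "AE x in lebesgue. norm (f (u x) * (Du x \<bullet> b) * \<beta> x) \<le> norm (c * K1 * \<bar>H x * (Du x \<bullet> b)\<bar>)"
      using order_trans[OF dom[of f, OF gr] abs_ge_self] by (intro AE_I2) simp
  qed measurable
  have lim1: "(\<lambda>n. LINT x|lebesgue. clamp_fun n f (u x) * (Du x \<bullet> b) * \<beta> x) \<longlonglongrightarrow> (LINT x|lebesgue. f (u x) * (Du x \<bullet> b) * \<beta> x)"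
  proof (rule integral_dominated_convergence[OF _ _ wi])
    show "AE x in lebesgue. (\<lambda>n. clamp_fun n f (u x) * (Du x \<bullet> b) * \<beta> x) \<longlonglongrightarrow> f (u x) * (Du x \<bullet> b) * \<beta> x"
    proof (rule AE_I2)
      fix x
      have "eventually (\<lambda>n. f (u x) = clamp_fun n f (u x)) sequentially"
        using eventually_ge_at_top[of "nat \<lceil>\<bar>u x\<bar>\<rceil>"]
      proof eventually_elim
        case (elim n)
        then have "\<bar>u x\<bar> \<le> real n" by linarith
        then show ?case by (simp add: clamp_fun_eq)
      qed
      then have "(\<lambda>n. clamp_fun n f (u x)) \<longlonglongrightarrow> f (u x)" by (rule Lim_transform_eventually[OF tendsto_const])
      then show "(\<lambda>n. clamp_fun n f (u x) * (Du x \<bullet> b) * \<beta> x) \<longlonglongrightarrow> f (u x) * (Du x \<bullet> b) * \<beta> x"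
        by (intro tendsto_intros)
    qed
    show "AE x in lebesgue. norm (clamp_fun n f (u x) * (Du x \<bullet> b) * \<beta> x) \<le> c * K1 * \<bar>H x * (Du x \<bullet> b)\<bar>" for n
      using dom[OF grn] by (intro AE_I2) simp
  qed measurable
  have lim2: "(\<lambda>n. LINT x|lebesgue. primitive (clamp_fun n f) (u x) * pd b \<beta> x) \<longlonglongrightarrow> (LINT x|lebesgue. primitive f (u x) * pd b \<beta> x)"
  proof (rule integral_dominated_convergence[where w = "\<lambda>x. c * (\<bar>u x\<bar> powr q + \<bar>u x\<bar> powr s) * K2"])
    show "AE x in lebesgue. (\<lambda>n. primitive (clamp_fun n f) (u x) * pd b \<beta> x) \<longlonglongrightarrow> primitive f (u x) * pd b \<beta> x"
    proof (rule AE_I2)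
      fix x
      have "eventually (\<lambda>n. primitive f (u x) = primitive (clamp_fun n f) (u x)) sequentially"
        using eventually_ge_at_top[of "nat \<lceil>\<bar>u x\<bar>\<rceil>"]
      proof eventually_elim
        case (elim n)
        then have "\<bar>u x\<bar> \<le> real n" by linarith
        then show ?case by (intro primitive_cong) (simp add: clamp_fun_eq)
      qed
      then have "(\<lambda>n. primitive (clamp_fun n f) (u x)) \<longlonglongrightarrow> primitive f (u x)" by (rule Lim_transform_eventually[OF tendsto_const])
      then show "(\<lambda>n. primitive (clamp_fun n f) (u x) * pd b \<beta> x) \<longlonglongrightarrow> primitive f (u x) * pd b \<beta> x"
        by (intro tendsto_intros)
    qed
    show "integrable lebesgue (\<lambda>x. c * (\<bar>u x\<bar> powr q + \<bar>u x\<bar> powr s) * K2)" using uq us by auto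
    show "AE x in lebesgue. norm (primitive (clamp_fun n f) (u x) * pd b \<beta> x) \<le> c * (\<bar>u x\<bar> powr q + \<bar>u x\<bar> powr s) * K2" for n
    proof (rule AE_I2)
      fix x
      have "\<bar>primitive (clamp_fun n f) (u x)\<bar> \<le> c * (\<bar>u x\<bar> powr (q - 1 + 1) + \<bar>u x\<bar> powr (s - 1 + 1))"
        by (rule primitive_growth[OF continuous_on_clamp_fun[OF f] _ _ c grn]) (use exps in auto)
      then show "norm (primitive (clamp_fun n f) (u x) * pd b \<beta> x) \<le> c * (\<bar>u x\<bar> powr q + \<bar>u x\<bar> powr s) * K2"
        unfolding real_norm_def abs_mult by (intro mult_mono K2) (use c in auto)
    qed
  qed measurable
  have "(LINT x|lebesgue. clamp_fun n f (u x) * (Du x \<bullet> b) * \<beta> x) = - (LINT x|lebesgue. primitive (clamp_fun n f) (u x) * pd b \<beta> x)" for n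
  proof (rule weak_chain_rule[OF wg continuous_on_clamp_fun[OF f] _ _ \<beta> \<beta>0 b])
    show "\<bar>clamp_fun n f t\<bar> \<le> c * (real n powr (q - 1) + real n powr (s - 1))" for t
    proof -
      let ?t = "max (- real n) (min (real n) t)"
      have "\<bar>?t\<bar> \<le> real n" by auto
      then have "c * (\<bar>?t\<bar> powr (q - 1) + \<bar>?t\<bar> powr (s - 1)) \<le> c * (real n powr (q - 1) + real n powr (s - 1))"
        using exps c by (intro mult_left_mono add_mono powr_mono2) auto
      with gr[of ?t] show ?thesis by (simp add: clamp_fun_def)
    qed
    show "(primitive (clamp_fun n f) has_real_derivative clamp_fun n f t) (at t)" for t
      by (rule primitive_has_real_derivative[OF continuous_on_clamp_fun[OF f]])
  qed
  then show "(LINT x|lebesgue. f (u x) * (Du x \<bullet> b) * \<beta> x) = - (LINT x|lebesgue. primitive f (u x) * pd b \<beta> x)"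
    using lim1 tendsto_minus[OF lim2] LIMSEQ_unique by auto
qed

section \<open>Assembly for the nonlinear equation and removal of the cutoff\<close>

lemma powr_le_one_plus_powr:
  fixes t a b :: real
  assumes "t \<ge> 0" "0 \<le> a" "a \<le> b"
  shows "t powr a \<le> 1 + t powr b"
proof (cases "t \<le> 1")
  case True
  have "t powr a \<le> 1 powr a" using True assms by (intro powr_mono2) auto
  also have "\<dots> \<le> 1 + t powr b" by simp
  finally show ?thesis .
next
  case False
  then have "t powr a \<le> t powr b" using assms by (intro powr_mono) auto
  then show ?thesis by simp
qed

text \<open>The equation is tested with arbitrary members of \<open>Cc_infinity\<close>, and its two
  lower order integrals can be merged only when both are finite.\<close>

lemma Cc_infinity_times_integrable:
  fixes v w :: "'a::euclidean_space \<Rightarrow> real"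
  assumes w: "w \<in> L1_loc" and v: "v \<in> Cc_infinity"
  shows "integrable lebesgue (\<lambda>x. w x * v x)"
proof -
  have "Ck 0 v" using v unfolding Cc_infinity_def by blast
  then have cv: "continuous_on UNIV v" by simp
  have K: "compact (closure {x. v x \<noteq> 0})" using v by (simp add: Cc_infinity_def)
  then obtain r where "\<And>x. x \<in> closure {x. v x \<noteq> 0} \<Longrightarrow> norm x \<le> r"
    using compact_imp_bounded[OF K] unfolding bounded_iff by blast
  then have r: "closure {x. v x \<noteq> 0} \<subseteq> cball 0 r" by auto
  have out: "v x = 0" if "x \<notin> cball 0 r" for x
    using that r closure_subset[of "{x. v x \<noteq> 0}"] by blast
  then have "kernel r v" by (intro kernelI cv) auto
  then obtain B where "\<forall>x. \<bar>v x\<bar> \<le> B" using kernel_bounded by blast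
  then show ?thesis
    using out by (intro integrable_L1_loc_times[OF w continuous_lebesgue_measurable[OF cv], of B 0 r]) auto
qed

text \<open>The local identity for \<open>g = f(u) - V u\<close>, with the chain rule applied to its
  \<open>f(u)\<close> part, holds for a dilated cutoff; each of the three integrals converges
  because its integrand is integrable on the whole space. Integrability of \<open>F(u)\<close>
  belongs to the conclusion, since otherwise its integral could be the default value
  \<open>0\<close>.\<close>

lemma pohozaev_identity:
  fixes f :: "real \<Rightarrow> real" and V u :: "'a::euclidean_space \<Rightarrow> real" and Du :: "'a \<Rightarrow> 'a" and s q c :: real
  assumes dim: "DIM('a) \<ge> 3" and s: "1 < s" "s \<le> 2"
    and q: "2 < q" "q < 2 * real DIM('a) / (real DIM('a) - 2)"
    and f: "continuous_on UNIV f" and c: "c > 0"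
    and gr: "\<And>t. \<bar>f t\<bar> \<le> c * (\<bar>t\<bar> powr (q - 1) + \<bar>t\<bar> powr (s - 1))"
    and V: "V \<in> Linf_loc" and u: "u \<in> H1 \<inter> Lp s" and sol: "weak_solution V f u Du"
    and int: "integrable lebesgue (\<lambda>x. V x * norm x * \<bar>u x\<bar> * norm (Du x))"
  shows "integrable lebesgue (\<lambda>x. primitive f (u x))"
    and "(real DIM('a) - 2) / 2 * (LINT x|lebesgue. (norm (Du x))\<^sup>2)
      - real DIM('a) * (LINT x|lebesgue. primitive f (u x))
      - (LINT x|lebesgue. V x * u x * (x \<bullet> Du x)) = 0"
proof -
  define N where "N = real DIM('a)"
  have N: "N \<ge> 3" using dim by (simp add: N_def)
  have qN: "q * (N - 2) < 2 * N" using q N by (simp add: N_def field_simps)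
  have wg: "has_weak_gradient u Du" using sol by (simp add: weak_solution_def)
  have uL: "u \<in> L1_loc" and DL: "Du \<in> L1_loc" using wg by (auto simp: has_weak_gradient_def)
  have [measurable]: "u \<in> borel_measurable lebesgue" "Du \<in> borel_measurable lebesgue" "V \<in> borel_measurable lebesgue"
    using uL DL V by (auto simp: L1_loc_def Linf_loc_def)
  have [measurable]: "f \<in> borel_measurable borel" by (rule borel_measurable_continuous_onI[OF f])
  \<comment> \<open>A square integrable weak gradient from \<open>H1\<close>; it is identified with
    \<open>Du\<close> almost everywhere in \<open>D2\<close>.\<close>
  obtain E where E: "E \<in> Lp 2" "has_weak_gradient u E" using u by (auto simp: H1_def)
  have [measurable]: "E \<in> borel_measurable lebesgue" using E by (simp add: Lp_def)
  have u2: "u \<in> Lp 2" using u by (simp add: H1_def)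
  have us: "integrable lebesgue (\<lambda>x. \<bar>u x\<bar> powr s)" using u by (simp add: Lp_def)
  have uq: "integrable lebesgue (\<lambda>x. \<bar>u x\<bar> powr q)"
  proof (rule subcritical_embedding[OF E(2) u2 E(1)])
    show "0 < q + DIM('a) * (1 - q / 2)" using qN by (simp add: N_def algebra_simps)
  qed (use q in simp)
  have D2: "integrable lebesgue (\<lambda>x. (norm (Du x))\<^sup>2)"
  proof -
    have ae: "AE x in lebesgue. (norm (E x))\<^sup>2 = (norm (Du x))\<^sup>2"
      using weak_gradient_unique[OF E(2) wg] by eventually_elim simp
    have "integrable lebesgue (\<lambda>x. (norm (E x))\<^sup>2)" using E(1) by (simp add: Lp_def)
    then show ?thesis by (subst (asm) integrable_cong_AE[OF _ _ ae]) auto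
  qed
  have fuL: "(\<lambda>x. f (u x)) \<in> L1_loc"
    unfolding L1_loc_def
  proof (intro CollectI conjI allI impI)
    fix K :: "'a set" assume K: "compact K"
    have Km: "K \<in> lmeasurable" by (rule lmeasurable_compact[OF K])
    then have [measurable]: "K \<in> sets lebesgue" by (rule fmeasurableD)
    show "set_integrable lebesgue K (\<lambda>x. f (u x))"
      unfolding set_integrable_def
    proof (rule Bochner_Integration.integrable_bound)
      have "integrable lebesgue (indicator K :: 'a \<Rightarrow> real)" using Km lmeasurable_iff_integrable by blast
      then show "integrable lebesgue (\<lambda>x. c * (2 * indicator K x + \<bar>u x\<bar> powr q + \<bar>u x\<bar> powr s))" using uq us by auto
      show "AE x in lebesgue. norm (indicator K x *\<^sub>R f (u x)) \<le> norm (c * (2 * indicator K x + \<bar>u x\<bar> powr q + \<bar>u x\<bar> powr s))"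
      proof (rule AE_I2)
        fix x
        have "\<bar>u x\<bar> powr (q - 1) \<le> 1 + \<bar>u x\<bar> powr q" "\<bar>u x\<bar> powr (s - 1) \<le> 1 + \<bar>u x\<bar> powr s"
          using q s by (auto intro!: powr_le_one_plus_powr)
        then have "c * (\<bar>u x\<bar> powr (q - 1) + \<bar>u x\<bar> powr (s - 1)) \<le> c * (2 + \<bar>u x\<bar> powr q + \<bar>u x\<bar> powr s)"
          using c by (intro mult_left_mono) auto
        then have "\<bar>f (u x)\<bar> \<le> c * (2 + \<bar>u x\<bar> powr q + \<bar>u x\<bar> powr s)" using gr[of "u x"] by linarith
        then show "norm (indicator K x *\<^sub>R f (u x)) \<le> norm (c * (2 * indicator K x + \<bar>u x\<bar> powr q + \<bar>u x\<bar> powr s))"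
          using c by (cases "x \<in> K") auto
      qed
    qed measurable
  qed measurable
  have VuL: "(\<lambda>x. V x * u x) \<in> L1_loc"
    unfolding L1_loc_def
  proof (intro CollectI conjI allI impI)
    fix K :: "'a set" assume K: "compact K"
    have [measurable]: "K \<in> sets lebesgue" by (rule fmeasurableD[OF lmeasurable_compact[OF K]])
    obtain C where C: "AE x in lebesgue. x \<in> K \<longrightarrow> \<bar>V x\<bar> \<le> C" using V K by (auto simp: Linf_loc_def)
    show "set_integrable lebesgue K (\<lambda>x. V x * u x)"
      unfolding set_integrable_def
    proof (rule Bochner_Integration.integrable_bound)
      show "integrable lebesgue (\<lambda>x. C * (indicator K x *\<^sub>R u x))"
        using uL K by (intro integrable_mult_right) (auto simp: L1_loc_def set_integrable_def)
      show "AE x in lebesgue. norm (indicator K x *\<^sub>R (V x * u x)) \<le> norm (C * (indicator K x *\<^sub>R u x))"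
        using C
      proof eventually_elim
        case (elim x)
        then show ?case by (cases "x \<in> K") (auto simp: abs_mult intro!: mult_right_mono)
      qed
    qed measurable
  qed measurable
  \<comment> \<open>From here on the equation is linear with a given right-hand side, which is what
    allows it to be mollified.\<close>
  define g where "g x = f (u x) - V x * u x" for x
  have g: "g \<in> L1_loc" unfolding g_def by (rule L1_loc_diff[OF fuL VuL])
  have [measurable]: "g \<in> borel_measurable lebesgue" using g by (simp add: L1_loc_def)
  have eq: "(LINT x|lebesgue. Du x \<bullet> grad v x) = (LINT x|lebesgue. g x * v x)" if v: "v \<in> Cc_infinity" for v
  proof -
    have "(LINT x|lebesgue. Du x \<bullet> grad v x) + (LINT x|lebesgue. V x * u x * v x) = (LINT x|lebesgue. f (u x) * v x)"
      using sol v by (simp add: weak_solution_def)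
    moreover have "(LINT x|lebesgue. g x * v x) = (LINT x|lebesgue. f (u x) * v x) - (LINT x|lebesgue. V x * u x * v x)"
      unfolding g_def left_diff_distrib
      by (rule Bochner_Integration.integral_diff) (intro Cc_infinity_times_integrable[OF _ v] fuL VuL)+
    ultimately show ?thesis by simp
  qed
  \<comment> \<open>As \<open>s - 1 \<le> 1 < q - 1\<close>, the lower power of the growth bound and
    the linear term \<open>V u\<close> are both absorbed locally by
    \<open>1 + \<bar>u\<bar> powr (q - 1)\<close>.\<close>
  have basic: "\<bar>t\<bar> powr (s - 1) \<le> 1 + \<bar>t\<bar> powr (q - 1)" "\<bar>t\<bar> \<le> 1 + \<bar>t\<bar> powr (q - 1)" for t
    using powr_le_one_plus_powr[of "\<bar>t\<bar>" "s - 1" "q - 1"] powr_le_one_plus_powr[of "\<bar>t\<bar>" 1 "q - 1"] q s by auto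
  have growth: "\<exists>K\<ge>0. AE x in lebesgue. x \<in> cball 0 R \<longrightarrow> \<bar>g x\<bar> \<le> K * (1 + \<bar>u x\<bar> powr (q - 1))" for R
  proof -
    obtain C where C: "AE x in lebesgue. x \<in> cball 0 R \<longrightarrow> \<bar>V x\<bar> \<le> C"
      using V compact_cball[of "0::'a" R] unfolding Linf_loc_def by blast
    have "AE x in lebesgue. x \<in> cball 0 R \<longrightarrow> \<bar>g x\<bar> \<le> (2 * c + \<bar>C\<bar>) * (1 + \<bar>u x\<bar> powr (q - 1))"
      using C
    proof eventually_elim
      case (elim x)
      show ?case
      proof
        assume "x \<in> cball 0 R"
        with elim have "\<bar>V x\<bar> \<le> \<bar>C\<bar>" by auto
        then have "\<bar>V x\<bar> * \<bar>u x\<bar> \<le> \<bar>C\<bar> * (1 + \<bar>u x\<bar> powr (q - 1))" using basic(2)[of "u x"] by (intro mult_mono) auto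
        moreover have "c * (\<bar>u x\<bar> powr (q - 1) + \<bar>u x\<bar> powr (s - 1)) \<le> c * (2 * (1 + \<bar>u x\<bar> powr (q - 1)))"
          using basic(1)[of "u x"] c by (intro mult_left_mono) auto
        moreover have "\<bar>g x\<bar> \<le> \<bar>f (u x)\<bar> + \<bar>V x\<bar> * \<bar>u x\<bar>" unfolding g_def by (simp flip: abs_mult)
        ultimately show "\<bar>g x\<bar> \<le> (2 * c + \<bar>C\<bar>) * (1 + \<bar>u x\<bar> powr (q - 1))"
          using gr[of "u x"] by (simp add: algebra_simps)
      qed
    qed
    then show ?thesis using c by (intro exI[of _ "2 * c + \<bar>C\<bar>"]) auto
  qed
  \<comment> \<open>Subcriticality in the form used by \<open>bootstrap\<close>:
    \<open>N (q - 2) < 2 q\<close> is the same as \<open>q (N - 2) < 2 N\<close>.\<close>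
  have sub: "(q - 2) / q < 2 / DIM('a)" using qN q N by (simp add: N_def field_simps)
  have L2: "integrable lebesgue (\<lambda>x. (indicator (cball 0 R) x * (1 + \<bar>u x\<bar> powr (q - 1)))\<^sup>2)" if R: "R > 0" for R
  proof (rule Bochner_Integration.integrable_bound)
    have "integrable lebesgue (indicator (cball (0::'a) R) :: 'a \<Rightarrow> real)"
      by (rule integrable_indicator_cball)
    then show "integrable lebesgue (\<lambda>x. 2 * (indicator (cball 0 R) x + (indicator (cball 0 R) x * \<bar>u x\<bar>) powr (2 * (q - 1))))"
      using bootstrap[OF wg g eq q(1) sub uq growth R] by auto
    have "(1 + \<bar>t\<bar> powr (q - 1))\<^sup>2 \<le> 2 * (1 + \<bar>t\<bar> powr (2 * (q - 1)))" for t :: real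
    proof -
      have "(\<bar>t\<bar> powr (q - 1))\<^sup>2 = \<bar>t\<bar> powr (2 * (q - 1))"
        by (simp add: power2_eq_square flip: powr_add)
      then show ?thesis using zero_le_power2[of "1 - \<bar>t\<bar> powr (q - 1)"] by (simp add: power2_sum power2_diff)
    qed
    then show "AE x in lebesgue. norm ((indicator (cball 0 R) x * (1 + \<bar>u x\<bar> powr (q - 1)))\<^sup>2) \<le>
        norm (2 * (indicator (cball 0 R) x + (indicator (cball 0 R) x * \<bar>u x\<bar>) powr (2 * (q - 1))))"
      by (intro AE_I2) (auto simp: indicator_def)
  qed measurable
  have g2: "integrable lebesgue (\<lambda>x. (indicator (cball 0 R) x * g x)\<^sup>2)" if R: "R > 0" for R
  proof -
    obtain K where K: "K \<ge> 0" "AE x in lebesgue. x \<in> cball 0 R \<longrightarrow> \<bar>g x\<bar> \<le> K * (1 + \<bar>u x\<bar> powr (q - 1))"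
      using growth by blast
    show ?thesis
    proof (rule Bochner_Integration.integrable_bound)
      show "integrable lebesgue (\<lambda>x. K\<^sup>2 * (indicator (cball 0 R) x * (1 + \<bar>u x\<bar> powr (q - 1)))\<^sup>2)"
        by (intro integrable_mult_right L2 R)
      show "AE x in lebesgue. norm ((indicator (cball 0 R) x * g x)\<^sup>2) \<le> norm (K\<^sup>2 * (indicator (cball 0 R) x * (1 + \<bar>u x\<bar> powr (q - 1)))\<^sup>2)"
        using K(2)
      proof eventually_elim
        case (elim x)
        show ?case
        proof (cases "x \<in> cball 0 R")
          case True
          with elim have "\<bar>g x\<bar>\<^sup>2 \<le> (K * (1 + \<bar>u x\<bar> powr (q - 1)))\<^sup>2" by (intro power_mono) auto
          then show ?thesis using True by (simp add: power_mult_distrib)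
        qed simp
      qed
    qed measurable
  qed
  have H2: "integrable lebesgue (\<lambda>x. (indicator (cball 0 R) x * (\<bar>u x\<bar> powr (q - 1) + \<bar>u x\<bar> powr (s - 1)))\<^sup>2)" if R: "R > 0" for R
  proof (rule Bochner_Integration.integrable_bound)
    show "integrable lebesgue (\<lambda>x. 4 * (indicator (cball 0 R) x * (1 + \<bar>u x\<bar> powr (q - 1)))\<^sup>2)"
      by (intro integrable_mult_right L2 R)
    have "(\<bar>t\<bar> powr (q - 1) + \<bar>t\<bar> powr (s - 1))\<^sup>2 \<le> 4 * (1 + \<bar>t\<bar> powr (q - 1))\<^sup>2" for t
    proof -
      have "(\<bar>t\<bar> powr (q - 1) + \<bar>t\<bar> powr (s - 1))\<^sup>2 \<le> (2 * (1 + \<bar>t\<bar> powr (q - 1)))\<^sup>2"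
        using basic(1)[of t] by (intro power_mono) auto
      also have "\<dots> = 2\<^sup>2 * (1 + \<bar>t\<bar> powr (q - 1))\<^sup>2" by (rule power_mult_distrib)
      finally show ?thesis by simp
    qed
    then show "AE x in lebesgue. norm ((indicator (cball 0 R) x * (\<bar>u x\<bar> powr (q - 1) + \<bar>u x\<bar> powr (s - 1)))\<^sup>2) \<le>
        norm (4 * (indicator (cball 0 R) x * (1 + \<bar>u x\<bar> powr (q - 1)))\<^sup>2)"
      by (intro AE_I2) (simp add: indicator_def)
  qed measurable
  have pm: "primitive f \<in> borel_measurable borel"
    by (rule borel_measurable_continuous_onI)
       (auto intro!: DERIV_continuous_on primitive_has_real_derivative f)
  note [measurable] = pm
  show Fi: "integrable lebesgue (\<lambda>x. primitive f (u x))"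
  proof (rule Bochner_Integration.integrable_bound)
    show "integrable lebesgue (\<lambda>x. c * (\<bar>u x\<bar> powr q + \<bar>u x\<bar> powr s))" using uq us by auto
    have "\<bar>primitive f t\<bar> \<le> c * (\<bar>t\<bar> powr q + \<bar>t\<bar> powr s)" for t
      using primitive_growth[OF f _ _ _ gr, of t] q s c by simp
    then show "AE x in lebesgue. norm (primitive f (u x)) \<le> norm (c * (\<bar>u x\<bar> powr q + \<bar>u x\<bar> powr s))"
      using c by (intro AE_I2) simp
  qed measurable
  define T where "T x = V x * u x * (x \<bullet> Du x)" for x
  have idm[measurable]: "(\<lambda>x::'a. x) \<in> borel_measurable lebesgue" by (rule measurable_completion) simp
  have [measurable]: "T \<in> borel_measurable lebesgue" unfolding T_def by measurable
  have Ti: "integrable lebesgue T"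
  proof (rule Bochner_Integration.integrable_bound[OF int])
    show "AE x in lebesgue. norm (T x) \<le> norm (V x * norm x * \<bar>u x\<bar> * norm (Du x))"
    proof (rule AE_I2)
      fix x
      have "\<bar>V x\<bar> * \<bar>u x\<bar> * \<bar>x \<bullet> Du x\<bar> \<le> \<bar>V x\<bar> * \<bar>u x\<bar> * (norm x * norm (Du x))"
        by (intro mult_left_mono Cauchy_Schwarz_ineq2) auto
      then show "norm (T x) \<le> norm (V x * norm x * \<bar>u x\<bar> * norm (Du x))"
        by (simp add: T_def abs_mult mult_ac)
    qed
  qed measurable
  obtain B1 where B1: "B1 > 0" "\<And>t z. t > 0 \<Longrightarrow> \<bar>bump 1 t (z::'a)\<bar> \<le> B1" using bump_bounded by blast
  obtain B2 where B2: "B2 > 0" "\<And>t z. t > 0 \<Longrightarrow> \<bar>bump (flat_deriv 1) t (z::'a)\<bar> \<le> B2" using bump_bounded by blast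
  define R where "R n = real (Suc n)" for n
  have R: "R n > 0" for n by (simp add: R_def)
  \<comment> \<open>The profile has the value \<open>exp (- 1)\<close> at the centre, so the factor
    \<open>exp 1\<close> makes these cutoffs tend to \<open>1\<close>. The function
    \<open>\<kappa>\<close> is the scalar factor in the radial gradient of
    \<open>\<phi>\<close>.\<close>
  define \<phi> where "\<phi> n x = exp 1 * bump 1 (R n) x" for n and x :: 'a
  define \<kappa> where "\<kappa> n x = exp 1 * (- 2 / (R n)\<^sup>2 * bump (flat_deriv 1) (R n) x)" for n and x :: 'a
  have \<phi>: "smooth_fun (\<phi> n)" for n
    unfolding \<phi>_def[abs_def] by (intro smooth_fun.mult smooth_fun.const smooth_fun_bump)
  have \<phi>0: "\<phi> n x = 0" if "x \<notin> cball 0 (R n)" for n x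
    unfolding \<phi>_def using that R[of n] by (simp add: bump_eq_0)
  have \<kappa>0: "\<kappa> n x = 0" if "norm x \<ge> R n" for n x
    unfolding \<kappa>_def using that R[of n] by (simp add: bump_eq_0)
  have grad\<phi>: "grad (\<phi> n) x = \<kappa> n x *\<^sub>R x" for n x
  proof (rule grad_eq)
    have "GDERIV (\<lambda>x. exp 1 * bump 1 (R n) (x - 0)) x :> exp 1 *\<^sub>R ((- 2 / (R n)\<^sup>2 * bump (flat_deriv 1) (R n) (x - 0)) *\<^sub>R (x - 0)) + bump 1 (R n) (x - 0) *\<^sub>R 0"
      by (rule GDERIV_mult[OF GDERIV_const bump_GDERIV])
    then show "GDERIV (\<phi> n) x :> \<kappa> n x *\<^sub>R x" by (simp add: \<phi>_def[abs_def] \<kappa>_def)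
  qed
  define C where "C = exp 1 * (B1 + 2 * B2)"
  have C0: "C \<ge> 0" unfolding C_def using B1 B2 by simp
  have \<phi>C: "\<bar>\<phi> n x\<bar> \<le> C" for n x
  proof -
    have "exp 1 * \<bar>bump 1 (R n) x\<bar> \<le> exp 1 * (B1 + 2 * B2)"
      using B1(2)[OF R, of n x] B2(1) by (intro mult_left_mono) auto
    then show ?thesis by (simp add: \<phi>_def C_def abs_mult)
  qed
  have \<kappa>b: "\<bar>\<kappa> n x\<bar> \<le> C / (R n)\<^sup>2" for n x
  proof -
    have "exp 1 * (2 / (R n)\<^sup>2 * \<bar>bump (flat_deriv 1) (R n) x\<bar>) \<le> exp 1 * (2 / (R n)\<^sup>2 * B2)"
      using B2(2)[OF R, of n x] R[of n] by (intro mult_left_mono) auto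
    also have "\<dots> \<le> C / (R n)\<^sup>2" using R[of n] B1 by (simp add: C_def field_simps)
    finally show ?thesis by (simp add: \<kappa>_def abs_mult)
  qed
  \<comment> \<open>The gradient factor has size \<open>1 / (R n)\<^sup>2\<close> and lives where
    \<open>norm x\<close> is below \<open>R n\<close>, so
    \<open>x \<bullet> grad (\<phi> n) x\<close> is bounded independently of \<open>n\<close>. This
    makes dominated convergence possible without decay of \<open>u\<close>.\<close>
  have \<kappa>C: "\<bar>\<kappa> n x\<bar> * (norm x)\<^sup>2 \<le> C" for n x
  proof (cases "norm x \<ge> R n")
    case True then show ?thesis using \<kappa>0 C0 by simp
  next
    case False
    then have "(norm x)\<^sup>2 \<le> (R n)\<^sup>2" by (intro power_mono) auto
    then have "\<bar>\<kappa> n x\<bar> * (norm x)\<^sup>2 \<le> C / (R n)\<^sup>2 * (R n)\<^sup>2"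
      using C0 by (intro mult_mono \<kappa>b) auto
    then show ?thesis using R[of n] by simp
  qed
  have Rlim: "(\<lambda>n. C / (R n)\<^sup>2) \<longlonglongrightarrow> 0" for C
  proof -
    have "(\<lambda>n. C * (inverse (real (Suc n)))\<^sup>2) \<longlonglongrightarrow> C * 0\<^sup>2"
      by (intro tendsto_intros LIMSEQ_inverse_real_of_nat)
    then show ?thesis by (simp add: R_def divide_inverse power_inverse)
  qed
  have \<kappa>lim: "(\<lambda>n. \<kappa> n x) \<longlonglongrightarrow> 0" for x
    by (rule Lim_null_comparison[OF _ Rlim[of C]]) (use \<kappa>b in auto)
  have \<phi>lim: "(\<lambda>n. \<phi> n x) \<longlonglongrightarrow> 1" for x
  proof -
    have cont: "isCont (flat 1) 1" by (rule DERIV_isCont[OF flat_has_real_derivative])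
    have "(\<lambda>n. 1 - (x \<bullet> x) / (R n)\<^sup>2) \<longlonglongrightarrow> 1 - 0" by (intro tendsto_diff tendsto_const Rlim)
    then have "(\<lambda>n. 1 - (x \<bullet> x) / (R n)\<^sup>2) \<longlonglongrightarrow> 1" by simp
    from isCont_tendsto_compose[OF cont this]
    have "(\<lambda>n. flat 1 (1 - (x \<bullet> x) / (R n)\<^sup>2)) \<longlonglongrightarrow> flat 1 1" .
    then have "(\<lambda>n. \<phi> n x) \<longlonglongrightarrow> exp 1 * flat 1 1"
      unfolding \<phi>_def bump_def by (intro tendsto_intros)
    then show ?thesis by (simp add: flat_pos flip: exp_add)
  qed
  have \<phi>m[measurable]: "\<phi> n \<in> borel_measurable lebesgue" for n
    by (rule continuous_lebesgue_measurable[OF smooth_fun_continuous[OF \<phi>]])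
  have \<kappa>m[measurable]: "\<kappa> n \<in> borel_measurable lebesgue" for n
    unfolding \<kappa>_def[abs_def] by (intro continuous_lebesgue_measurable continuous_intros)
  define L where "L n x = ((N / 2 - 1) * \<phi> n x + \<kappa> n x * (norm x)\<^sup>2 / 2) * (norm (Du x))\<^sup>2 - \<kappa> n x * (x \<bullet> Du x)\<^sup>2" for n x
  have ident: "(LINT x|lebesgue. L n x)
      = (LINT x|lebesgue. (N * \<phi> n x + \<kappa> n x * (norm x)\<^sup>2) * primitive f (u x)) + (LINT x|lebesgue. \<phi> n x * T x)" for n
  proof -
    \<comment> \<open>The components of the field \<open>\<phi> x\<close>. Summing the chain rule
      over them turns the integral of \<open>\<phi> f(u) (x \<bullet> Du)\<close> into minus the
      integral of \<open>F(u)\<close> times the divergence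
      \<open>N \<phi> + \<kappa> (norm x)\<^sup>2\<close>.\<close>
    define \<beta> where "\<beta> b x = \<phi> n x * (x \<bullet> b)" for b x
    have \<beta>s: "smooth_fun (\<beta> b)" for b unfolding \<beta>_def[abs_def] by (intro smooth_fun.mult \<phi> smooth_fun.coord)
    have \<beta>0: "\<beta> b x = 0" if "x \<notin> cball 0 (R n)" for b x using \<phi>0[OF that] by (simp add: \<beta>_def)
    note chain = weak_chain_rule_growth[OF wg f _ s(1) less_imp_le[OF c] gr uq us D2 H2[OF R] \<beta>s \<beta>0]
    have fi: "integrable lebesgue (\<lambda>x. f (u x) * (Du x \<bullet> b) * \<beta> b x)" if "b \<in> Basis" for b
      using q that by (intro chain(1)) auto
    have fe: "(LINT x|lebesgue. f (u x) * (Du x \<bullet> b) * \<beta> b x) = - (LINT x|lebesgue. primitive f (u x) * pd b (\<beta> b) x)" if "b \<in> Basis" for b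
      using q that by (intro chain(2)) auto
    have pd\<beta>: "pd b (\<beta> b) x = \<phi> n x + \<kappa> n x * ((x \<bullet> b) * (x \<bullet> b))" if b: "b \<in> Basis" for b x
    proof -
      have "pd b (\<lambda>y. y \<bullet> b) x = 1" using pd_coord[of b 0 b] b by (simp add: inner_same_Basis)
      then show ?thesis unfolding \<beta>_def[abs_def] pd_mult[OF \<phi> smooth_fun.coord]
        by (simp add: pd_def[of _ "\<phi> n"] grad\<phi>)
    qed
    have iF: "integrable lebesgue (\<lambda>x. primitive f (u x) * pd b (\<beta> b) x)" if b: "b \<in> Basis" for b
    proof -
      obtain B where B: "\<And>x. \<bar>pd b (\<beta> b) x\<bar> \<le> B"
      proof -
        have "pd b (\<beta> b) y = 0" if "y \<notin> cball 0 (R n)" for y using \<beta>0 that by (rule pd_outside)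
        from smooth_fun_bounded[OF smooth_fun_pd[OF \<beta>s] this] show ?thesis using that by blast
      qed
      have "integrable lebesgue (\<lambda>x. pd b (\<beta> b) x * primitive f (u x))"
        by (rule integrable_bounded_times[OF Fi _ B])
           (intro continuous_lebesgue_measurable smooth_fun_continuous smooth_fun_pd \<beta>s)
      then show ?thesis by (simp add: mult.commute)
    qed
    have i\<phi>T: "integrable lebesgue (\<lambda>x. \<phi> n x * T x)" by (rule integrable_bounded_times[OF Ti \<phi>m \<phi>C])
    have sumf: "integrable lebesgue (\<lambda>x. \<Sum>b\<in>Basis. f (u x) * (Du x \<bullet> b) * \<beta> b x)"
      by (intro Bochner_Integration.integrable_sum fi)
    have "(LINT x|lebesgue. L n x) = - (LINT x|lebesgue. \<phi> n x * (x \<bullet> Du x) * g x)"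
    proof -
      have "L n x = ((DIM('a) / 2 - 1) * \<phi> n x + (x \<bullet> grad (\<phi> n) x) / 2) * (norm (Du x))\<^sup>2
            - (x \<bullet> Du x) * (grad (\<phi> n) x \<bullet> Du x)" for x
        by (simp add: L_def grad\<phi> N_def power2_norm_eq_inner power2_eq_square[of "x \<bullet> Du x"] mult_ac)
      moreover have "R n + 1 > 0" using R[of n] by simp
      ultimately show ?thesis
        using pohozaev_local[where R = "R n" and \<phi> = "\<phi> n", OF wg D2 g g2 eq \<phi> \<phi>0] by simp
    qed
    also have "(LINT x|lebesgue. \<phi> n x * (x \<bullet> Du x) * g x) = (LINT x|lebesgue. (\<Sum>b\<in>Basis. f (u x) * (Du x \<bullet> b) * \<beta> b x) - \<phi> n x * T x)"
    proof (intro Bochner_Integration.integral_cong refl)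
      fix x
      have "(\<Sum>b\<in>Basis. f (u x) * (Du x \<bullet> b) * \<beta> b x) = f (u x) * \<phi> n x * (x \<bullet> Du x)"
        by (simp add: \<beta>_def euclidean_inner[of x "Du x"] sum_distrib_left mult_ac)
      then show "\<phi> n x * (x \<bullet> Du x) * g x = (\<Sum>b\<in>Basis. f (u x) * (Du x \<bullet> b) * \<beta> b x) - \<phi> n x * T x"
        by (simp add: g_def T_def algebra_simps)
    qed
    also have "\<dots> = (\<Sum>b\<in>Basis. LINT x|lebesgue. f (u x) * (Du x \<bullet> b) * \<beta> b x) - (LINT x|lebesgue. \<phi> n x * T x)"
      using sumf i\<phi>T fi by (simp add: Bochner_Integration.integral_sum)
    also have "(\<Sum>b\<in>Basis. LINT x|lebesgue. f (u x) * (Du x \<bullet> b) * \<beta> b x) = - (\<Sum>b\<in>Basis. LINT x|lebesgue. primitive f (u x) * pd b (\<beta> b) x)"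
      by (simp add: fe sum_negf)
    also have "(\<Sum>b\<in>Basis. LINT x|lebesgue. primitive f (u x) * pd b (\<beta> b) x) = (LINT x|lebesgue. (\<Sum>b\<in>Basis. primitive f (u x) * pd b (\<beta> b) x))"
      by (rule Bochner_Integration.integral_sum[symmetric]) (rule iF)
    also have "\<dots> = (LINT x|lebesgue. (N * \<phi> n x + \<kappa> n x * (norm x)\<^sup>2) * primitive f (u x))"
    proof (intro Bochner_Integration.integral_cong refl)
      fix x
      have "(\<Sum>b\<in>Basis. primitive f (u x) * pd b (\<beta> b) x) = primitive f (u x) * (\<Sum>b\<in>Basis. \<phi> n x + \<kappa> n x * ((x \<bullet> b) * (x \<bullet> b)))"
        by (simp add: sum_distrib_left pd\<beta>)
      also have "(\<Sum>b\<in>Basis. \<phi> n x + \<kappa> n x * ((x \<bullet> b) * (x \<bullet> b))) = N * \<phi> n x + \<kappa> n x * (norm x)\<^sup>2"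
        by (simp add: sum.distrib N_def power2_norm_eq_inner euclidean_inner[of x x] flip: sum_distrib_left)
      finally show "(\<Sum>b\<in>Basis. primitive f (u x) * pd b (\<beta> b) x) = (N * \<phi> n x + \<kappa> n x * (norm x)\<^sup>2) * primitive f (u x)"
        by (simp add: mult.commute)
    qed
    finally show ?thesis by simp
  qed
  have lim1: "(\<lambda>n. LINT x|lebesgue. L n x) \<longlonglongrightarrow> (LINT x|lebesgue. (N / 2 - 1) * (norm (Du x))\<^sup>2)"
  proof (rule integral_dominated_convergence[where w = "\<lambda>x. ((N / 2 - 1) * C + 2 * C) * (norm (Du x))\<^sup>2"])
    show "AE x in lebesgue. (\<lambda>n. L n x) \<longlonglongrightarrow> (N / 2 - 1) * (norm (Du x))\<^sup>2"
    proof (rule AE_I2)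
      fix x
      have "(\<lambda>n. L n x) \<longlonglongrightarrow> ((N / 2 - 1) * 1 + 0 * (norm x)\<^sup>2 / 2) * (norm (Du x))\<^sup>2 - 0 * (x \<bullet> Du x)\<^sup>2"
        unfolding L_def by (intro tendsto_intros \<phi>lim \<kappa>lim) auto
      then show "(\<lambda>n. L n x) \<longlonglongrightarrow> (N / 2 - 1) * (norm (Du x))\<^sup>2" by simp
    qed
    show "integrable lebesgue (\<lambda>x. ((N / 2 - 1) * C + 2 * C) * (norm (Du x))\<^sup>2)" using D2 by simp
    show "AE x in lebesgue. norm (L n x) \<le> ((N / 2 - 1) * C + 2 * C) * (norm (Du x))\<^sup>2" for n
    proof (rule AE_I2)
      fix x
      let ?D = "(norm (Du x))\<^sup>2"
      have "(N / 2 - 1) * \<bar>\<phi> n x\<bar> \<le> (N / 2 - 1) * C" using N by (intro mult_left_mono \<phi>C) auto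
      moreover have "\<bar>\<kappa> n x * (norm x)\<^sup>2 / 2\<bar> \<le> C" using \<kappa>C[of n x] C0 by (simp add: abs_mult)
      moreover have "\<bar>(N / 2 - 1) * \<phi> n x\<bar> = (N / 2 - 1) * \<bar>\<phi> n x\<bar>" using N by (simp add: abs_mult)
      ultimately have "\<bar>(N / 2 - 1) * \<phi> n x + \<kappa> n x * (norm x)\<^sup>2 / 2\<bar> \<le> (N / 2 - 1) * C + C" by linarith
      from mult_right_mono[OF this, of ?D]
      have 1: "\<bar>((N / 2 - 1) * \<phi> n x + \<kappa> n x * (norm x)\<^sup>2 / 2) * ?D\<bar> \<le> ((N / 2 - 1) * C + C) * ?D"
        by (simp add: abs_mult)
      have "(x \<bullet> Du x)\<^sup>2 \<le> (norm x)\<^sup>2 * ?D"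
        using Cauchy_Schwarz_ineq[of x "Du x"] by (simp add: power2_norm_eq_inner)
      from mult_left_mono[OF this, of "\<bar>\<kappa> n x\<bar>"] mult_right_mono[OF \<kappa>C[of n x], of ?D]
      have 2: "\<bar>\<kappa> n x * (x \<bullet> Du x)\<^sup>2\<bar> \<le> C * ?D" by (simp add: abs_mult mult.assoc)
      show "norm (L n x) \<le> ((N / 2 - 1) * C + 2 * C) * ?D"
      proof -
        have "norm (L n x) \<le> ((N / 2 - 1) * C + C) * ?D + C * ?D"
          unfolding L_def real_norm_def using 1 2 by linarith
        then show ?thesis by (simp add: algebra_simps)
      qed
    qed
    show "L n \<in> borel_measurable lebesgue" for n unfolding L_def[abs_def] by measurable
  qed measurable
  have lim2: "(\<lambda>n. LINT x|lebesgue. (N * \<phi> n x + \<kappa> n x * (norm x)\<^sup>2) * primitive f (u x)) \<longlonglongrightarrow> (LINT x|lebesgue. N * primitive f (u x))"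
  proof (rule integral_dominated_convergence[where w = "\<lambda>x. (N * C + C) * \<bar>primitive f (u x)\<bar>"])
    show "AE x in lebesgue. (\<lambda>n. (N * \<phi> n x + \<kappa> n x * (norm x)\<^sup>2) * primitive f (u x)) \<longlonglongrightarrow> N * primitive f (u x)"
    proof (rule AE_I2)
      fix x
      have "(\<lambda>n. (N * \<phi> n x + \<kappa> n x * (norm x)\<^sup>2) * primitive f (u x)) \<longlonglongrightarrow> (N * 1 + 0 * (norm x)\<^sup>2) * primitive f (u x)"
        by (intro tendsto_intros \<phi>lim \<kappa>lim)
      then show "(\<lambda>n. (N * \<phi> n x + \<kappa> n x * (norm x)\<^sup>2) * primitive f (u x)) \<longlonglongrightarrow> N * primitive f (u x)" by simp
    qed
    show "integrable lebesgue (\<lambda>x. (N * C + C) * \<bar>primitive f (u x)\<bar>)" using Fi by simp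
    show "AE x in lebesgue. norm ((N * \<phi> n x + \<kappa> n x * (norm x)\<^sup>2) * primitive f (u x)) \<le> (N * C + C) * \<bar>primitive f (u x)\<bar>" for n
    proof (rule AE_I2)
      fix x
      have "N * \<bar>\<phi> n x\<bar> \<le> N * C" using N by (intro mult_left_mono \<phi>C) auto
      moreover have "\<bar>N * \<phi> n x\<bar> = N * \<bar>\<phi> n x\<bar>" using N by (simp add: abs_mult)
      moreover have "\<bar>\<kappa> n x * (norm x)\<^sup>2\<bar> \<le> C" using \<kappa>C[of n x] by (simp add: abs_mult)
      ultimately have "\<bar>N * \<phi> n x + \<kappa> n x * (norm x)\<^sup>2\<bar> \<le> N * C + C" by linarith
      from mult_right_mono[OF this, of "\<bar>primitive f (u x)\<bar>"]
      show "norm ((N * \<phi> n x + \<kappa> n x * (norm x)\<^sup>2) * primitive f (u x)) \<le> (N * C + C) * \<bar>primitive f (u x)\<bar>"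
        by (simp add: abs_mult)
    qed
  qed measurable
  have lim3: "(\<lambda>n. LINT x|lebesgue. \<phi> n x * T x) \<longlonglongrightarrow> (LINT x|lebesgue. T x)"
  proof (rule integral_dominated_convergence[where w = "\<lambda>x. C * \<bar>T x\<bar>"])
    show "AE x in lebesgue. (\<lambda>n. \<phi> n x * T x) \<longlonglongrightarrow> T x"
    proof (rule AE_I2)
      fix x
      have "(\<lambda>n. \<phi> n x * T x) \<longlonglongrightarrow> 1 * T x" by (intro tendsto_intros \<phi>lim)
      then show "(\<lambda>n. \<phi> n x * T x) \<longlonglongrightarrow> T x" by simp
    qed
    show "integrable lebesgue (\<lambda>x. C * \<bar>T x\<bar>)" using Ti by simp
    show "AE x in lebesgue. norm (\<phi> n x * T x) \<le> C * \<bar>T x\<bar>" for n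
      by (intro AE_I2) (auto simp: abs_mult intro!: mult_right_mono \<phi>C)
  qed measurable
  have "(LINT x|lebesgue. (N / 2 - 1) * (norm (Du x))\<^sup>2) = (LINT x|lebesgue. N * primitive f (u x)) + (LINT x|lebesgue. T x)"
    by (rule LIMSEQ_unique[OF lim1]) (unfold ident, intro tendsto_add lim2 lim3)
  then show "(real DIM('a) - 2) / 2 * (LINT x|lebesgue. (norm (Du x))\<^sup>2)
      - real DIM('a) * (LINT x|lebesgue. primitive f (u x))
      - (LINT x|lebesgue. V x * u x * (x \<bullet> Du x)) = 0"
    by (simp add: N_def T_def[abs_def] diff_divide_distrib)
qed

theorem proposition2p3:
  fixes f :: "real \<Rightarrow> real"
    and V u :: "real ^ 'n \<Rightarrow> real"
    and Du :: "real ^ 'n \<Rightarrow> real ^ 'n"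
    and s q c :: real
  assumes "CARD('n) \<ge> 3"
    and "1 < s" "s \<le> 2"
    and "2 < q" "q < 2 * real CARD('n) / (real CARD('n) - 2)"
    and "continuous_on UNIV f"
    and "c > 0"
    and "\<forall>t. \<bar>f t\<bar> \<le> c * (\<bar>t\<bar> powr (q - 1) + \<bar>t\<bar> powr (s - 1))"
    and "V \<in> Linf_loc"
    and "u \<in> H1 \<inter> Lp s"
    and "weak_solution V f u Du"
    and "integrable lebesgue (\<lambda>x. V x * norm x * \<bar>u x\<bar> * norm (Du x))"
  shows "integrable lebesgue (\<lambda>x. primitive f (u x)) \<and>
    (real CARD('n) - 2) / 2 * (\<integral>x. (norm (Du x))\<^sup>2 \<partial>lebesgue)
      - real CARD('n) * (\<integral>x. primitive f (u x) \<partial>lebesgue)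
      - (\<integral>x. V x * u x * (x \<bullet> Du x) \<partial>lebesgue) = 0"
  using pohozaev_identity[of s q f c V u Du] assms by simp

end
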